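(* The restriction of the 2-adjunction $\mathsf{RaPar}\dashv\mathsf{Total}:\mathfrak{SplitRangeCat}\to\mathfrak{StableFact}$ to its fixed objects is the Cockett-Guo-Hofstra 2-equivalence of $\mathfrak{SplitRangeCat}$ with the full subcategory $\mathfrak{StableFact}_{\mathrm{mono}}$ of $\mathfrak{StableFact}$ given by categories $\mathcal C$ equipped with a relatively stable factorization system $(\mathcal P,\mathcal S)$ with $\mathcal S$ a class of monomorphisms in $\mathcal C$. That is: the counit $\varepsilon_{\mathcal X}$ is an isomorphism for every split range category $\mathcal X$; the unit $\eta_{(\mathcal C,\mathcal P,\mathcal S)}$ is an isomorphism if and only if $\mathcal S$ is a class of monomorphisms in $\mathcal C$; and $\mathsf{RaPar}$, $\mathsf{Total}$ restrict to a 2-equivalence between $\mathfrak{StableFact}_{\mathrm{mono}}$ and $\mathfrak{SplitRangeCat}$.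
   Context: The 2-category $\mathfrak{StableFact}$ (very large): objects are triples $(\mathcal C,\mathcal P,\mathcal S)$ where $\mathcal C$ is a category equipped with an orthogonal factorization system $(\mathcal P,\mathcal S)$ which is relatively stable, i.e. $\mathcal C$ has pullbacks along $\mathcal S$-morphisms and $\mathcal P$ is stable under them; 1-cells $F:(\mathcal C,\mathcal P,\mathcal S)\to(\mathcal D,\mathcal Q,\mathcal T)$ are functors with $F(\mathcal P)\subseteq\mathcal Q$, $F(\mathcal S)\subseteq\mathcal T$ which preserve pullbacks along $\mathcal S$-morphisms; 2-cells are natural transformations whose naturality squares involving $\mathcal S$-morphisms are pullback squares. Restriction and range categories: a restriction structure on a category assigns to each $f:A\to B$ a morphism $\bar f:A\to A$ such that (R1) $f\cdot\bar f=f$; (R2) $\bar f\cdot\bar g=\bar g\cdot\bar f$ if $\mathrm{dom}f=\mathrm{dom}g$; (R3) $\overline{g\cdot\bar f}=\bar g\cdot\bar f$ if $\mathrm{dom}f=\mathrm{dom}g$; (R4) $\bar g\cdot f=f\cdot\overline{g\cdot f}$ if $\mathrm{cod}f=\mathrm{dom}g$. It is split if every $e$ with $\bar e=e$ splits ($e=m\cdot r$, $r\cdot m=1$ for some $m,r$). A range structure on a restriction category assigns to each $f:A\to B$ a morphism $\widehat f:B\to B$ such that (RR1) $\overline{\widehat f}=\widehat f$; (RR2) $\widehat f\cdot f=f$; (RR3) $\widehat{\bar g\cdot f}=\bar g\cdot\widehat f$ if $\mathrm{cod}f=\mathrm{dom}g$; (RR4) $\widehat{g\cdot\widehat f}=\widehat{g\cdot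 f}$ if $\mathrm{cod}f=\mathrm{dom}g$. A split range category is a split restriction category with a range structure. A morphism $f$ is total if $\bar f=1$; $i$ is a restricted isomorphism if there is a (necessarily unique) $i^-$ with $i^-\cdot i=\bar i$, $i\cdot i^-=\overline{i^-}$. $\mathfrak{SplitRangeCat}$ (very large) is the 2-category of split range categories, functors preserving restriction and range operators, and natural transformations with total components. The 2-functor $\mathsf{Total}$ sends $\mathcal X$ to $(\mathsf{Total}(\mathcal X),\mathsf{RaSur}(\mathcal X),\mathsf{ReIso}(\mathcal X))$, where $\mathsf{Total}(\mathcal X)$ is the subcategory of total morphisms (all objects), $\mathsf{RaSur}(\mathcal X)=\{f\mid\bar f=1,\ \widehat f=1\}$, and $\mathsf{ReIso}(\mathcal X)$ is the class of total restricted isomorphisms; on 1-cells it restricts functors, and it keeps 2-cells. The 2-functor $\mathsf{RaPar}$: an $\mathcal S$-span $(s,f):A\to B$ is a pair $s:D\to A$ in $\mathcal S$, $f:D\to B$ in $\mathcal C$; a morphism $x:(s,f)\to(\tilde s,\tilde f)$ is a $\mathcal C$-morphism with $\tilde s\cdot x=s$, $\tilde f\cdot x=f$; isomorphic spans are identified; they form the category $\mathsf{Span}(\mathcal C,\mathcal S)$ (with the objects of $\mathcal C$) under $(t,g)\cdot(s,f)=(s\cdot t',g\cdot f')$, where $f\cdot t'=t\cdot f'$ is a pullback square. An $\mathcal S$-cospan $\langle f,s\rangle:A\to B$ is a pair $f:A\to D$ in $\mathcal C$, $s:B\to D$ in $\mathcal S$; a morphism $v:\langle f,s\rangle\to\langle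 g,t\rangle$ is a $\mathcal C$-morphism with $v\cdot f=g$, $v\cdot s=t$; with pullback squares $f\cdot s'=s\cdot f'$ and $g\cdot t'=t\cdot g'$, its conjugate $v^\star$ is the unique morphism with $t'\cdot v^\star=s'$, $g'\cdot v^\star=f'$. $\mathcal S^\star$ is the class of all existing pullbacks in $\mathcal C$ of conjugates $v^\star$ of $\mathcal S$-cospan morphisms $v$ with $v\in\mathcal S$. $\mathcal S^\circ$ is the least pullback-stable class $\mathcal U$ with $\mathcal S^\star\subseteq\mathcal U\subseteq\mathcal S$ such that for all $p,q\in\mathcal P$, $x\in\mathcal S$, $y\in\mathcal U$, $x\cdot q=p\cdot y$ implies $x\in\mathcal U$. $\sim_{\mathrm z^\circ}$ is the least equivalence relation on $\mathcal S$-spans with $(s,f)\sim_{\mathrm z^\circ}(\tilde s,\tilde f)$ whenever there is a morphism $x:(s,f)\to(\tilde s,\tilde f)$ with $x\in\mathcal S^\circ$ (a congruence). $\mathsf{RaPar}(\mathcal C,\mathcal S)$ (short for $\mathsf{RaPar}(\mathcal C,\mathcal P,\mathcal S)$) is the quotient of $\mathsf{Span}(\mathcal C,\mathcal S)$ by $\sim_{\mathrm z^\circ}$, with morphisms $[s,f]$, restriction $\overline{[s,f]}=[s,s]$ and range $\widehat{[s,f]}=[s_f,s_f]$, where $f=s_f\cdot p_f$ is a $(\mathcal P,\mathcal S)$-factorization. On 1-cells $\mathsf{RaPar}(F)[s,f]=[Fs,Ff]$; a 2-cell $\alpha:F\Rightarrow G$ is sent to the transformation with components $[1_{FA},\alpha_A]$.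 The 2-adjunction $\mathsf{RaPar}\dashv\mathsf{Total}$ has unit $\eta_{(\mathcal C,\mathcal P,\mathcal S)}:(\mathcal C,\mathcal P,\mathcal S)\to\mathsf{Total}(\mathsf{RaPar}(\mathcal C,\mathcal S))$, $f\mapsto[1,f]$, and counit $\varepsilon_{\mathcal X}:\mathsf{RaPar}(\mathsf{Total}(\mathcal X),\mathsf{RaSur}(\mathcal X),\mathsf{ReIso}(\mathcal X))\to\mathcal X$, $[s,f]\mapsto f\cdot s^-$. Fixed objects of the adjunction are the objects at which the unit, respectively the counit, is an isomorphism. The Cockett-Guo-Hofstra 2-equivalence is the one given by $\mathcal X\mapsto(\mathsf{Total}(\mathcal X),\mathsf{RaSur}(\mathcal X),\mathsf{ReIso}(\mathcal X))$ and, for $\mathcal S$ a class of monomorphisms, by $(\mathcal C,\mathcal P,\mathcal S)\mapsto\mathsf{Span}(\mathcal C,\mathcal S)$, which is then isomorphic to $\mathsf{RaPar}(\mathcal C,\mathcal S)$. *)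

theory Defs
  imports "HOL-Library.FuncSet"
begin

section \<open>Categories, functors, transformations\<close>

record ('o, 'm) cat =
  Obj :: "'o set"
  Arr :: "'m set"
  Dom :: "'m \<Rightarrow> 'o"
  Cod :: "'m \<Rightarrow> 'o"
  Ident :: "'o \<Rightarrow> 'm"
  Comp :: "'m \<Rightarrow> 'm \<Rightarrow> 'm"  (infixr "\<cdot>\<index>" 70)

definition hom :: "('o, 'm, 'z) cat_scheme \<Rightarrow> 'o \<Rightarrow> 'o \<Rightarrow> 'm set" where
  "hom C A B = {f \<in> Arr C. Dom C f = A \<and> Cod C f = B}"

locale category =
  fixes C :: "('o, 'm, 'z) cat_scheme" (structure)
  assumes Dom_Obj: "f \<in> Arr C \<Longrightarrow> Dom C f \<in> Obj C"
    and Cod_Obj: "f \<in> Arr C \<Longrightarrow> Cod C f \<in> Obj C"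
    and Ident_hom: "A \<in> Obj C \<Longrightarrow> Ident C A \<in> hom C A A"
    and Comp_hom: "f \<in> hom C A B \<Longrightarrow> g \<in> hom C B D \<Longrightarrow> g \<cdot> f \<in> hom C A D"
    and Comp_Ident_right: "f \<in> hom C A B \<Longrightarrow> f \<cdot> Ident C A = f"
    and Comp_Ident_left: "f \<in> hom C A B \<Longrightarrow> Ident C B \<cdot> f = f"
    and Comp_assoc: "f \<in> hom C A B \<Longrightarrow> g \<in> hom C B D \<Longrightarrow> h \<in> hom C D E
      \<Longrightarrow> (h \<cdot> g) \<cdot> f = h \<cdot> (g \<cdot> f)"

definition is_iso :: "('o, 'm, 'z) cat_scheme \<Rightarrow> 'm \<Rightarrow> bool" where
  "is_iso C f \<longleftrightarrow> f \<in> Arr C \<and> (\<exists>g \<in> hom C (Cod C f) (Dom C f).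
     g \<cdot>\<^bsub>C\<^esub> f = Ident C (Dom C f) \<and> f \<cdot>\<^bsub>C\<^esub> g = Ident C (Cod C f))"

definition is_mono :: "('o, 'm, 'z) cat_scheme \<Rightarrow> 'm \<Rightarrow> bool" where
  "is_mono C m \<longleftrightarrow> m \<in> Arr C \<and>
     (\<forall>A. \<forall>u \<in> hom C A (Dom C m). \<forall>v \<in> hom C A (Dom C m). m \<cdot>\<^bsub>C\<^esub> u = m \<cdot>\<^bsub>C\<^esub> v \<longrightarrow> u = v)"

text \<open>\<open>pullback C f t t' f'\<close>: the square \<open>f \<cdot> t' = t \<cdot> f'\<close> is a pullback; \<open>t'\<close> is the pullback of
  \<open>t\<close> along \<open>f\<close>, and \<open>f'\<close> is the pullback of \<open>f\<close> along \<open>t\<close>.\<close>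

definition pullback :: "('o, 'm, 'z) cat_scheme \<Rightarrow> 'm \<Rightarrow> 'm \<Rightarrow> 'm \<Rightarrow> 'm \<Rightarrow> bool" where
  "pullback C f t t' f' \<longleftrightarrow>
     f \<in> Arr C \<and> t \<in> Arr C \<and> t' \<in> Arr C \<and> f' \<in> Arr C \<and>
     Cod C f = Cod C t \<and> Dom C t' = Dom C f' \<and> Cod C t' = Dom C f \<and> Cod C f' = Dom C t \<and>
     f \<cdot>\<^bsub>C\<^esub> t' = t \<cdot>\<^bsub>C\<^esub> f' \<and>
     (\<forall>A. \<forall>u \<in> hom C A (Dom C f). \<forall>v \<in> hom C A (Dom C t). f \<cdot>\<^bsub>C\<^esub> u = t \<cdot>\<^bsub>C\<^esub> v \<longrightarrow>
        (\<exists>!h. h \<in> hom C A (Dom C t') \<and> t' \<cdot>\<^bsub>C\<^esub> h = u \<and> f' \<cdot>\<^bsub>C\<^esub> h = v))"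

record ('o1, 'm1, 'o2, 'm2) fctr =
  FObj :: "'o1 \<Rightarrow> 'o2"
  FArr :: "'m1 \<Rightarrow> 'm2"

definition is_functor ::
  "('o1, 'm1, 'y) cat_scheme \<Rightarrow> ('o2, 'm2, 'z) cat_scheme \<Rightarrow> ('o1, 'm1, 'o2, 'm2) fctr \<Rightarrow> bool" where
  "is_functor C D F \<longleftrightarrow>
     (\<forall>A \<in> Obj C. FObj F A \<in> Obj D \<and> FArr F (Ident C A) = Ident D (FObj F A)) \<and>
     (\<forall>f \<in> Arr C. FArr F f \<in> hom D (FObj F (Dom C f)) (FObj F (Cod C f))) \<and>
     (\<forall>f \<in> Arr C. \<forall>g \<in> Arr C. Cod C f = Dom C g \<longrightarrow>
        FArr F (g \<cdot>\<^bsub>C\<^esub> f) = FArr F g \<cdot>\<^bsub>D\<^esub> FArr F f)"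

text \<open>Functors and transformations are represented by total HOL functions; equality between them
  means agreement on the objects and morphisms of the domain category.\<close>

definition fctr_eq ::
  "('o1, 'm1, 'y) cat_scheme \<Rightarrow> ('o1, 'm1, 'o2, 'm2) fctr \<Rightarrow> ('o1, 'm1, 'o2, 'm2) fctr \<Rightarrow> bool" where
  "fctr_eq C F G \<longleftrightarrow> (\<forall>A \<in> Obj C. FObj F A = FObj G A) \<and> (\<forall>f \<in> Arr C. FArr F f = FArr G f)"

definition id_fctr :: "('o, 'm, 'o, 'm) fctr" where
  "id_fctr = \<lparr>FObj = (\<lambda>A. A), FArr = (\<lambda>f. f)\<rparr>"

definition comp_fctr ::
  "('o2, 'm2, 'o3, 'm3) fctr \<Rightarrow> ('o1, 'm1, 'o2, 'm2) fctr \<Rightarrow> ('o1, 'm1, 'o3, 'm3) fctr" where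
  "comp_fctr G F = \<lparr>FObj = FObj G \<circ> FObj F, FArr = FArr G \<circ> FArr F\<rparr>"

definition nat_trans ::
  "('o1, 'm1, 'y) cat_scheme \<Rightarrow> ('o2, 'm2, 'z) cat_scheme \<Rightarrow> ('o1, 'm1, 'o2, 'm2) fctr \<Rightarrow>
   ('o1, 'm1, 'o2, 'm2) fctr \<Rightarrow> ('o1 \<Rightarrow> 'm2) \<Rightarrow> bool" where
  "nat_trans C D F G \<alpha> \<longleftrightarrow>
     (\<forall>A \<in> Obj C. \<alpha> A \<in> hom D (FObj F A) (FObj G A)) \<and>
     (\<forall>f \<in> Arr C. \<alpha> (Cod C f) \<cdot>\<^bsub>D\<^esub> FArr F f = FArr G f \<cdot>\<^bsub>D\<^esub> \<alpha> (Dom C f))"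

definition nt_eq :: "('o1, 'm1, 'y) cat_scheme \<Rightarrow> ('o1 \<Rightarrow> 'm2) \<Rightarrow> ('o1 \<Rightarrow> 'm2) \<Rightarrow> bool" where
  "nt_eq C \<alpha> \<beta> \<longleftrightarrow> (\<forall>A \<in> Obj C. \<alpha> A = \<beta> A)"

definition id_nt ::
  "('o2, 'm2, 'z) cat_scheme \<Rightarrow> ('o1, 'm1, 'o2, 'm2) fctr \<Rightarrow> 'o1 \<Rightarrow> 'm2" where
  "id_nt D F = (\<lambda>A. Ident D (FObj F A))"

definition vcomp ::
  "('o2, 'm2, 'z) cat_scheme \<Rightarrow> ('o1 \<Rightarrow> 'm2) \<Rightarrow> ('o1 \<Rightarrow> 'm2) \<Rightarrow> 'o1 \<Rightarrow> 'm2" where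
  "vcomp D \<beta> \<alpha> = (\<lambda>A. \<beta> A \<cdot>\<^bsub>D\<^esub> \<alpha> A)"

text \<open>Horizontal composite of \<open>\<alpha>: F \<Rightarrow> F'\<close> followed by \<open>\<beta>: G \<Rightarrow> G'\<close>, with values in \<open>E\<close>.\<close>

definition hcomp ::
  "('o3, 'm3, 'z) cat_scheme \<Rightarrow> ('o2, 'm2, 'o3, 'm3) fctr \<Rightarrow> ('o1, 'm1, 'o2, 'm2) fctr \<Rightarrow>
   ('o2 \<Rightarrow> 'm3) \<Rightarrow> ('o1 \<Rightarrow> 'm2) \<Rightarrow> 'o1 \<Rightarrow> 'm3" where
  "hcomp E G F' \<beta> \<alpha> = (\<lambda>A. \<beta> (FObj F' A) \<cdot>\<^bsub>E\<^esub> FArr G (\<alpha> A))"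

definition whisker_left ::
  "('o2, 'm2, 'o3, 'm3) fctr \<Rightarrow> ('o1 \<Rightarrow> 'm2) \<Rightarrow> 'o1 \<Rightarrow> 'm3" where
  "whisker_left H \<alpha> = (\<lambda>A. FArr H (\<alpha> A))"

definition whisker_right ::
  "('o2 \<Rightarrow> 'm3) \<Rightarrow> ('o1, 'm1, 'o2, 'm2) fctr \<Rightarrow> 'o1 \<Rightarrow> 'm3" where
  "whisker_right \<beta> H = (\<lambda>A. \<beta> (FObj H A))"


section \<open>Relatively stable factorization systems\<close>

record ('o, 'm) fact_cat = "('o, 'm) cat" +
  PP :: "'m set"
  SS :: "'m set"

locale stable_fact = category C
  for C :: "('o, 'm, 'z) fact_cat_scheme" (structure) +
  assumes PP_Arr: "PP C \<subseteq> Arr C"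
    and SS_Arr: "SS C \<subseteq> Arr C"
    and PP_iso: "p \<in> PP C \<Longrightarrow> is_iso C h \<Longrightarrow> Dom C h = Cod C p \<Longrightarrow> h \<cdot> p \<in> PP C"
    and SS_iso: "s \<in> SS C \<Longrightarrow> is_iso C h \<Longrightarrow> Cod C h = Dom C s \<Longrightarrow> s \<cdot> h \<in> SS C"
    and factorization:
      "f \<in> Arr C \<Longrightarrow> \<exists>p \<in> PP C. \<exists>s \<in> SS C. Cod C p = Dom C s \<and> f = s \<cdot> p"
    and orthogonality:
      "p \<in> PP C \<Longrightarrow> s \<in> SS C \<Longrightarrow> u \<in> hom C (Dom C p) (Dom C s) \<Longrightarrow> v \<in> hom C (Cod C p) (Cod C s)
       \<Longrightarrow> v \<cdot> p = s \<cdot> u \<Longrightarrow> \<exists>!d. d \<in> hom C (Cod C p) (Dom C s) \<and> d \<cdot> p = u \<and> s \<cdot> d = v"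
    and SS_pullback_exists:
      "f \<in> Arr C \<Longrightarrow> s \<in> SS C \<Longrightarrow> Cod C f = Cod C s \<Longrightarrow> \<exists>s' f'. pullback C f s s' f'"
    and PP_stable: "p \<in> PP C \<Longrightarrow> s \<in> SS C \<Longrightarrow> pullback C p s s' p' \<Longrightarrow> p' \<in> PP C"

definition stable_fact_mono :: "('o, 'm, 'z) fact_cat_scheme \<Rightarrow> bool" where
  "stable_fact_mono C \<longleftrightarrow> stable_fact C \<and> (\<forall>s \<in> SS C. is_mono C s)"

definition fact_1cell ::
  "('o1, 'm1) fact_cat \<Rightarrow> ('o2, 'm2) fact_cat \<Rightarrow> ('o1, 'm1, 'o2, 'm2) fctr \<Rightarrow> bool" where
  "fact_1cell C D F \<longleftrightarrow>
     stable_fact C \<and> stable_fact D \<and> is_functor C D F \<and>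
     FArr F ` PP C \<subseteq> PP D \<and> FArr F ` SS C \<subseteq> SS D \<and>
     (\<forall>f s s' f'. s \<in> SS C \<longrightarrow> pullback C f s s' f' \<longrightarrow>
        pullback D (FArr F f) (FArr F s) (FArr F s') (FArr F f'))"

definition fact_2cell ::
  "('o1, 'm1) fact_cat \<Rightarrow> ('o2, 'm2) fact_cat \<Rightarrow> ('o1, 'm1, 'o2, 'm2) fctr \<Rightarrow>
   ('o1, 'm1, 'o2, 'm2) fctr \<Rightarrow> ('o1 \<Rightarrow> 'm2) \<Rightarrow> bool" where
  "fact_2cell C D F G \<alpha> \<longleftrightarrow>
     fact_1cell C D F \<and> fact_1cell C D G \<and> nat_trans C D F G \<alpha> \<and>
     (\<forall>s \<in> SS C. pullback D (\<alpha> (Cod C s)) (FArr G s) (FArr F s) (\<alpha> (Dom C s)))"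

definition fact_iso_1cell ::
  "('o1, 'm1) fact_cat \<Rightarrow> ('o2, 'm2) fact_cat \<Rightarrow> ('o1, 'm1, 'o2, 'm2) fctr \<Rightarrow> bool" where
  "fact_iso_1cell C D F \<longleftrightarrow> fact_1cell C D F \<and>
     (\<exists>G. fact_1cell D C G \<and> fctr_eq C (comp_fctr G F) id_fctr \<and> fctr_eq D (comp_fctr F G) id_fctr)"


section \<open>Split range categories\<close>

record ('o, 'm) range_cat = "('o, 'm) cat" +
  Rst :: "'m \<Rightarrow> 'm"
  Rng :: "'m \<Rightarrow> 'm"

locale split_range_cat = category X
  for X :: "('o, 'm, 'z) range_cat_scheme" (structure) +
  assumes Rst_hom: "f \<in> hom X A B \<Longrightarrow> Rst X f \<in> hom X A A"
    and R1: "f \<in> Arr X \<Longrightarrow> f \<cdot> Rst X f = f"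
    and R2: "f \<in> Arr X \<Longrightarrow> g \<in> Arr X \<Longrightarrow> Dom X f = Dom X g \<Longrightarrow> Rst X f \<cdot> Rst X g = Rst X g \<cdot> Rst X f"
    and R3: "f \<in> Arr X \<Longrightarrow> g \<in> Arr X \<Longrightarrow> Dom X f = Dom X g \<Longrightarrow> Rst X (g \<cdot> Rst X f) = Rst X g \<cdot> Rst X f"
    and R4: "f \<in> Arr X \<Longrightarrow> g \<in> Arr X \<Longrightarrow> Cod X f = Dom X g \<Longrightarrow> Rst X g \<cdot> f = f \<cdot> Rst X (g \<cdot> f)"
    and split: "e \<in> Arr X \<Longrightarrow> Rst X e = e \<Longrightarrow>
      \<exists>m r. r \<in> hom X (Dom X e) (Dom X m) \<and> m \<in> hom X (Dom X m) (Dom X e) \<and>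
        e = m \<cdot> r \<and> r \<cdot> m = Ident X (Dom X m)"
    and Rng_hom: "f \<in> hom X A B \<Longrightarrow> Rng X f \<in> hom X B B"
    and RR1: "f \<in> Arr X \<Longrightarrow> Rst X (Rng X f) = Rng X f"
    and RR2: "f \<in> Arr X \<Longrightarrow> Rng X f \<cdot> f = f"
    and RR3: "f \<in> Arr X \<Longrightarrow> g \<in> Arr X \<Longrightarrow> Cod X f = Dom X g \<Longrightarrow> Rng X (Rst X g \<cdot> f) = Rst X g \<cdot> Rng X f"
    and RR4: "f \<in> Arr X \<Longrightarrow> g \<in> Arr X \<Longrightarrow> Cod X f = Dom X g \<Longrightarrow> Rng X (g \<cdot> Rng X f) = Rng X (g \<cdot> f)"

definition total :: "('o, 'm, 'z) range_cat_scheme \<Rightarrow> 'm \<Rightarrow> bool" where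
  "total X f \<longleftrightarrow> f \<in> Arr X \<and> Rst X f = Ident X (Dom X f)"

definition restricted_inverse :: "('o, 'm, 'z) range_cat_scheme \<Rightarrow> 'm \<Rightarrow> 'm \<Rightarrow> bool" where
  "restricted_inverse X i j \<longleftrightarrow> i \<in> Arr X \<and> j \<in> hom X (Cod X i) (Dom X i) \<and>
     j \<cdot>\<^bsub>X\<^esub> i = Rst X i \<and> i \<cdot>\<^bsub>X\<^esub> j = Rst X j"

definition rinv :: "('o, 'm, 'z) range_cat_scheme \<Rightarrow> 'm \<Rightarrow> 'm" where
  "rinv X i = (THE j. restricted_inverse X i j)"

definition range_1cell ::
  "('o1, 'm1) range_cat \<Rightarrow> ('o2, 'm2) range_cat \<Rightarrow> ('o1, 'm1, 'o2, 'm2) fctr \<Rightarrow> bool" where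
  "range_1cell X Y F \<longleftrightarrow>
     split_range_cat X \<and> split_range_cat Y \<and> is_functor X Y F \<and>
     (\<forall>f \<in> Arr X. FArr F (Rst X f) = Rst Y (FArr F f) \<and> FArr F (Rng X f) = Rng Y (FArr F f))"

definition range_2cell ::
  "('o1, 'm1) range_cat \<Rightarrow> ('o2, 'm2) range_cat \<Rightarrow> ('o1, 'm1, 'o2, 'm2) fctr \<Rightarrow>
   ('o1, 'm1, 'o2, 'm2) fctr \<Rightarrow> ('o1 \<Rightarrow> 'm2) \<Rightarrow> bool" where
  "range_2cell X Y F G \<alpha> \<longleftrightarrow>
     range_1cell X Y F \<and> range_1cell X Y G \<and> nat_trans X Y F G \<alpha> \<and> (\<forall>A \<in> Obj X. total Y (\<alpha> A))"

definition range_iso_1cell ::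
  "('o1, 'm1) range_cat \<Rightarrow> ('o2, 'm2) range_cat \<Rightarrow> ('o1, 'm1, 'o2, 'm2) fctr \<Rightarrow> bool" where
  "range_iso_1cell X Y F \<longleftrightarrow> range_1cell X Y F \<and>
     (\<exists>G. range_1cell Y X G \<and> fctr_eq X (comp_fctr G F) id_fctr \<and> fctr_eq Y (comp_fctr F G) id_fctr)"


section \<open>The 2-functor Total\<close>

definition RaSur :: "('o, 'm, 'z) range_cat_scheme \<Rightarrow> 'm set" where
  "RaSur X = {f \<in> Arr X. Rst X f = Ident X (Dom X f) \<and> Rng X f = Ident X (Cod X f)}"

definition ReIso :: "('o, 'm, 'z) range_cat_scheme \<Rightarrow> 'm set" where
  "ReIso X = {i. total X i \<and> (\<exists>j. restricted_inverse X i j)}"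

definition Total :: "('o, 'm) range_cat \<Rightarrow> ('o, 'm) fact_cat" where
  "Total X = \<lparr>Obj = Obj X, Arr = {f. total X f}, Dom = Dom X, Cod = Cod X,
     Ident = Ident X, Comp = Comp X, PP = RaSur X, SS = ReIso X\<rparr>"

definition Total_fctr ::
  "('o1, 'm1) range_cat \<Rightarrow> ('o1, 'm1, 'o2, 'm2) fctr \<Rightarrow> ('o1, 'm1, 'o2, 'm2) fctr" where
  "Total_fctr X F = \<lparr>FObj = FObj F, FArr = restrict (FArr F) (Arr (Total X))\<rparr>"

definition Total_nt :: "('o1 \<Rightarrow> 'm2) \<Rightarrow> 'o1 \<Rightarrow> 'm2" where
  "Total_nt \<alpha> = \<alpha>"


section \<open>Spans, cospans, and the 2-functor RaPar\<close>

definition spans :: "('o, 'm, 'z) fact_cat_scheme \<Rightarrow> ('m \<times> 'm) set" where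
  "spans C = {(s, f). s \<in> SS C \<and> f \<in> Arr C \<and> Dom C s = Dom C f}"

definition span_mor :: "('o, 'm, 'z) fact_cat_scheme \<Rightarrow> 'm \<Rightarrow> 'm \<times> 'm \<Rightarrow> 'm \<times> 'm \<Rightarrow> bool" where
  "span_mor C x a b \<longleftrightarrow> a \<in> spans C \<and> b \<in> spans C \<and> x \<in> hom C (Dom C (fst a)) (Dom C (fst b)) \<and>
     fst b \<cdot>\<^bsub>C\<^esub> x = fst a \<and> snd b \<cdot>\<^bsub>C\<^esub> x = snd a"

definition span_iso :: "('o, 'm, 'z) fact_cat_scheme \<Rightarrow> 'm \<times> 'm \<Rightarrow> 'm \<times> 'm \<Rightarrow> bool" where
  "span_iso C a b \<longleftrightarrow> (\<exists>x. is_iso C x \<and> span_mor C x a b)"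

definition cospans :: "('o, 'm, 'z) fact_cat_scheme \<Rightarrow> ('m \<times> 'm) set" where
  "cospans C = {(f, s). f \<in> Arr C \<and> s \<in> SS C \<and> Cod C f = Cod C s}"

definition cospan_mor :: "('o, 'm, 'z) fact_cat_scheme \<Rightarrow> 'm \<Rightarrow> 'm \<times> 'm \<Rightarrow> 'm \<times> 'm \<Rightarrow> bool" where
  "cospan_mor C v a b \<longleftrightarrow> a \<in> cospans C \<and> b \<in> cospans C \<and> v \<in> hom C (Cod C (fst a)) (Cod C (fst b)) \<and>
     v \<cdot>\<^bsub>C\<^esub> fst a = fst b \<and> v \<cdot>\<^bsub>C\<^esub> snd a = snd b"

text \<open>\<open>w\<close> is the conjugate of the cospan morphism \<open>v\<close> from \<open>(f, s)\<close> to \<open>(g, t)\<close>, for some choice of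
  the two pullbacks.\<close>

definition conjugate ::
  "('o, 'm, 'z) fact_cat_scheme \<Rightarrow> 'm \<Rightarrow> 'm \<times> 'm \<Rightarrow> 'm \<times> 'm \<Rightarrow> 'm \<Rightarrow> bool" where
  "conjugate C v a b w \<longleftrightarrow> cospan_mor C v a b \<and>
     (\<exists>s' f' t' g'. pullback C (fst a) (snd a) s' f' \<and> pullback C (fst b) (snd b) t' g' \<and>
        w \<in> hom C (Dom C s') (Dom C t') \<and> t' \<cdot>\<^bsub>C\<^esub> w = s' \<and> g' \<cdot>\<^bsub>C\<^esub> w = f')"

definition S_star :: "('o, 'm, 'z) fact_cat_scheme \<Rightarrow> 'm set" where
  "S_star C = {u. \<exists>v a b w h k. v \<in> SS C \<and> conjugate C v a b w \<and> pullback C h w u k}"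

definition pullback_stable :: "('o, 'm, 'z) cat_scheme \<Rightarrow> 'm set \<Rightarrow> bool" where
  "pullback_stable C U \<longleftrightarrow> (\<forall>u \<in> U. \<forall>h u' h'. pullback C h u u' h' \<longrightarrow> u' \<in> U)"

definition S_circ :: "('o, 'm, 'z) fact_cat_scheme \<Rightarrow> 'm set" where
  "S_circ C = \<Inter>{U. pullback_stable C U \<and> S_star C \<subseteq> U \<and> U \<subseteq> SS C \<and>
     (\<forall>p \<in> PP C. \<forall>q \<in> PP C. \<forall>x \<in> SS C. \<forall>y \<in> U.
        Dom C q = Dom C y \<and> Cod C q = Dom C x \<and> Cod C y = Dom C p \<and> Cod C x = Cod C p \<and>
        x \<cdot>\<^bsub>C\<^esub> q = p \<cdot>\<^bsub>C\<^esub> y \<longrightarrow> x \<in> U)}"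

inductive z_equiv :: "('o, 'm, 'z) fact_cat_scheme \<Rightarrow> 'm \<times> 'm \<Rightarrow> 'm \<times> 'm \<Rightarrow> bool" for C where
  step: "x \<in> S_circ C \<Longrightarrow> span_mor C x a b \<Longrightarrow> z_equiv C a b"
| refl: "a \<in> spans C \<Longrightarrow> z_equiv C a a"
| sym: "z_equiv C a b \<Longrightarrow> z_equiv C b a"
| trans: "z_equiv C a b \<Longrightarrow> z_equiv C b c \<Longrightarrow> z_equiv C a c"

definition eq_class :: "('a \<Rightarrow> 'a \<Rightarrow> bool) \<Rightarrow> 'a \<Rightarrow> 'a set" where
  "eq_class R a = {b. R a b}"

text \<open>\<open>span_quotient C R\<close> has as morphisms the \<open>R\<close>-classes of spans. An operation on classes is the
  union of the classes of all results obtained from representatives (and from choices of pullbacks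
  or factorizations); this is a single class exactly when the operation is well defined.\<close>

definition span_quotient ::
  "('o, 'm, 'z) fact_cat_scheme \<Rightarrow> ('m \<times> 'm \<Rightarrow> 'm \<times> 'm \<Rightarrow> bool) \<Rightarrow> ('o, ('m \<times> 'm) set) range_cat" where
  "span_quotient C R =
     \<lparr>Obj = Obj C,
      Arr = {eq_class R a | a. a \<in> spans C},
      Dom = (\<lambda>X. the_elem ((\<lambda>(s, f). Cod C s) ` X)),
      Cod = (\<lambda>X. the_elem ((\<lambda>(s, f). Cod C f) ` X)),
      Ident = (\<lambda>A. eq_class R (Ident C A, Ident C A)),
      Comp = (\<lambda>Y X. \<Union>{eq_class R (s \<cdot>\<^bsub>C\<^esub> t', g \<cdot>\<^bsub>C\<^esub> f') | s f t g t' f'.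
                (s, f) \<in> X \<and> (t, g) \<in> Y \<and> pullback C f t t' f'}),
      Rst = (\<lambda>X. \<Union>{eq_class R (s, s) | s f. (s, f) \<in> X}),
      Rng = (\<lambda>X. \<Union>{eq_class R (m, m) | s f m p. (s, f) \<in> X \<and> p \<in> PP C \<and> m \<in> SS C \<and>
                Cod C p = Dom C m \<and> f = m \<cdot>\<^bsub>C\<^esub> p})\<rparr>"

definition span_fctr ::
  "('m2 \<times> 'm2 \<Rightarrow> 'm2 \<times> 'm2 \<Rightarrow> bool) \<Rightarrow> ('o1, 'm1, 'o2, 'm2) fctr \<Rightarrow>
   ('o1, ('m1 \<times> 'm1) set, 'o2, ('m2 \<times> 'm2) set) fctr" where
  "span_fctr R F = \<lparr>FObj = FObj F,
     FArr = (\<lambda>X. \<Union>{eq_class R (FArr F s, FArr F f) | s f. (s, f) \<in> X})\<rparr>"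

text \<open>For \<open>\<alpha>: F \<Rightarrow> G\<close> into \<open>D\<close>.\<close>

definition span_nt ::
  "('o2, 'm2, 'z) fact_cat_scheme \<Rightarrow> ('m2 \<times> 'm2 \<Rightarrow> 'm2 \<times> 'm2 \<Rightarrow> bool) \<Rightarrow>
   ('o1, 'm1, 'o2, 'm2) fctr \<Rightarrow> ('o1 \<Rightarrow> 'm2) \<Rightarrow> 'o1 \<Rightarrow> ('m2 \<times> 'm2) set" where
  "span_nt D R F \<alpha> = (\<lambda>A. eq_class R (Ident D (FObj F A), \<alpha> A))"

text \<open>The relation \<open>z_equiv\<close> already identifies isomorphic spans, because \<open>S_circ\<close> contains all
  isomorphisms: identities are conjugates of identities, and isomorphisms are pullbacks of
  identities. Hence \<open>RaPar C\<close> may be formed directly from spans instead of from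
  isomorphism classes of spans.\<close>

definition RaPar :: "('o, 'm) fact_cat \<Rightarrow> ('o, ('m \<times> 'm) set) range_cat" where
  "RaPar C = span_quotient C (z_equiv C)"

definition RaPar_fctr ::
  "('o2, 'm2) fact_cat \<Rightarrow> ('o1, 'm1, 'o2, 'm2) fctr \<Rightarrow>
   ('o1, ('m1 \<times> 'm1) set, 'o2, ('m2 \<times> 'm2) set) fctr" where
  "RaPar_fctr D F = span_fctr (z_equiv D) F"

definition RaPar_nt ::
  "('o2, 'm2) fact_cat \<Rightarrow> ('o1, 'm1, 'o2, 'm2) fctr \<Rightarrow> ('o1 \<Rightarrow> 'm2) \<Rightarrow> 'o1 \<Rightarrow> ('m2 \<times> 'm2) set" where
  "RaPar_nt D F \<alpha> = span_nt D (z_equiv D) F \<alpha>"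

definition Span :: "('o, 'm) fact_cat \<Rightarrow> ('o, ('m \<times> 'm) set) range_cat" where
  "Span C = span_quotient C (span_iso C)"

definition Span_fctr ::
  "('o2, 'm2) fact_cat \<Rightarrow> ('o1, 'm1, 'o2, 'm2) fctr \<Rightarrow>
   ('o1, ('m1 \<times> 'm1) set, 'o2, ('m2 \<times> 'm2) set) fctr" where
  "Span_fctr D F = span_fctr (span_iso D) F"

definition Span_nt ::
  "('o2, 'm2) fact_cat \<Rightarrow> ('o1, 'm1, 'o2, 'm2) fctr \<Rightarrow> ('o1 \<Rightarrow> 'm2) \<Rightarrow> 'o1 \<Rightarrow> ('m2 \<times> 'm2) set" where
  "Span_nt D F \<alpha> = span_nt D (span_iso D) F \<alpha>"


section \<open>Unit and counit\<close>

definition unit_fctr :: "('o, 'm) fact_cat \<Rightarrow> ('o, 'm, 'o, ('m \<times> 'm) set) fctr" where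
  "unit_fctr C = \<lparr>FObj = (\<lambda>A. A), FArr = (\<lambda>f. eq_class (z_equiv C) (Ident C (Dom C f), f))\<rparr>"

definition counit_fctr :: "('o, 'm) range_cat \<Rightarrow> ('o, ('m \<times> 'm) set, 'o, 'm) fctr" where
  "counit_fctr X = \<lparr>FObj = (\<lambda>A. A), FArr = (\<lambda>K. the_elem ((\<lambda>(s, f). f \<cdot>\<^bsub>X\<^esub> rinv X s) ` K))\<rparr>"

end

theory Submission
  imports Defs
begin

text \<open>If the unit is invertible, it is injective on morphisms; but it identifies the two legs of the
  kernel pair of any \<open>s\<close> in \<open>\<S>\<close>, because the diagonal of that kernel pair and all its pullbacks
  belong to \<open>\<S>\<^sup>\<star>\<close>. So the two legs agree and \<open>s\<close> is monic.

  If conversely \<open>\<S>\<close> consists of monomorphisms, then isomorphisms already form a class with the closure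
  properties that define \<open>\<S>\<^sup>\<circ>\<close>, so \<open>\<S>\<^sup>\<circ>\<close> is the class of isomorphisms and \<open>RaPar\<close> is the category of spans.
  A span \<open>[s, f]\<close> is total exactly when \<open>s\<close> is invertible, which inverts the unit. A morphism \<open>h\<close> of a
  split range category is recovered from the span \<open>[s, h \<cdot> s]\<close>, where \<open>s\<close> splits \<open>Rst h\<close>, which inverts
  the counit.\<close>


section \<open>Categories and pullbacks\<close>

text \<open>The operations of \<open>span_quotient\<close> are unions over all representatives and
  all choices of pullbacks or factorizations, so each becomes usable only once its union is shown to
  collapse to one class. Monic left legs make this cheap: morphisms in both directions between two
  spans are mutually inverse (\<open>span_isoI\<close>), so one construction of a comparison
  morphism, applied twice with the roles exchanged, settles well-definedness. \<open>RaPar\<close>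
  is therefore developed as a 2-functor on monic systems; for the implication from an invertible
  unit to monomorphisms it is enough to compare two explicit classes. On the other side,
  calculations in \<open>Total X\<close> are made equational: a total restricted isomorphism is
  carried together with its restricted inverse as a pair \<open>splits m r\<close>, and pullbacks
  along it are described by restrictions. Orthogonality, stability and preservation by functors then
  become computations with R4, RR3 and RR4. The unit and counit are inverted through bijectivity on
  objects and morphisms, because an inverse functor transports pullbacks and operators
  automatically.\<close>

context category
begin

lemma Arr_hom: "f \<in> Arr C \<Longrightarrow> f \<in> hom C (Dom C f) (Cod C f)"
  by (simp add: hom_def)

lemma Comp_Arr [simp]:
  assumes "f \<in> Arr C" "g \<in> Arr C" "Cod C f = Dom C g"
  shows "g \<cdot> f \<in> Arr C" "Dom C (g \<cdot> f) = Dom C f" "Cod C (g \<cdot> f) = Cod C g"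
  using Comp_hom[of f "Dom C f" "Cod C f" g "Cod C g"] assms by (auto simp: hom_def)

lemma Ident_Arr [simp]:
  assumes "A \<in> Obj C"
  shows "Ident C A \<in> Arr C" "Dom C (Ident C A) = A" "Cod C (Ident C A) = A"
  using Ident_hom[OF assms] by (auto simp: hom_def)

lemma Comp_IdentR [simp]: "f \<in> Arr C \<Longrightarrow> Dom C f = A \<Longrightarrow> f \<cdot> Ident C A = f"
  using Comp_Ident_right[of f A "Cod C f"] by (simp add: hom_def)

lemma Comp_IdentL [simp]: "f \<in> Arr C \<Longrightarrow> Cod C f = A \<Longrightarrow> Ident C A \<cdot> f = f"
  using Comp_Ident_left[of f "Dom C f" A] by (simp add: hom_def)

lemma assoc [simp]:
  "f \<in> Arr C \<Longrightarrow> g \<in> Arr C \<Longrightarrow> h \<in> Arr C \<Longrightarrow> Cod C f = Dom C g \<Longrightarrow> Cod C g = Dom C h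
    \<Longrightarrow> (h \<cdot> g) \<cdot> f = h \<cdot> (g \<cdot> f)"
  using Comp_assoc[of f "Dom C f" "Cod C f" g "Cod C g" h "Cod C h"] by (simp add: hom_def)

text \<open>As a simp rule, \<open>assoc\<close> brackets to the right and so hides a known
  composite \<open>h \<cdot> g\<close> inside \<open>h \<cdot> (g \<cdot> f)\<close>. Instances of
  this lemma make such an equation usable for rewriting again.\<close>

lemma reassoc:
  "h \<cdot> g = k \<Longrightarrow> f \<in> Arr C \<Longrightarrow> g \<in> Arr C \<Longrightarrow> h \<in> Arr C \<Longrightarrow> Cod C f = Dom C g \<Longrightarrow> Cod C g = Dom C h
    \<Longrightarrow> h \<cdot> (g \<cdot> f) = k \<cdot> f"
  by (metis assoc)

declare Dom_Obj [simp] Cod_Obj [simp]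

section \<open>Isomorphisms and monomorphisms\<close>

lemma isoI:
  assumes "f \<in> Arr C" "g \<in> Arr C" "Dom C g = Cod C f" "Cod C g = Dom C f"
    "g \<cdot> f = Ident C (Dom C f)" "f \<cdot> g = Ident C (Cod C f)"
  shows "is_iso C f"
  unfolding is_iso_def using assms by (auto simp: hom_def)

lemma isoE:
  assumes "is_iso C f"
  obtains g where "f \<in> Arr C" "g \<in> Arr C" "Dom C g = Cod C f" "Cod C g = Dom C f"
    "g \<cdot> f = Ident C (Dom C f)" "f \<cdot> g = Ident C (Cod C f)" "is_iso C g"
proof -
  obtain g where "f \<in> Arr C" "g \<in> Arr C" "Dom C g = Cod C f" "Cod C g = Dom C f"
    "g \<cdot> f = Ident C (Dom C f)" "f \<cdot> g = Ident C (Cod C f)"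
    using assms unfolding is_iso_def by (auto simp: hom_def)
  moreover from this have "is_iso C g"
    by (intro isoI[of g f]) auto
  ultimately show thesis by (rule that)
qed

lemma iso_Ident [simp]: "A \<in> Obj C \<Longrightarrow> is_iso C (Ident C A)"
  by (rule isoI[of _ "Ident C A"]) auto

lemma iso_Arr: "is_iso C f \<Longrightarrow> f \<in> Arr C"
  by (simp add: is_iso_def)

lemma iso_comp:
  assumes "is_iso C f" "is_iso C g" "Cod C f = Dom C g"
  shows "is_iso C (g \<cdot> f)"
proof -
  obtain f' where f: "f \<in> Arr C" "f' \<in> Arr C" "Dom C f' = Cod C f" "Cod C f' = Dom C f"
    "f' \<cdot> f = Ident C (Dom C f)" "f \<cdot> f' = Ident C (Cod C f)" using isoE[OF assms(1)] by metis
  obtain g' where g: "g \<in> Arr C" "g' \<in> Arr C" "Dom C g' = Cod C g" "Cod C g' = Dom C g"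
    "g' \<cdot> g = Ident C (Dom C g)" "g \<cdot> g' = Ident C (Cod C g)" using isoE[OF assms(2)] by metis
  show ?thesis
    using f g assms(3)
    by (intro isoI[of _ "f' \<cdot> g'"]) (auto simp: reassoc[OF f(6)] reassoc[OF g(5)])
qed

lemma monoD:
  "is_mono C m \<Longrightarrow> u \<in> Arr C \<Longrightarrow> v \<in> Arr C \<Longrightarrow> Cod C u = Dom C m \<Longrightarrow> Cod C v = Dom C m
    \<Longrightarrow> Dom C u = Dom C v \<Longrightarrow> m \<cdot> u = m \<cdot> v \<Longrightarrow> u = v"
  by (auto simp: is_mono_def hom_def)

lemma monoI:
  "m \<in> Arr C \<Longrightarrow> (\<And>u v. u \<in> Arr C \<Longrightarrow> v \<in> Arr C \<Longrightarrow> Cod C u = Dom C m \<Longrightarrow> Cod C v = Dom C m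
    \<Longrightarrow> Dom C u = Dom C v \<Longrightarrow> m \<cdot> u = m \<cdot> v \<Longrightarrow> u = v) \<Longrightarrow> is_mono C m"
  by (auto simp: is_mono_def hom_def)

text \<open>Cancelling \<open>m\<close> in \<open>m \<cdot> (d \<cdot> m) = m\<close> makes the
  section \<open>d\<close> a two-sided inverse. In the monic case this is how morphisms of
  \<open>SS\<close> are shown to be invertible.\<close>

lemma mono_split_epi_iso:
  assumes m: "is_mono C m" and d: "d \<in> Arr C" "Dom C d = Cod C m" "Cod C d = Dom C m"
    and md: "m \<cdot> d = Ident C (Cod C m)"
  shows "is_iso C m"
proof -
  have mA: "m \<in> Arr C" using m by (simp add: is_mono_def)
  have "d \<cdot> m = Ident C (Dom C m)"
    by (rule monoD[OF m]) (use mA d in \<open>auto simp: reassoc[OF md]\<close>)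
  then show ?thesis using isoI[OF mA d] md by simp
qed

section \<open>Calculus of pullback squares\<close>

lemma pullbackI:
  assumes "f \<in> Arr C" "t \<in> Arr C" "t' \<in> Arr C" "f' \<in> Arr C"
    "Cod C f = Cod C t" "Dom C t' = Dom C f'" "Cod C t' = Dom C f" "Cod C f' = Dom C t"
    "f \<cdot> t' = t \<cdot> f'"
    and ex: "\<And>u v. u \<in> Arr C \<Longrightarrow> v \<in> Arr C \<Longrightarrow> Dom C u = Dom C v \<Longrightarrow> Cod C u = Dom C f
      \<Longrightarrow> Cod C v = Dom C t \<Longrightarrow> f \<cdot> u = t \<cdot> v \<Longrightarrow>
      \<exists>h. h \<in> Arr C \<and> Dom C h = Dom C u \<and> Cod C h = Dom C t' \<and> t' \<cdot> h = u \<and> f' \<cdot> h = v"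
    and uniq: "\<And>h k. h \<in> Arr C \<Longrightarrow> k \<in> Arr C \<Longrightarrow> Dom C h = Dom C k \<Longrightarrow> Cod C h = Dom C t'
      \<Longrightarrow> Cod C k = Dom C t' \<Longrightarrow> t' \<cdot> h = t' \<cdot> k \<Longrightarrow> f' \<cdot> h = f' \<cdot> k \<Longrightarrow> h = k"
  shows "pullback C f t t' f'"
  unfolding pullback_def
proof (intro conjI allI ballI impI assms(1-9))
  fix A u v assume "u \<in> hom C A (Dom C f)" "v \<in> hom C A (Dom C t)" "f \<cdot> u = t \<cdot> v"
  then obtain h where "h \<in> hom C A (Dom C t')" "t' \<cdot> h = u" "f' \<cdot> h = v"
    using ex[of u v] by (auto simp: hom_def)
  then show "\<exists>!h. h \<in> hom C A (Dom C t') \<and> t' \<cdot> h = u \<and> f' \<cdot> h = v"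
    using uniq by (intro ex1I[of _ h]) (auto simp: hom_def)
qed

lemma pullbackD:
  assumes "pullback C f t t' f'"
  shows "f \<in> Arr C" "t \<in> Arr C" "t' \<in> Arr C" "f' \<in> Arr C"
    "Cod C f = Cod C t" "Dom C t' = Dom C f'" "Cod C t' = Dom C f" "Cod C f' = Dom C t"
    "f \<cdot> t' = t \<cdot> f'"
  using assms by (auto simp: pullback_def)

lemma pullback_ex:
  assumes "pullback C f t t' f'" "u \<in> Arr C" "v \<in> Arr C" "Dom C u = Dom C v"
    "Cod C u = Dom C f" "Cod C v = Dom C t" "f \<cdot> u = t \<cdot> v"
  obtains h where "h \<in> Arr C" "Dom C h = Dom C u" "Cod C h = Dom C t'" "t' \<cdot> h = u" "f' \<cdot> h = v"
proof -
  have "u \<in> hom C (Dom C u) (Dom C f)" "v \<in> hom C (Dom C u) (Dom C t)"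
    using assms by (auto simp: hom_def)
  then have "\<exists>h. h \<in> hom C (Dom C u) (Dom C t') \<and> t' \<cdot> h = u \<and> f' \<cdot> h = v"
    using assms(1,7) unfolding pullback_def by blast
  then show thesis using that by (auto simp: hom_def)
qed

lemma pullback_uniq:
  assumes p: "pullback C f t t' f'" and h: "h \<in> Arr C" "k \<in> Arr C" "Dom C h = Dom C k"
    "Cod C h = Dom C t'" "Cod C k = Dom C t'" "t' \<cdot> h = t' \<cdot> k" "f' \<cdot> h = f' \<cdot> k"
  shows "h = k"
proof -
  note d = pullbackD[OF p]
  let ?A = "Dom C h"
  have u: "t' \<cdot> h \<in> hom C ?A (Dom C f)" and v: "f' \<cdot> h \<in> hom C ?A (Dom C t)"
    using d h by (auto simp: hom_def)
  have e: "f \<cdot> (t' \<cdot> h) = t \<cdot> (f' \<cdot> h)"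
    using d h by (simp add: reassoc[OF d(9)])
  have "\<exists>!x. x \<in> hom C ?A (Dom C t') \<and> t' \<cdot> x = t' \<cdot> h \<and> f' \<cdot> x = f' \<cdot> h"
    using p u v e unfolding pullback_def by blast
  moreover have "h \<in> hom C ?A (Dom C t')" "k \<in> hom C ?A (Dom C t')"
    using h by (auto simp: hom_def)
  ultimately show ?thesis using h(6,7) by metis
qed

lemma pullback_sym: "pullback C f t t' f' \<Longrightarrow> pullback C t f f' t'"
proof -
  assume p: "pullback C f t t' f'"
  note d = pullbackD[OF p]
  show ?thesis
  proof (rule pullbackI)
    fix u v assume "u \<in> Arr C" "v \<in> Arr C" "Dom C u = Dom C v" "Cod C u = Dom C t"
      "Cod C v = Dom C f" "t \<cdot> u = f \<cdot> v"
    then show "\<exists>h. h \<in> Arr C \<and> Dom C h = Dom C u \<and> Cod C h = Dom C f' \<and> f' \<cdot> h = u \<and> t' \<cdot> h = v"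
      using pullback_ex[OF p, of v u] d(6) by metis
  next
    fix h k assume "h \<in> Arr C" "k \<in> Arr C" "Dom C h = Dom C k" "Cod C h = Dom C f'"
      "Cod C k = Dom C f'" "f' \<cdot> h = f' \<cdot> k" "t' \<cdot> h = t' \<cdot> k"
    then show "h = k" using pullback_uniq[OF p, of h k] d(6) by simp
  qed (use d in auto)
qed

lemma pullback_paste:
  assumes p: "pullback C f t t' f'" and q: "pullback C g t' t'' g'"
  shows "pullback C (f \<cdot> g) t t'' (f' \<cdot> g')"
proof -
  note d = pullbackD[OF p] and e = pullbackD[OF q]
  show ?thesis
  proof (rule pullbackI)
    show "(f \<cdot> g) \<cdot> t'' = t \<cdot> (f' \<cdot> g')"
      using d e by (simp add: reassoc[OF d(9)])
  next
    fix u v assume a: "u \<in> Arr C" "v \<in> Arr C" "Dom C u = Dom C v" "Cod C u = Dom C (f \<cdot> g)"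
      "Cod C v = Dom C t" "(f \<cdot> g) \<cdot> u = t \<cdot> v"
    obtain h where h: "h \<in> Arr C" "Dom C h = Dom C u" "Cod C h = Dom C t'" "t' \<cdot> h = g \<cdot> u" "f' \<cdot> h = v"
      using pullback_ex[OF p, of "g \<cdot> u" v] a d e by auto
    obtain k where k: "k \<in> Arr C" "Dom C k = Dom C u" "Cod C k = Dom C t''" "t'' \<cdot> k = u" "g' \<cdot> k = h"
      using pullback_ex[OF q, of u h] a d e h by auto
    show "\<exists>h. h \<in> Arr C \<and> Dom C h = Dom C u \<and> Cod C h = Dom C t'' \<and> t'' \<cdot> h = u \<and> (f' \<cdot> g') \<cdot> h = v"
      using k h d e by (intro exI[of _ k]) simp
  next
    fix h k assume a: "h \<in> Arr C" "k \<in> Arr C" "Dom C h = Dom C k" "Cod C h = Dom C t''"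
      "Cod C k = Dom C t''" "t'' \<cdot> h = t'' \<cdot> k" "(f' \<cdot> g') \<cdot> h = (f' \<cdot> g') \<cdot> k"
    have "g' \<cdot> h = g' \<cdot> k"
    proof (rule pullback_uniq[OF p])
      show "t' \<cdot> g' \<cdot> h = t' \<cdot> g' \<cdot> k"
        using a d e reassoc[OF e(9), of h] reassoc[OF e(9), of k] by simp
    qed (use a d e in auto)
    then show "h = k" using pullback_uniq[OF q, of h k] a by simp
  qed (use d e in auto)
qed

lemma pullback_paste':
  assumes "pullback C f t t' f'" and "pullback C f' u u' f''"
  shows "pullback C f (t \<cdot> u) (t' \<cdot> u') f''"
  using assms pullback_paste pullback_sym by blast

text \<open>Pullbacks are determined only up to isomorphism, so every isomorphism \<open>h\<close>
  into the domain of \<open>f\<close> is a pullback of an identity. This puts all isomorphisms into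
  \<open>S_star\<close>.\<close>

lemma pullback_iso:
  assumes f: "f \<in> Arr C" and h: "is_iso C h" "Cod C h = Dom C f"
  shows "pullback C f (Ident C (Cod C f)) h (f \<cdot> h)"
proof -
  obtain k where k: "h \<in> Arr C" "k \<in> Arr C" "Dom C k = Cod C h" "Cod C k = Dom C h"
    "k \<cdot> h = Ident C (Dom C h)" "h \<cdot> k = Ident C (Cod C h)" using isoE[OF h(1)] by metis
  show ?thesis
  proof (rule pullbackI)
    fix u v assume a: "u \<in> Arr C" "v \<in> Arr C" "Dom C u = Dom C v" "Cod C u = Dom C f"
      "Cod C v = Dom C (Ident C (Cod C f))" "f \<cdot> u = Ident C (Cod C f) \<cdot> v"
    have "v = f \<cdot> u" using a f by simp
    moreover have "h \<cdot> (k \<cdot> u) = u" using reassoc[OF k(6), of u] a k h by simp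
    ultimately show "\<exists>h'. h' \<in> Arr C \<and> Dom C h' = Dom C u \<and> Cod C h' = Dom C h \<and> h \<cdot> h' = u \<and> (f \<cdot> h) \<cdot> h' = v"
      using k f h a(1,4) by (intro exI[of _ "k \<cdot> u"]) simp
  next
    fix a b assume a: "a \<in> Arr C" "b \<in> Arr C" "Dom C a = Dom C b" "Cod C a = Dom C h"
      "Cod C b = Dom C h" "h \<cdot> a = h \<cdot> b"
    have "a = k \<cdot> (h \<cdot> a)" using reassoc[OF k(5), of a] a k(1-4) by simp
    also have "\<dots> = k \<cdot> (h \<cdot> b)" using a by simp
    also have "\<dots> = b" using reassoc[OF k(5), of b] a k(1-4) by simp
    finally show "a = b" .
  qed (use k f h in auto)
qed

lemma pullback_Ident: "f \<in> Arr C \<Longrightarrow> pullback C f (Ident C (Cod C f)) (Ident C (Dom C f)) f"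
  using pullback_iso[of f "Ident C (Dom C f)"] by simp

text \<open>Cancelling \<open>m\<close> from \<open>m \<cdot> p \<cdot> u = m \<cdot> v\<close>
  leaves \<open>v = p \<cdot> u\<close>, so \<open>u\<close> serves as its own mediating
  map.\<close>

lemma pullback_mono:
  assumes "is_mono C m" "p \<in> Arr C" "Cod C p = Dom C m"
  shows "pullback C (m \<cdot> p) m (Ident C (Dom C p)) p"
proof -
  have m: "m \<in> Arr C" using assms(1) by (simp add: is_mono_def)
  show ?thesis
  proof (rule pullbackI)
    fix u v assume "u \<in> Arr C" "v \<in> Arr C" "Dom C u = Dom C v" "Cod C u = Dom C (m \<cdot> p)"
      "Cod C v = Dom C m" "(m \<cdot> p) \<cdot> u = m \<cdot> v"
    moreover from this have "p \<cdot> u = v"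
      using m assms by (intro monoD[OF assms(1), of "p \<cdot> u" v]) auto
    ultimately show "\<exists>h. h \<in> Arr C \<and> Dom C h = Dom C u \<and> Cod C h = Dom C (Ident C (Dom C p))
        \<and> Ident C (Dom C p) \<cdot> h = u \<and> p \<cdot> h = v"
      using m assms by (intro exI[of _ u]) auto
  qed (use m assms in auto)
qed

lemma pullback_compare:
  assumes p: "pullback C f t t' f'" and q: "pullback C f t s g"
  obtains h where "is_iso C h" "Dom C h = Dom C s" "Cod C h = Dom C t'" "t' \<cdot> h = s" "f' \<cdot> h = g"
proof -
  note d = pullbackD[OF p] and e = pullbackD[OF q]
  obtain h where h: "h \<in> Arr C" "Dom C h = Dom C s" "Cod C h = Dom C t'" "t' \<cdot> h = s" "f' \<cdot> h = g"
    using pullback_ex[OF p, of s g] d e by metis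
  obtain k where k: "k \<in> Arr C" "Dom C k = Dom C t'" "Cod C k = Dom C s" "s \<cdot> k = t'" "g \<cdot> k = f'"
    using pullback_ex[OF q, of t' f'] d e by metis
  have "h \<cdot> k = Ident C (Dom C t')"
    by (rule pullback_uniq[OF p]) (use h k d e in \<open>auto simp: reassoc[OF h(4)] reassoc[OF h(5)]\<close>)
  moreover have "k \<cdot> h = Ident C (Dom C s)"
    by (rule pullback_uniq[OF q]) (use h k d e in \<open>auto simp: reassoc[OF k(4)] reassoc[OF k(5)]\<close>)
  ultimately have "is_iso C h" using h k by (intro isoI[of h k]) auto
  then show thesis using that h by blast
qed

end


section \<open>Factorization systems\<close>

context stable_fact
begin

lemma PP_ArrD [simp]: "p \<in> PP C \<Longrightarrow> p \<in> Arr C"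
  using PP_Arr by blast

lemma SS_ArrD [simp]: "s \<in> SS C \<Longrightarrow> s \<in> Arr C"
  using SS_Arr by blast

lemma factorE:
  assumes "f \<in> Arr C"
  obtains p m where "p \<in> PP C" "m \<in> SS C" "Cod C p = Dom C m" "Dom C p = Dom C f"
    "Cod C m = Cod C f" "f = m \<cdot> p"
proof -
  obtain p m where a: "p \<in> PP C" "m \<in> SS C" "Cod C p = Dom C m" "f = m \<cdot> p"
    using factorization[OF assms] by blast
  moreover from a have "Dom C p = Dom C f" "Cod C m = Cod C f" by simp_all
  ultimately show thesis using that by blast
qed

lemma fillE:
  assumes "p \<in> PP C" "s \<in> SS C" "u \<in> Arr C" "v \<in> Arr C" "Dom C u = Dom C p" "Cod C u = Dom C s"
    "Dom C v = Cod C p" "Cod C v = Cod C s" "v \<cdot> p = s \<cdot> u"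
  obtains d where "d \<in> Arr C" "Dom C d = Cod C p" "Cod C d = Dom C s" "d \<cdot> p = u" "s \<cdot> d = v"
  using orthogonality[of p s u v] assms by (auto simp: hom_def)

lemma fill_uniq:
  assumes "p \<in> PP C" "s \<in> SS C" "d \<in> Arr C" "e \<in> Arr C" "Dom C d = Cod C p" "Dom C e = Cod C p"
    "Cod C d = Dom C s" "Cod C e = Dom C s" "d \<cdot> p = e \<cdot> p" "s \<cdot> d = s \<cdot> e"
  shows "d = e"
proof -
  have "s \<cdot> (d \<cdot> p) = (s \<cdot> d) \<cdot> p" using assms(1-8) by simp
  then have "\<exists>!x. x \<in> hom C (Cod C p) (Dom C s) \<and> x \<cdot> p = d \<cdot> p \<and> s \<cdot> x = s \<cdot> d"
    using assms(1-8) by (intro orthogonality) (auto simp: hom_def)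
  then show ?thesis using assms by (metis Arr_hom)
qed

text \<open>A retract argument: with \<open>f = m \<cdot> p\<close>, filling \<open>p\<close>
  against \<open>f\<close> gives a left inverse of \<open>p\<close>; uniqueness of fillers between
  \<open>p\<close> and \<open>m\<close> makes it two-sided, so \<open>f\<close> is \<open>m\<close>
  precomposed with an isomorphism. Closure of \<open>SS\<close> under composition and pullback is
  derived from this criterion, the axioms providing only \<open>SS_iso\<close>.\<close>

lemma SS_I:
  assumes f: "f \<in> Arr C"
    and fill: "\<And>p u v. p \<in> PP C \<Longrightarrow> u \<in> Arr C \<Longrightarrow> v \<in> Arr C \<Longrightarrow> Dom C u = Dom C p
      \<Longrightarrow> Cod C u = Dom C f \<Longrightarrow> Dom C v = Cod C p \<Longrightarrow> Cod C v = Cod C f \<Longrightarrow> v \<cdot> p = f \<cdot> u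
      \<Longrightarrow> \<exists>d. d \<in> Arr C \<and> Dom C d = Cod C p \<and> Cod C d = Dom C f \<and> d \<cdot> p = u \<and> f \<cdot> d = v"
  shows "f \<in> SS C"
proof -
  obtain p m where pm: "p \<in> PP C" "m \<in> SS C" "Cod C p = Dom C m" "Dom C p = Dom C f"
    "Cod C m = Cod C f" "f = m \<cdot> p" by (rule factorE[OF f])
  obtain d where d: "d \<in> Arr C" "Dom C d = Cod C p" "Cod C d = Dom C f"
      "d \<cdot> p = Ident C (Dom C f)" "f \<cdot> d = m"
    using fill[of p "Ident C (Dom C f)" m] pm(1-5) f by (auto simp: pm(6)[symmetric])
  have "p \<cdot> d = Ident C (Cod C p)"
  proof (rule fill_uniq[OF pm(1,2)])
    show "m \<cdot> p \<cdot> d = m \<cdot> Ident C (Cod C p)"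
      using pm(1-5) d(1-3,5) by (simp add: reassoc[OF pm(6)[symmetric]])
  qed (use pm(1-5) d(1-4) f in auto)
  then have "is_iso C p" using d(1-4) pm(1-5) by (intro isoI[of p d]) auto
  then show ?thesis using SS_iso[of m p] pm(1-5) by (simp add: pm(6)[symmetric])
qed

text \<open>The dual retract argument: filling \<open>f\<close> against \<open>m\<close> gives a
  right inverse of \<open>m\<close>, which uniqueness makes two-sided, so \<open>f\<close> is
  \<open>p\<close> followed by an isomorphism.\<close>

lemma PP_I:
  assumes f: "f \<in> Arr C"
    and fill: "\<And>s u v. s \<in> SS C \<Longrightarrow> u \<in> Arr C \<Longrightarrow> v \<in> Arr C \<Longrightarrow> Dom C u = Dom C f
      \<Longrightarrow> Cod C u = Dom C s \<Longrightarrow> Dom C v = Cod C f \<Longrightarrow> Cod C v = Cod C s \<Longrightarrow> v \<cdot> f = s \<cdot> u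
      \<Longrightarrow> \<exists>d. d \<in> Arr C \<and> Dom C d = Cod C f \<and> Cod C d = Dom C s \<and> d \<cdot> f = u \<and> s \<cdot> d = v"
  shows "f \<in> PP C"
proof -
  obtain p m where pm: "p \<in> PP C" "m \<in> SS C" "Cod C p = Dom C m" "Dom C p = Dom C f"
    "Cod C m = Cod C f" "f = m \<cdot> p" by (rule factorE[OF f])
  obtain d where d: "d \<in> Arr C" "Dom C d = Cod C f" "Cod C d = Dom C m"
      "d \<cdot> f = p" "m \<cdot> d = Ident C (Cod C f)"
    using fill[of m p "Ident C (Cod C f)"] pm(1-5) f by (auto simp: pm(6)[symmetric])
  have "d \<cdot> m = Ident C (Dom C m)"
  proof (rule fill_uniq[OF pm(1,2)])
    show "(d \<cdot> m) \<cdot> p = Ident C (Dom C m) \<cdot> p"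
      using pm(1-5) d(1-4) by (simp add: pm(6)[symmetric])
    show "m \<cdot> d \<cdot> m = m \<cdot> Ident C (Dom C m)"
      using pm(1-5) d(1-3) by (simp add: reassoc[OF d(5)])
  qed (use pm(1-5) d(1-3) f in auto)
  then have "is_iso C m" using d(1-3,5) pm(1-5) by (intro isoI[of m d]) auto
  then show ?thesis using PP_iso[of p m] pm(1-5) by (simp add: pm(6)[symmetric])
qed

lemma iso_SS: assumes "is_iso C f" shows "f \<in> SS C"
proof (rule SS_I)
  obtain g where g: "f \<in> Arr C" "g \<in> Arr C" "Dom C g = Cod C f" "Cod C g = Dom C f"
    "g \<cdot> f = Ident C (Dom C f)" "f \<cdot> g = Ident C (Cod C f)" using isoE[OF assms] by metis
  show "f \<in> Arr C" by (rule g)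
  fix p u v assume a: "p \<in> PP C" "u \<in> Arr C" "v \<in> Arr C" "Dom C u = Dom C p"
    "Cod C u = Dom C f" "Dom C v = Cod C p" "Cod C v = Cod C f" "v \<cdot> p = f \<cdot> u"
  have "(g \<cdot> v) \<cdot> p = u"
    using a g(1-4) by (simp add: reassoc[OF g(5)])
  moreover have "f \<cdot> g \<cdot> v = v"
    using a(1-7) g(1-4) by (simp add: reassoc[OF g(6)])
  ultimately show "\<exists>d. d \<in> Arr C \<and> Dom C d = Cod C p \<and> Cod C d = Dom C f \<and> d \<cdot> p = u \<and> f \<cdot> d = v"
    using a(1-7) g(1-4) by (intro exI[of _ "g \<cdot> v"]) simp
qed

lemma iso_PP: assumes "is_iso C f" shows "f \<in> PP C"
proof (rule PP_I)
  obtain g where g: "f \<in> Arr C" "g \<in> Arr C" "Dom C g = Cod C f" "Cod C g = Dom C f"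
    "g \<cdot> f = Ident C (Dom C f)" "f \<cdot> g = Ident C (Cod C f)" using isoE[OF assms] by metis
  show "f \<in> Arr C" by (rule g)
  fix s u v assume a: "s \<in> SS C" "u \<in> Arr C" "v \<in> Arr C" "Dom C u = Dom C f"
    "Cod C u = Dom C s" "Dom C v = Cod C f" "Cod C v = Cod C s" "v \<cdot> f = s \<cdot> u"
  have "s \<cdot> u \<cdot> g = v"
    using a(1-7) g(1-4,6) by (simp add: reassoc[OF a(8)[symmetric]])
  moreover have "(u \<cdot> g) \<cdot> f = u"
    using a(1-7) g(1-5) by simp
  ultimately show "\<exists>d. d \<in> Arr C \<and> Dom C d = Cod C f \<and> Cod C d = Dom C s \<and> d \<cdot> f = u \<and> s \<cdot> d = v"
    using a(1-7) g(1-4) by (intro exI[of _ "u \<cdot> g"]) simp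
qed

lemma Ident_SS [simp]: "A \<in> Obj C \<Longrightarrow> Ident C A \<in> SS C"
  by (simp add: iso_SS)

lemma Ident_PP [simp]: "A \<in> Obj C \<Longrightarrow> Ident C A \<in> PP C"
  by (simp add: iso_PP)

lemma SS_comp [simp]:
  assumes s: "s \<in> SS C" and t: "t \<in> SS C" and c: "Cod C s = Dom C t"
  shows "t \<cdot> s \<in> SS C"
proof (rule SS_I)
  show "t \<cdot> s \<in> Arr C" using assms by simp
  fix p u v assume a: "p \<in> PP C" "u \<in> Arr C" "v \<in> Arr C" "Dom C u = Dom C p"
    "Cod C u = Dom C (t \<cdot> s)" "Dom C v = Cod C p" "Cod C v = Cod C (t \<cdot> s)" "v \<cdot> p = (t \<cdot> s) \<cdot> u"
  obtain d where d: "d \<in> Arr C" "Dom C d = Cod C p" "Cod C d = Dom C t" "d \<cdot> p = s \<cdot> u" "t \<cdot> d = v"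
    by (rule fillE[OF a(1) t, of "s \<cdot> u" v]) (use a assms in auto)
  obtain e where e: "e \<in> Arr C" "Dom C e = Cod C p" "Cod C e = Dom C s" "e \<cdot> p = u" "s \<cdot> e = d"
    by (rule fillE[OF a(1) s, of u d]) (use a d assms in auto)
  then show "\<exists>d. d \<in> Arr C \<and> Dom C d = Cod C p \<and> Cod C d = Dom C (t \<cdot> s) \<and> d \<cdot> p = u \<and> (t \<cdot> s) \<cdot> d = v"
    using a(1-7) d assms by (intro exI[of _ e]) simp
qed

lemma PP_comp [simp]:
  assumes p: "p \<in> PP C" and q: "q \<in> PP C" and c: "Cod C p = Dom C q"
  shows "q \<cdot> p \<in> PP C"
proof (rule PP_I)
  show "q \<cdot> p \<in> Arr C" using assms by simp
  fix s u v assume a: "s \<in> SS C" "u \<in> Arr C" "v \<in> Arr C" "Dom C u = Dom C (q \<cdot> p)"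
    "Cod C u = Dom C s" "Dom C v = Cod C (q \<cdot> p)" "Cod C v = Cod C s" "v \<cdot> (q \<cdot> p) = s \<cdot> u"
  obtain d where d: "d \<in> Arr C" "Dom C d = Cod C p" "Cod C d = Dom C s" "d \<cdot> p = u" "s \<cdot> d = v \<cdot> q"
    by (rule fillE[OF p a(1), of u "v \<cdot> q"]) (use a assms in auto)
  obtain e where e: "e \<in> Arr C" "Dom C e = Cod C q" "Cod C e = Dom C s" "e \<cdot> q = d" "s \<cdot> e = v"
    by (rule fillE[OF q a(1), of d v]) (use a d assms in auto)
  then show "\<exists>d. d \<in> Arr C \<and> Dom C d = Cod C (q \<cdot> p) \<and> Cod C d = Dom C s \<and> d \<cdot> (q \<cdot> p) = u \<and> s \<cdot> d = v"
    using a(1-7) d assms by (intro exI[of _ e]) (simp add: reassoc)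
qed

text \<open>A lifting problem against \<open>s'\<close> is first solved against \<open>s\<close> by
  \<open>e\<close>; then \<open>v\<close> and \<open>e\<close> together induce the filler into the
  pullback, and uniqueness for the pullback gives \<open>h \<cdot> p = u\<close>.\<close>

lemma SS_stable:
  assumes s: "s \<in> SS C" and pb: "pullback C f s s' f'"
  shows "s' \<in> SS C"
proof (rule SS_I)
  note d = pullbackD[OF pb]
  show "s' \<in> Arr C" by (rule d)
  fix p u v assume a: "p \<in> PP C" "u \<in> Arr C" "v \<in> Arr C" "Dom C u = Dom C p"
    "Cod C u = Dom C s'" "Dom C v = Cod C p" "Cod C v = Cod C s'" "v \<cdot> p = s' \<cdot> u"
  obtain e where e: "e \<in> Arr C" "Dom C e = Cod C p" "Cod C e = Dom C s" "e \<cdot> p = f' \<cdot> u" "s \<cdot> e = f \<cdot> v"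
    by (rule fillE[OF a(1) s, of "f' \<cdot> u" "f \<cdot> v"]) (use a d in \<open>auto simp: reassoc[OF d(9)]\<close>)
  obtain h where h: "h \<in> Arr C" "Dom C h = Dom C v" "Cod C h = Dom C s'" "s' \<cdot> h = v" "f' \<cdot> h = e"
    by (rule pullback_ex[OF pb, of v e]) (use a d e in auto)
  have "h \<cdot> p = u"
    by (rule pullback_uniq[OF pb]) (use a d e h in \<open>auto simp: reassoc[OF h(4)] reassoc[OF h(5)]\<close>)
  then show "\<exists>d. d \<in> Arr C \<and> Dom C d = Cod C p \<and> Cod C d = Dom C s' \<and> d \<cdot> p = u \<and> s' \<cdot> d = v"
    using h a by auto
qed

lemma SS_pullbackE:
  assumes "f \<in> Arr C" "s \<in> SS C" "Cod C f = Cod C s"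
  obtains s' f' where "pullback C f s s' f'" "s' \<in> SS C" "f' \<in> Arr C" "Dom C s' = Dom C f'"
    "Cod C s' = Dom C f" "Cod C f' = Dom C s" "f \<cdot> s' = s \<cdot> f'"
proof -
  obtain s' f' where p: "pullback C f s s' f'" using SS_pullback_exists[OF assms] by blast
  show thesis by (rule that[OF p SS_stable[OF assms(2) p]]) (use pullbackD[OF p] in auto)
qed

section \<open>The classes \<open>S_star\<close> and \<open>S_circ\<close>, and kernel pairs\<close>

lemma conjugate_in_S_star:
  assumes "v \<in> SS C" "conjugate C v a b w" "pullback C h w u k"
  shows "u \<in> S_star C"
  using assms unfolding S_star_def by blast

lemma S_star_S_circ: "S_star C \<subseteq> S_circ C"
  unfolding S_circ_def by blast

text \<open>The conjugate of \<open>s\<close>, as a morphism of cospans from \<open>\<langle>1, 1\<rangle>\<close> to \<open>\<langle>s, s\<rangle>\<close>, is the diagonal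
  into the kernel pair of \<open>s\<close>.\<close>

lemma diagonal_conjugate:
  assumes s: "s \<in> SS C" and k: "pullback C s s k1 k2"
    and d: "d \<in> Arr C" "Dom C d = Dom C s" "Cod C d = Dom C k1"
      "k1 \<cdot> d = Ident C (Dom C s)" "k2 \<cdot> d = Ident C (Dom C s)"
  shows "conjugate C s (Ident C (Dom C s), Ident C (Dom C s)) (s, s) d"
proof -
  let ?i = "Ident C (Dom C s)"
  have "pullback C ?i ?i ?i ?i" using pullback_Ident[of ?i] s by simp
  moreover have "cospan_mor C s (?i, ?i) (s, s)"
    using s by (auto simp: cospan_mor_def cospans_def hom_def)
  ultimately show ?thesis
    using k d s unfolding conjugate_def by (fastforce simp: hom_def)
qed

lemma diagonalE:
  assumes "s \<in> Arr C" and k: "pullback C s s k1 k2"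
  obtains d where "d \<in> Arr C" "Dom C d = Dom C s" "Cod C d = Dom C k1"
      "k1 \<cdot> d = Ident C (Dom C s)" "k2 \<cdot> d = Ident C (Dom C s)"
  by (rule pullback_ex[OF k, of "Ident C (Dom C s)" "Ident C (Dom C s)"]) (use assms in auto)

lemma iso_in_S_circ:
  assumes "is_iso C u"
  shows "u \<in> S_circ C"
proof -
  obtain h where h: "u \<in> Arr C" "h \<in> Arr C" "Dom C h = Cod C u" "Cod C h = Dom C u"
    "h \<cdot> u = Ident C (Dom C u)" "u \<cdot> h = Ident C (Cod C u)" "is_iso C h"
    by (rule isoE[OF assms])
  let ?i = "Ident C (Dom C u)"
  have i: "?i \<in> SS C" using h by simp
  have k: "pullback C ?i ?i ?i ?i" using pullback_Ident[of ?i] h by simp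
  have "conjugate C ?i (?i, ?i) (?i, ?i) ?i"
    using diagonal_conjugate[OF i k, of ?i] h by simp
  moreover have "pullback C h ?i u ?i"
    using pullback_iso[of h u] h assms by simp
  ultimately show ?thesis
    using conjugate_in_S_star[OF i] S_star_S_circ by blast
qed

lemma z_equiv_class: "z_equiv C a b \<Longrightarrow> eq_class (z_equiv C) a = eq_class (z_equiv C) b"
  unfolding eq_class_def by (blast intro: z_equiv.trans z_equiv.sym)

text \<open>Write \<open>(l1, l2)\<close> for the kernel pair of \<open>k1\<close>. The span \<open>(l1, k2 \<cdot> l2)\<close> restricts to \<open>(1, k2)\<close> along
  the diagonal, and to \<open>(1, k1)\<close> along the pullback of the diagonal of \<open>s\<close> along \<open>l2\<close>; both lie in
  \<open>S_star C\<close>.\<close>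

lemma kernel_pair_identified:
  assumes s: "s \<in> SS C" and k: "pullback C s s k1 k2"
  shows "z_equiv C (Ident C (Dom C k1), k1) (Ident C (Dom C k1), k2)"
proof -
  note kd = pullbackD[OF k]
  let ?K = "Dom C k1"
  let ?i = "Ident C ?K"
  have k1: "k1 \<in> SS C" using SS_stable[OF s k] .
  obtain d where d: "d \<in> Arr C" "Dom C d = Dom C s" "Cod C d = Dom C k1"
      "k1 \<cdot> d = Ident C (Dom C s)" "k2 \<cdot> d = Ident C (Dom C s)"
    by (rule diagonalE[OF kd(1) k])
  obtain l1 l2 where l: "pullback C k1 k1 l1 l2" "l1 \<in> SS C"
    using SS_pullbackE[of k1 k1] k1 by (metis SS_ArrD)
  note ld = pullbackD[OF l(1)]
  obtain e where e: "e \<in> Arr C" "Dom C e = ?K" "Cod C e = Dom C l1" "l1 \<cdot> e = ?i" "l2 \<cdot> e = ?i"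
    by (rule diagonalE[OF ld(1) l(1)])
  have span: "(l1, k2 \<cdot> l2) \<in> spans C" "(?i, k1) \<in> spans C" "(?i, k2) \<in> spans C"
    using l ld kd by (auto simp: spans_def)
  \<comment> \<open>\<open>S_star\<close> collects pullbacks of conjugates, so the diagonal itself
    enters as its own pullback along an identity.\<close>
  have "pullback C (Ident C (Dom C l1)) e e (Ident C ?K)"
    using pullback_sym[OF pullback_Ident[of e]] e by simp
  with e have "e \<in> S_circ C"
    using conjugate_in_S_star[OF k1 diagonal_conjugate[OF k1 l(1) e]] S_star_S_circ by blast
  moreover have "span_mor C e (?i, k2) (l1, k2 \<cdot> l2)"
    using span e ld kd by (auto simp: span_mor_def hom_def)
  ultimately have 2: "z_equiv C (?i, k2) (l1, k2 \<cdot> l2)" by (rule z_equiv.step)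
  \<comment> \<open>The components \<open>1\<close> and \<open>d \<cdot> k1\<close> agree after
    \<open>k1\<close> because \<open>k1 \<cdot> d\<close> is an identity. Following
    \<open>e'\<close> by \<open>k2 \<cdot> l2\<close> gives
    \<open>k2 \<cdot> d \<cdot> k1 = k1\<close>, while \<open>e\<close> gives
    \<open>k2\<close>.\<close>
  obtain e' where e': "e' \<in> Arr C" "Dom C e' = ?K" "Cod C e' = Dom C l1"
      "l1 \<cdot> e' = ?i" "l2 \<cdot> e' = d \<cdot> k1"
    by (rule pullback_ex[OF l(1), of ?i "d \<cdot> k1"])
      (use kd d in \<open>auto simp: reassoc[OF d(4)]\<close>)
  \<comment> \<open>For a cone \<open>l2 \<cdot> u = d \<cdot> v\<close> the mediating map is
    \<open>l1 \<cdot> u\<close>: the chain \<open>k1 \<cdot> l1 \<cdot> u = k1 \<cdot> l2 \<cdot> u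
    = k1 \<cdot> d \<cdot> v = v\<close> recovers \<open>v\<close>. It is unique because
    \<open>e'\<close> has the retraction \<open>l1\<close>.\<close>
  have "pullback C l2 d e' k1"
  proof (rule pullbackI)
    fix u v assume a: "u \<in> Arr C" "v \<in> Arr C" "Dom C u = Dom C v" "Cod C u = Dom C l2"
      "Cod C v = Dom C d" "l2 \<cdot> u = d \<cdot> v"
    have "k1 \<cdot> (l1 \<cdot> u) = k1 \<cdot> (l2 \<cdot> u)" using a(1-5) kd ld(1-8) by (simp add: reassoc[OF ld(9)])
    also have "\<dots> = v" using a d(1-3) kd by (simp add: reassoc[OF d(4)])
    finally have v: "k1 \<cdot> l1 \<cdot> u = v" .
    moreover have "e' \<cdot> l1 \<cdot> u = u"
      by (rule pullback_uniq[OF l(1)])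
        (use a(1-5) e' ld(1-8) kd d v in
          \<open>auto simp: reassoc[OF e'(4)] reassoc[OF e'(5)] a(6)\<close>)
    ultimately show "\<exists>h. h \<in> Arr C \<and> Dom C h = Dom C u \<and> Cod C h = Dom C e' \<and> e' \<cdot> h = u \<and> k1 \<cdot> h = v"
      using a(1-5) ld(1-8) e' by (intro exI[of _ "l1 \<cdot> u"]) simp
  next
    fix h h' assume a: "h \<in> Arr C" "h' \<in> Arr C" "Dom C h = Dom C h'" "Cod C h = Dom C e'"
      "Cod C h' = Dom C e'" "e' \<cdot> h = e' \<cdot> h'"
    have "h = l1 \<cdot> (e' \<cdot> h)" using reassoc[OF e'(4), of h] a(1-5) e'(1-3) ld by simp
    also have "\<dots> = l1 \<cdot> (e' \<cdot> h')" using a by simp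
    also have "\<dots> = h'" using reassoc[OF e'(4), of h'] a(1-5) e'(1-3) ld by simp
    finally show "h = h'" .
  qed (use ld kd d e' in auto)
  with e' have "e' \<in> S_circ C"
    using conjugate_in_S_star[OF s diagonal_conjugate[OF s k d]] S_star_S_circ by blast
  moreover have "span_mor C e' (?i, k1) (l1, k2 \<cdot> l2)"
    using span e' ld kd d by (auto simp: span_mor_def hom_def reassoc[OF d(5)])
  ultimately have "z_equiv C (?i, k1) (l1, k2 \<cdot> l2)" by (rule z_equiv.step)
  with 2 show ?thesis by (blast intro: z_equiv.sym z_equiv.trans)
qed

end

lemma unit_inj_imp_mono:
  fixes C :: "('o, 'm) fact_cat"
  assumes "stable_fact C" and inj: "inj_on (FArr (unit_fctr C)) (Arr C)" and s: "s \<in> SS C"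
  shows "is_mono C s"
proof -
  interpret stable_fact C by fact
  obtain k1 k2 where k: "pullback C s s k1 k2"
    using SS_pullback_exists[of s s] s by auto
  note kd = pullbackD[OF k]
  have "FArr (unit_fctr C) k1 = FArr (unit_fctr C) k2"
    using z_equiv_class[OF kernel_pair_identified[OF s k]] kd by (simp add: unit_fctr_def)
  with inj have e: "k1 = k2" using kd by (auto dest: inj_onD)
  show ?thesis
  proof (rule monoI)
    fix u v assume a: "u \<in> Arr C" "v \<in> Arr C" "Cod C u = Dom C s" "Cod C v = Dom C s"
      "Dom C u = Dom C v" "s \<cdot>\<^bsub>C\<^esub> u = s \<cdot>\<^bsub>C\<^esub> v"
    \<comment> \<open>The induced map into the kernel pair has composites \<open>u\<close> and
      \<open>v\<close> with \<open>k1\<close> and \<open>k2\<close>, which coincide.\<close>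
    show "u = v" by (rule pullback_ex[OF k, of u v]) (use a e in auto)
  qed (use s in simp)
qed


section \<open>The range category of spans of a monic factorization system\<close>

text \<open>The record type is \<open>fact_cat\<close> itself because \<open>RaPar\<close> accepts
  only records without further fields.\<close>

locale mono_fact = stable_fact C for C :: "('o, 'm) fact_cat" (structure) +
  assumes SS_mono [simp]: "s \<in> SS C \<Longrightarrow> is_mono C s"
begin

lemma SS_cancel:
  "s \<in> SS C \<Longrightarrow> u \<in> Arr C \<Longrightarrow> v \<in> Arr C \<Longrightarrow> Cod C u = Dom C s \<Longrightarrow> Cod C v = Dom C s
    \<Longrightarrow> Dom C u = Dom C v \<Longrightarrow> s \<cdot> u = s \<cdot> v \<Longrightarrow> u = v"
  by (rule monoD[OF SS_mono])

text \<open>Composing a cospan with a monomorphism \<open>v\<close> does not change its pullbacks, so conjugates of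
  monomorphisms are invertible.\<close>

lemma conjugate_iso:
  assumes v: "v \<in> SS C" and c: "conjugate C v a b w"
  shows "is_iso C w"
proof -
  obtain f s g t where ab: "a = (f, s)" "b = (g, t)" by fastforce
  obtain s' f' t' g' where p: "pullback C f s s' f'" and q: "pullback C g t t' g'"
    and w: "w \<in> Arr C" "Dom C w = Dom C s'" "Cod C w = Dom C t'" "t' \<cdot> w = s'" "g' \<cdot> w = f'"
    and m: "cospan_mor C v a b"
    using c ab by (auto simp: conjugate_def hom_def)
  have mm: "f \<in> Arr C" "s \<in> SS C" "Cod C f = Cod C s" "g \<in> Arr C" "t \<in> SS C" "Cod C g = Cod C t"
    "Dom C v = Cod C f" "Cod C v = Cod C g" "v \<cdot> f = g" "v \<cdot> s = t"
    using m ab by (auto simp: cospan_mor_def cospans_def hom_def)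
  note d = pullbackD[OF p] and e = pullbackD[OF q]
  have D: "Dom C g = Dom C f" "Dom C t = Dom C s"
    using mm v by (metis Comp_Arr(2) SS_ArrD)+
  \<comment> \<open>Cancelling the monic \<open>v\<close> turns the pullback of
    \<open>(g, t)\<close> into a cone over \<open>(f, s)\<close>; the induced map \<open>x\<close>
    is the inverse of the conjugate.\<close>
  have "f \<cdot> t' = s \<cdot> g'"
  proof (rule SS_cancel[OF v])
    show "v \<cdot> f \<cdot> t' = v \<cdot> s \<cdot> g'"
      using e D mm v by (simp add: reassoc[OF mm(9)] reassoc[OF mm(10)])
  qed (use mm v e D in auto)
  then obtain x where x: "x \<in> Arr C" "Dom C x = Dom C t'" "Cod C x = Dom C s'" "s' \<cdot> x = t'" "f' \<cdot> x = g'"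
    using pullback_ex[OF p, of t' g'] D e by metis
  have "x \<cdot> w = Ident C (Dom C s')"
    by (rule pullback_uniq[OF p]) (use w x d in \<open>auto simp: reassoc[OF x(4)] reassoc[OF x(5)]\<close>)
  moreover have "w \<cdot> x = Ident C (Dom C t')"
    by (rule pullback_uniq[OF q]) (use w x e in \<open>auto simp: reassoc[OF w(4)] reassoc[OF w(5)]\<close>)
  ultimately show ?thesis using w x by (intro isoI[of w x]) auto
qed

text \<open>The inverse of \<open>u\<close> induces a section of \<open>u'\<close>, and
  \<open>u'\<close> is monic because it is a pullback of a morphism of \<open>SS\<close>.\<close>

lemma iso_pullback_stable: "pullback_stable C {f. is_iso C f}"
  unfolding pullback_stable_def
proof (intro ballI allI impI)
  fix u h u' h' assume u: "u \<in> {f. is_iso C f}" and p: "pullback C h u u' h'"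
  note d = pullbackD[OF p]
  obtain w where w: "u \<in> Arr C" "w \<in> Arr C" "Dom C w = Cod C u" "Cod C w = Dom C u"
    "w \<cdot> u = Ident C (Dom C u)" "u \<cdot> w = Ident C (Cod C u)" using u isoE[of u] by auto
  obtain k where k: "k \<in> Arr C" "Dom C k = Dom C h" "Cod C k = Dom C u'"
      "u' \<cdot> k = Ident C (Dom C h)" "h' \<cdot> k = w \<cdot> h"
    by (rule pullback_ex[OF p, of "Ident C (Dom C h)" "w \<cdot> h"])
      (use d w in \<open>auto simp: reassoc[OF w(6)]\<close>)
  have "is_mono C u'" using SS_stable[OF _ p] iso_SS u by simp
  then show "u' \<in> {f. is_iso C f}"
    using mono_split_epi_iso[of u' k] k d by simp
qed

lemma S_circ_iso: "x \<in> S_circ C \<longleftrightarrow> is_iso C x"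
proof
  let ?U = "{f. is_iso C f}"
  assume "x \<in> S_circ C"
  moreover have "S_star C \<subseteq> ?U"
    using conjugate_iso iso_pullback_stable unfolding S_star_def pullback_stable_def by blast
  moreover have "x \<in> ?U" if a: "p \<in> PP C" "q \<in> PP C" "x \<in> SS C" "y \<in> ?U" "Dom C q = Dom C y"
      "Cod C q = Dom C x" "Cod C y = Dom C p" "Cod C x = Cod C p" "x \<cdot> q = p \<cdot> y" for p q x y
  proof -
    obtain z where z: "y \<in> Arr C" "z \<in> Arr C" "Dom C z = Cod C y" "Cod C z = Dom C y"
      "z \<cdot> y = Ident C (Dom C y)" "y \<cdot> z = Ident C (Cod C y)" using isoE[of y] a(4) by auto
    \<comment> \<open>The square \<open>1 \<cdot> p = x \<cdot> (q \<cdot> z)\<close>, with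
      \<open>z\<close> inverse to \<open>y\<close>, has a filler, and this filler is a section of
      the monic \<open>x\<close>.\<close>
    obtain d where d: "d \<in> Arr C" "Dom C d = Cod C p" "Cod C d = Dom C x" "d \<cdot> p = q \<cdot> z"
        "x \<cdot> d = Ident C (Cod C p)"
      by (rule fillE[OF a(1,3), of "q \<cdot> z" "Ident C (Cod C p)"])
        (use a(1-8) z in \<open>auto simp: reassoc[OF a(9)]\<close>)
    then show ?thesis using mono_split_epi_iso[of x d] a by simp
  qed
  moreover have "?U \<subseteq> SS C" using iso_SS by blast
  ultimately have "x \<in> ?U"
    using iso_pullback_stable unfolding S_circ_def by blast
  then show "is_iso C x" by simp
qed (rule iso_in_S_circ)

section \<open>Isomorphism of spans, and classes of spans\<close>

lemma span_mor_spans: "span_mor C x a b \<Longrightarrow> a \<in> spans C \<and> b \<in> spans C"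
  by (simp add: span_mor_def)

lemma in_spans [simp]: "(s, f) \<in> spans C \<longleftrightarrow> s \<in> SS C \<and> f \<in> Arr C \<and> Dom C f = Dom C s"
  by (auto simp: spans_def)

lemma span_mor_iff:
  "span_mor C x (s, f) (t, g) \<longleftrightarrow> (s, f) \<in> spans C \<and> (t, g) \<in> spans C \<and> x \<in> Arr C \<and>
    Dom C x = Dom C s \<and> Cod C x = Dom C t \<and> t \<cdot> x = s \<and> g \<cdot> x = f"
  by (auto simp: span_mor_def hom_def)

lemma span_mor_Cod:
  assumes "span_mor C x (s, f) (t, g)"
  shows "Cod C t = Cod C s" "Cod C g = Cod C f"
  using assms Comp_Arr(3)[of x t] Comp_Arr(3)[of x g] by (simp_all add: span_mor_iff)

text \<open>Since the left legs are monic, there is at most one morphism between two spans.\<close>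

lemma span_isoI:
  assumes "span_mor C x a b" "span_mor C y b a"
  shows "span_iso C a b"
proof -
  obtain s f t g where ab: "a = (s, f)" "b = (t, g)" by fastforce
  have x: "s \<in> SS C" "f \<in> Arr C" "Dom C f = Dom C s" "t \<in> SS C" "g \<in> Arr C" "Dom C g = Dom C t"
    "x \<in> Arr C" "Dom C x = Dom C s" "Cod C x = Dom C t" and tx: "t \<cdot> x = s"
    and y: "y \<in> Arr C" "Dom C y = Dom C t" "Cod C y = Dom C s" and sy: "s \<cdot> y = t"
    using assms by (auto simp: ab span_mor_iff)
  have "y \<cdot> x = Ident C (Dom C s)"
    by (rule SS_cancel[of s]) (use x y tx in \<open>auto simp: reassoc[OF sy]\<close>)
  moreover have "x \<cdot> y = Ident C (Dom C t)"
    by (rule SS_cancel[of t]) (use x y sy in \<open>auto simp: reassoc[OF tx]\<close>)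
  ultimately have "is_iso C x" using x y by (intro isoI[of x y]) auto
  then show ?thesis using assms unfolding span_iso_def by blast
qed

lemma span_iso_refl: "a \<in> spans C \<Longrightarrow> span_iso C a a"
  by (cases a) (auto simp: span_iso_def span_mor_iff intro!: exI[of _ "Ident C (Dom C (fst a))"])

lemma span_iso_sym:
  assumes "span_iso C a b" shows "span_iso C b a"
proof -
  obtain s f t g where ab: "a = (s, f)" "b = (t, g)" by fastforce
  obtain x where "is_iso C x" and x: "s \<in> SS C" "f \<in> Arr C" "Dom C f = Dom C s" "t \<in> SS C"
    "g \<in> Arr C" "Dom C g = Dom C t" "Dom C x = Dom C s" "Cod C x = Dom C t" "t \<cdot> x = s" "g \<cdot> x = f"
    using assms by (auto simp: span_iso_def ab span_mor_iff)
  then obtain y where y: "x \<in> Arr C" "y \<in> Arr C" "Dom C y = Dom C t" "Cod C y = Dom C s"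
    "x \<cdot> y = Ident C (Dom C t)" "is_iso C y" using isoE[of x] by metis
  have "(t \<cdot> x) \<cdot> y = t" "(g \<cdot> x) \<cdot> y = g"
    using x(1-8) y by simp_all
  then have "s \<cdot> y = t" "f \<cdot> y = g" by (simp_all only: x(9,10))
  then have "span_mor C y b a" using x y by (simp add: span_mor_iff ab)
  then show ?thesis using y unfolding span_iso_def by blast
qed

lemma span_iso_trans:
  assumes "span_iso C a b" "span_iso C b c" shows "span_iso C a c"
proof -
  obtain s f t g u h where abc: "a = (s, f)" "b = (t, g)" "c = (u, h)"
    by (metis surj_pair)
  obtain x y where x: "is_iso C x" "span_mor C x a b" "is_iso C y" "span_mor C y b c"
    using assms by (auto simp: span_iso_def)
  have "is_iso C (y \<cdot> x)" using x by (intro iso_comp) (auto simp: abc span_mor_iff)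
  moreover have "span_mor C (y \<cdot> x) a c"
    using x by (auto simp: abc span_mor_iff reassoc)
  ultimately show ?thesis unfolding span_iso_def by blast
qed

text \<open>With \<open>S_circ\<close> reduced to isomorphisms, the generating steps are exactly the
  span isomorphisms, which already form an equivalence relation on spans.\<close>

lemma z_equiv_span_iso: "z_equiv C = span_iso C"
proof (intro ext iffI)
  show "span_iso C a b" if "z_equiv C a b" for a b
    using that
  proof induction
    case (step x a b)
    then show ?case by (auto simp: S_circ_iso span_iso_def)
  qed (blast intro: span_iso_refl span_iso_sym span_iso_trans)+
  show "z_equiv C a b" if "span_iso C a b" for a b
    using that by (auto simp: span_iso_def S_circ_iso intro: z_equiv.step)
qed

lemma RaPar_Span: "RaPar C = Span C"
  by (simp add: RaPar_def Span_def z_equiv_span_iso)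

abbreviation cls :: "'m \<Rightarrow> 'm \<Rightarrow> ('m \<times> 'm) set" where
  "cls s f \<equiv> eq_class (span_iso C) (s, f)"

lemma in_cls: "(t, g) \<in> cls s f \<longleftrightarrow> span_iso C (s, f) (t, g)"
  by (simp add: eq_class_def)

lemma cls_eq_iff: "(s, f) \<in> spans C \<Longrightarrow> cls s f = cls t g \<longleftrightarrow> span_iso C (s, f) (t, g)"
  unfolding eq_class_def
  by (metis (no_types, lifting) Collect_cong mem_Collect_eq span_iso_refl span_iso_sym span_iso_trans)

lemma cls_eqI: "span_mor C x (s, f) (t, g) \<Longrightarrow> span_mor C y (t, g) (s, f) \<Longrightarrow> cls s f = cls t g"
  using cls_eq_iff span_isoI span_mor_spans by blast

lemma cls_eqD:
  assumes "cls s f = cls t g" "s \<in> SS C" "f \<in> Arr C" "Dom C f = Dom C s"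
  obtains x where "is_iso C x" "Dom C x = Dom C s" "Cod C x = Dom C t" "t \<cdot> x = s" "g \<cdot> x = f"
    "t \<in> SS C" "g \<in> Arr C" "Dom C g = Dom C t" "Cod C t = Cod C s" "Cod C g = Cod C f"
proof -
  obtain x where x: "is_iso C x" "span_mor C x (s, f) (t, g)"
    using assms by (auto simp: cls_eq_iff span_iso_def)
  with span_mor_Cod[OF x(2)] show thesis using that by (auto simp: span_mor_iff)
qed

text \<open>The common pattern of the well-definedness proofs: an operation of
  \<open>span_quotient\<close> equals \<open>K\<close> once some choice of representatives exists
  and every choice yields \<open>K\<close>.\<close>

lemma Union_eqI: "\<exists>x. x \<in> A \<Longrightarrow> (\<And>x. x \<in> A \<Longrightarrow> x = K) \<Longrightarrow> \<Union>A = K"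
  by blast

lemma cls_representative:
  assumes "s \<in> SS C" "f \<in> Arr C" "Dom C f = Dom C s"
  shows "(s, f) \<in> cls s f"
  using assms by (simp add: in_cls span_iso_refl)

lemma cls_memE:
  assumes "(t, g) \<in> cls s f"
  obtains x y where "span_mor C x (t, g) (s, f)" "span_mor C y (s, f) (t, g)"
  using assms span_iso_sym unfolding in_cls span_iso_def by blast

lemma the_elem_image_const: "x \<in> A \<Longrightarrow> (\<And>y. y \<in> A \<Longrightarrow> f y = c) \<Longrightarrow> the_elem (f ` A) = c"
proof -
  assume "x \<in> A" "\<And>y. y \<in> A \<Longrightarrow> f y = c"
  then have "f ` A = {c}" by blast
  then show ?thesis by simp
qed

section \<open>The operations of \<open>RaPar C\<close> evaluated on classes\<close>

lemma Obj_RaPar [simp]: "Obj (RaPar C) = Obj C"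
  by (simp add: RaPar_def span_quotient_def)

lemma Ident_RaPar: "Ident (RaPar C) A = cls (Ident C A) (Ident C A)"
  by (simp add: RaPar_def span_quotient_def z_equiv_span_iso)

lemma Arr_RaPar: "Arr (RaPar C) = {cls s f | s f. s \<in> SS C \<and> f \<in> Arr C \<and> Dom C f = Dom C s}"
  by (auto simp: RaPar_def span_quotient_def z_equiv_span_iso)

lemma Dom_cls [simp]:
  assumes "s \<in> SS C" "f \<in> Arr C" "Dom C f = Dom C s"
  shows "Dom (RaPar C) (cls s f) = Cod C s"
proof -
  have "(case y of (s, f) \<Rightarrow> Cod C s) = Cod C s" if "y \<in> cls s f" for y
  proof (cases y)
    case (Pair t g)
    with that have "(t, g) \<in> cls s f" by simp
    then obtain x where "span_mor C x (t, g) (s, f)" by (rule cls_memE)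
    from span_mor_Cod[OF this] show ?thesis by (simp add: Pair)
  qed
  from the_elem_image_const[OF cls_representative[OF assms] this]
  show ?thesis by (simp add: RaPar_def span_quotient_def)
qed

lemma Cod_cls [simp]:
  assumes "s \<in> SS C" "f \<in> Arr C" "Dom C f = Dom C s"
  shows "Cod (RaPar C) (cls s f) = Cod C f"
proof -
  have "(case y of (s, f) \<Rightarrow> Cod C f) = Cod C f" if "y \<in> cls s f" for y
  proof (cases y)
    case (Pair t g)
    with that have "(t, g) \<in> cls s f" by simp
    then obtain x where "span_mor C x (t, g) (s, f)" by (rule cls_memE)
    from span_mor_Cod[OF this] show ?thesis by (simp add: Pair)
  qed
  from the_elem_image_const[OF cls_representative[OF assms] this]
  show ?thesis by (simp add: RaPar_def span_quotient_def)
qed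

lemma cls_Arr [simp]: "s \<in> SS C \<Longrightarrow> f \<in> Arr C \<Longrightarrow> Dom C f = Dom C s \<Longrightarrow> cls s f \<in> Arr (RaPar C)"
  by (auto simp: Arr_RaPar)

lemma RaPar_ArrE:
  assumes "X \<in> Arr (RaPar C)"
  obtains s f where "s \<in> SS C" "f \<in> Arr C" "Dom C f = Dom C s" "X = cls s f"
    "Dom (RaPar C) X = Cod C s" "Cod (RaPar C) X = Cod C f"
  using assms by (auto simp: Arr_RaPar)

text \<open>Morphisms of both factors induce a map between the two pullbacks. Using it in both
  directions makes composition independent of the representatives and of the chosen
  pullback.\<close>

lemma comp_cls_mor:
  assumes x: "span_mor C x (s1, f1) (s, f)" and y: "span_mor C y (t1, g1) (t, g)"
    and p: "pullback C f t t' f'" and p1: "pullback C f1 t1 t1' f1'"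
  shows "\<exists>h. span_mor C h (s1 \<cdot> t1', g1 \<cdot> f1') (s \<cdot> t', g \<cdot> f')"
proof -
  note d = pullbackD[OF p] and e = pullbackD[OF p1]
  have X: "s1 \<in> SS C" "f1 \<in> Arr C" "Dom C f1 = Dom C s1" "s \<in> SS C" "f \<in> Arr C" "Dom C f = Dom C s"
    "x \<in> Arr C" "Dom C x = Dom C s1" "Cod C x = Dom C s" and sx: "s \<cdot> x = s1" "f \<cdot> x = f1"
    using x by (auto simp: span_mor_iff)
  have Y: "t1 \<in> SS C" "g1 \<in> Arr C" "Dom C g1 = Dom C t1" "t \<in> SS C" "g \<in> Arr C" "Dom C g = Dom C t"
    "y \<in> Arr C" "Dom C y = Dom C t1" "Cod C y = Dom C t" and ty: "t \<cdot> y = t1" "g \<cdot> y = g1"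
    using y by (auto simp: span_mor_iff)
  have t': "t' \<in> SS C" "t1' \<in> SS C" using SS_stable[OF _ p] SS_stable[OF _ p1] X Y by auto
  obtain h where h: "h \<in> Arr C" "Dom C h = Dom C (x \<cdot> t1')" "Cod C h = Dom C t'"
    and h': "t' \<cdot> h = x \<cdot> t1'" "f' \<cdot> h = y \<cdot> f1'"
    by (rule pullback_ex[OF p, of "x \<cdot> t1'" "y \<cdot> f1'"])
      (use X Y d(1-8) e in \<open>auto simp: reassoc[OF sx(2)] reassoc[OF ty(1)]\<close>)
  have "(s \<cdot> t') \<cdot> h = s1 \<cdot> t1'" "(g \<cdot> f') \<cdot> h = g1 \<cdot> f1'"
    using X Y d(1-8) e(1-8) h by (auto simp: h' reassoc[OF sx(1)] reassoc[OF ty(2)])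
  then have "span_mor C h (s1 \<cdot> t1', g1 \<cdot> f1') (s \<cdot> t', g \<cdot> f')"
    using X Y d(1-8) e(1-8) h t' by (simp add: span_mor_iff)
  then show ?thesis ..
qed

lemma comp_cls:
  assumes sf: "s \<in> SS C" "f \<in> Arr C" "Dom C f = Dom C s"
    and tg: "t \<in> SS C" "g \<in> Arr C" "Dom C g = Dom C t"
    and p: "pullback C f t t' f'"
  shows "Comp (RaPar C) (cls t g) (cls s f) = cls (s \<cdot> t') (g \<cdot> f')"
proof -
  have "Comp (RaPar C) (cls t g) (cls s f) =
    \<Union>{cls (s1 \<cdot> t1') (g1 \<cdot> f1') | s1 f1 t1 g1 t1' f1'.
        (s1, f1) \<in> cls s f \<and> (t1, g1) \<in> cls t g \<and> pullback C f1 t1 t1' f1'}" (is "_ = \<Union>?A")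
    by (simp add: RaPar_def span_quotient_def z_equiv_span_iso)
  also have "\<dots> = cls (s \<cdot> t') (g \<cdot> f')"
  proof (rule Union_eqI)
    have "cls (s \<cdot> t') (g \<cdot> f') \<in> ?A"
      using cls_representative[OF sf] cls_representative[OF tg] p by blast
    then show "\<exists>x. x \<in> ?A" by blast
    fix K assume "K \<in> ?A"
    then obtain s1 f1 t1 g1 t1' f1' where K: "K = cls (s1 \<cdot> t1') (g1 \<cdot> f1')"
      "(s1, f1) \<in> cls s f" "(t1, g1) \<in> cls t g" "pullback C f1 t1 t1' f1'" by blast
    then show "K = cls (s \<cdot> t') (g \<cdot> f')"
      using comp_cls_mor[OF _ _ p K(4)] comp_cls_mor[OF _ _ K(4) p]
      by (metis cls_eqI cls_memE)
  qed
  finally show ?thesis .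
qed

lemma Rst_cls [simp]:
  assumes "s \<in> SS C" "f \<in> Arr C" "Dom C f = Dom C s"
  shows "Rst (RaPar C) (cls s f) = cls s s"
proof -
  have "Rst (RaPar C) (cls s f) = \<Union>{cls t t | t g. (t, g) \<in> cls s f}"
    by (simp add: RaPar_def span_quotient_def z_equiv_span_iso)
  also have "\<dots> = cls s s"
  proof (rule Union_eqI)
    show "\<exists>x. x \<in> {cls t t | t g. (t, g) \<in> cls s f}"
      using cls_representative[OF assms] by blast
    fix K assume "K \<in> {cls t t | t g. (t, g) \<in> cls s f}"
    then obtain t g where K: "K = cls t t" "(t, g) \<in> cls s f" by blast
    from K(2) obtain x y where "span_mor C x (t, g) (s, f)" "span_mor C y (s, f) (t, g)"
      by (rule cls_memE)
    then have "span_mor C x (t, t) (s, s)" "span_mor C y (s, s) (t, t)"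
      by (auto simp: span_mor_iff)
    then show "K = cls s s" using K cls_eqI by blast
  qed
  finally show ?thesis .
qed

text \<open>The morphism of images is the filler of \<open>p\<close> against \<open>n\<close>. Taken
  in both directions, it shows that the range depends neither on the representative nor on the
  factorization.\<close>

lemma factor_mor:
  assumes p: "p \<in> PP C" "m \<in> SS C" "Cod C p = Dom C m"
    and q: "q \<in> PP C" "n \<in> SS C" "Cod C q = Dom C n"
    and x: "x \<in> Arr C" "Dom C x = Dom C p" "Cod C x = Dom C q" "(n \<cdot> q) \<cdot> x = m \<cdot> p"
  shows "\<exists>h. span_mor C h (m, m) (n, n)"
proof -
  have "Cod C (m \<cdot> p) = Cod C ((n \<cdot> q) \<cdot> x)" by (simp only: x(4))
  then have c: "Cod C m = Cod C n" using p q x(1-3) by simp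
  obtain d where "d \<in> Arr C" "Dom C d = Cod C p" "Cod C d = Dom C n" "d \<cdot> p = q \<cdot> x" "n \<cdot> d = m"
    by (rule fillE[OF p(1) q(2), of "q \<cdot> x" m]) (use p q x c in auto)
  then have "span_mor C d (m, m) (n, n)" using p q by (simp add: span_mor_iff)
  then show ?thesis ..
qed

lemma Rng_cls:
  assumes sf: "s \<in> SS C" "Dom C p = Dom C s" and p: "p \<in> PP C" "m \<in> SS C" "Cod C p = Dom C m"
  shows "Rng (RaPar C) (cls s (m \<cdot> p)) = cls m m"
proof -
  let ?A = "{cls n n | t g n q. (t, g) \<in> cls s (m \<cdot> p) \<and> q \<in> PP C \<and> n \<in> SS C \<and>
      Cod C q = Dom C n \<and> g = n \<cdot> q}"
  have "Rng (RaPar C) (cls s (m \<cdot> p)) = \<Union>?A"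
    by (simp add: RaPar_def span_quotient_def z_equiv_span_iso)
  also have "\<dots> = cls m m"
  proof (rule Union_eqI)
    show "\<exists>x. x \<in> ?A"
      using cls_representative[of s "m \<cdot> p"] sf p by fastforce
    fix K assume "K \<in> ?A"
    then obtain t n q where K: "K = cls n n" "(t, n \<cdot> q) \<in> cls s (m \<cdot> p)"
      and q: "q \<in> PP C" "n \<in> SS C" "Cod C q = Dom C n" by blast
    from K(2) obtain x y where xy: "span_mor C x (t, n \<cdot> q) (s, m \<cdot> p)"
        "span_mor C y (s, m \<cdot> p) (t, n \<cdot> q)"
      by (rule cls_memE)
    obtain h where "span_mor C h (n, n) (m, m)"
      using factor_mor[OF q p, of x] xy p q sf by (auto simp: span_mor_iff simp del: assoc)
    moreover obtain h' where "span_mor C h' (m, m) (n, n)"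
      using factor_mor[OF p q, of y] xy p q sf by (auto simp: span_mor_iff simp del: assoc)
    ultimately show "K = cls m m" using K cls_eqI by blast
  qed
  finally show ?thesis .
qed

lemma total_comp_cls:
  assumes "s \<in> SS C" "f \<in> Arr C" "Dom C f = Dom C s" "g \<in> Arr C" "Dom C g = Cod C f"
  shows "Comp (RaPar C) (cls (Ident C (Dom C g)) g) (cls s f) = cls s (g \<cdot> f)"
  using comp_cls[of s f "Ident C (Dom C g)" g "Ident C (Dom C f)" f] pullback_Ident[of f] assms
  by simp

text \<open>When the right leg factors through the monic \<open>t\<close>, the pullback of
  \<open>t\<close> along it is an identity. The identity law, R1, RR2 and the splitting of
  idempotents are all of this shape.\<close>

lemma comp_cls_mono:
  assumes "s \<in> SS C" "f \<in> Arr C" "Dom C f = Dom C s" "t \<in> SS C" "g \<in> Arr C" "Dom C g = Dom C t"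
    "Cod C f = Dom C t"
  shows "Comp (RaPar C) (cls t g) (cls s (t \<cdot> f)) = cls s (g \<cdot> f)"
  using comp_cls[of s "t \<cdot> f" t g "Ident C (Dom C f)" f] pullback_mono[of t f] assms
  by simp

section \<open>The axioms of a split range category for \<open>RaPar C\<close>\<close>

lemma RaPar_category: "category (RaPar C)"
proof
  fix X assume "X \<in> Arr (RaPar C)"
  then show "Dom (RaPar C) X \<in> Obj (RaPar C)" "Cod (RaPar C) X \<in> Obj (RaPar C)"
    by (auto elim!: RaPar_ArrE)
next
  fix A assume "A \<in> Obj (RaPar C)"
  then show "Ident (RaPar C) A \<in> hom (RaPar C) A A"
    by (simp add: hom_def Ident_RaPar)
next
  fix X Y A B D assume X: "X \<in> hom (RaPar C) A B" and Y: "Y \<in> hom (RaPar C) B D"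
  obtain s f where s: "s \<in> SS C" "f \<in> Arr C" "Dom C f = Dom C s" "X = cls s f" "A = Cod C s" "B = Cod C f"
    using X by (auto simp: hom_def elim!: RaPar_ArrE)
  obtain t g where t: "t \<in> SS C" "g \<in> Arr C" "Dom C g = Dom C t" "Y = cls t g" "B = Cod C t" "D = Cod C g"
    using Y by (auto simp: hom_def elim!: RaPar_ArrE)
  obtain t' f' where p: "pullback C f t t' f'" "t' \<in> SS C"
    by (rule SS_pullbackE[of f t]) (use s t in auto)
  note d = pullbackD[OF p(1)]
  show "Comp (RaPar C) Y X \<in> hom (RaPar C) A D"
    using comp_cls[OF s(1-3) t(1-3) p(1)] s t d p(2) by (simp add: hom_def)
next
  fix X A B assume "X \<in> hom (RaPar C) A B"
  then obtain s f where s: "s \<in> SS C" "f \<in> Arr C" "Dom C f = Dom C s" "X = cls s f" "A = Cod C s" "B = Cod C f"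
    by (auto simp: hom_def elim!: RaPar_ArrE)
  show "Comp (RaPar C) X (Ident (RaPar C) A) = X"
    using comp_cls_mono[of "Ident C (Cod C s)" "Ident C (Dom C s)" s f]
      comp_cls[of "Ident C (Cod C s)" "Ident C (Cod C s)" s f s "Ident C (Dom C s)"]
      pullback_sym[OF pullback_Ident[of s]] s
    by (simp add: Ident_RaPar)
  show "Comp (RaPar C) (Ident (RaPar C) B) X = X"
    using total_comp_cls[of s f "Ident C (Cod C f)"] s by (simp add: Ident_RaPar)
next
  fix X Y Z A B D E
  assume X: "X \<in> hom (RaPar C) A B" and Y: "Y \<in> hom (RaPar C) B D" and Z: "Z \<in> hom (RaPar C) D E"
  obtain s f where s: "s \<in> SS C" "f \<in> Arr C" "Dom C f = Dom C s" "X = cls s f" "A = Cod C s" "B = Cod C f"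
    using X by (auto simp: hom_def elim!: RaPar_ArrE)
  obtain t g where t: "t \<in> SS C" "g \<in> Arr C" "Dom C g = Dom C t" "Y = cls t g" "Cod C f = Cod C t" "D = Cod C g"
    using Y s by (auto simp: hom_def elim!: RaPar_ArrE)
  obtain u h where u: "u \<in> SS C" "h \<in> Arr C" "Dom C h = Dom C u" "Z = cls u h" "Cod C g = Cod C u" "E = Cod C h"
    using Z t by (auto simp: hom_def elim!: RaPar_ArrE)
  obtain t' f' where p: "pullback C f t t' f'" "t' \<in> SS C"
    by (rule SS_pullbackE[of f t]) (use s t in auto)
  note d = pullbackD[OF p(1)]
  obtain u' g' where q: "pullback C g u u' g'" "u' \<in> SS C"
    by (rule SS_pullbackE[of g u]) (use u t in auto)
  note e = pullbackD[OF q(1)]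
  \<comment> \<open>This third square pastes with \<open>q\<close> on one side and with
    \<open>p\<close> on the other, so both bracketings are computed with the same apex.\<close>
  obtain u'' f'' where r: "pullback C f' u' u'' f''" "u'' \<in> SS C"
    by (rule SS_pullbackE[of f' u']) (use q t d e in auto)
  note c = pullbackD[OF r(1)]
  have "Comp (RaPar C) Z (cls (s \<cdot> t') (g \<cdot> f')) = cls ((s \<cdot> t') \<cdot> u'') (h \<cdot> (g' \<cdot> f''))"
    unfolding u(4) by (rule comp_cls[OF _ _ _ _ _ _ pullback_paste[OF q(1) r(1)]])
      (use s t u p(2) q(2) d(1-8) e(1-8) in auto)
  moreover have "Comp (RaPar C) (cls (t \<cdot> u') (h \<cdot> g')) X = cls (s \<cdot> (t' \<cdot> u'')) ((h \<cdot> g') \<cdot> f'')"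
    unfolding s(4) by (rule comp_cls[OF _ _ _ _ _ _ pullback_paste'[OF p(1) r(1)]])
      (use s t u p(2) q(2) d(1-8) e(1-8) in auto)
  ultimately show "Comp (RaPar C) (Comp (RaPar C) Z Y) X = Comp (RaPar C) Z (Comp (RaPar C) Y X)"
    using comp_cls[OF s(1-3) t(1-3) p(1)] comp_cls[OF t(1-3) u(1-3) q(1)]
      s(1-4) t(1-5) u(1-5) p(2) q(2) r(2) d(1-8) e(1-8) c(1-8)
    by simp
qed

lemma Rst_comp:
  assumes t: "t \<in> SS C" and f: "f \<in> Arr C" "s \<in> SS C" "Dom C f = Dom C s"
    and p: "pullback C f t t' f'"
  shows "Comp (RaPar C) (cls t t) (cls s f) = cls (s \<cdot> t') (f \<cdot> t')"
  using comp_cls[OF f(2,1,3) t _ _ p] t pullbackD[OF p] by simp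

lemma RaPar_split:
  assumes X: "X \<in> Arr (RaPar C)" and RX: "Rst (RaPar C) X = X"
  shows "\<exists>m r. r \<in> hom (RaPar C) (Dom (RaPar C) X) (Dom (RaPar C) m) \<and>
      m \<in> hom (RaPar C) (Dom (RaPar C) m) (Dom (RaPar C) X) \<and>
      X = Comp (RaPar C) m r \<and> Comp (RaPar C) r m = Ident (RaPar C) (Dom (RaPar C) m)"
proof -
  obtain s f where s: "s \<in> SS C" "f \<in> Arr C" "Dom C f = Dom C s" "X = cls s f"
    using X by (rule RaPar_ArrE)
  have X: "X = cls s s" using s RX by simp
  let ?i = "Ident C (Dom C s)"
  \<comment> \<open>The idempotent \<open>[s, s]\<close> splits as
    \<open>[1, s] \<cdot> [s, 1]\<close>; the reverse composite is an identity because
    \<open>s\<close> is monic.\<close>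
  let ?m = "cls ?i s" and ?r = "cls s ?i"
  have "X = Comp (RaPar C) ?m ?r" using total_comp_cls[of s ?i s] s X by simp
  moreover have "Comp (RaPar C) ?r ?m = Ident (RaPar C) (Dom C s)"
    using comp_cls_mono[of ?i ?i s ?i] s by (simp add: Ident_RaPar)
  moreover have "Dom (RaPar C) X = Cod C s" using s by simp
  ultimately show ?thesis
    using s(1) by - (rule exI[of _ ?m], rule exI[of _ ?r], simp add: hom_def)
qed

lemma RaPar_RngE:
  assumes "X \<in> Arr (RaPar C)"
  obtains s p m where "s \<in> SS C" "p \<in> PP C" "m \<in> SS C" "Dom C p = Dom C s" "Cod C p = Dom C m"
    "X = cls s (m \<cdot> p)" "Dom (RaPar C) X = Cod C s" "Cod (RaPar C) X = Cod C m"
    "Rng (RaPar C) X = cls m m"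
proof -
  obtain s f where s: "s \<in> SS C" "f \<in> Arr C" "Dom C f = Dom C s" "X = cls s f"
    using assms by (rule RaPar_ArrE)
  obtain p m where pm: "p \<in> PP C" "m \<in> SS C" "Cod C p = Dom C m" "Dom C p = Dom C f"
    "Cod C m = Cod C f" "f = m \<cdot> p" by (rule factorE[OF s(2)])
  show thesis
    by (rule that[OF s(1) pm(1,2)]) (use s pm(1-5) Rng_cls[of s p m] in \<open>auto simp: pm(6)[symmetric]\<close>)
qed

lemma RaPar_split_range_cat: "split_range_cat (RaPar C)"
proof -
  interpret X: category "RaPar C" by (rule RaPar_category)
  show ?thesis
  proof
    fix X A B assume X: "X \<in> hom (RaPar C) A B"
    then show "Rst (RaPar C) X \<in> hom (RaPar C) A A"
      by (auto simp: hom_def elim!: RaPar_ArrE)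
    have "X \<in> Arr (RaPar C)" using X by (simp add: hom_def)
    then show "Rng (RaPar C) X \<in> hom (RaPar C) B B"
      by (rule RaPar_RngE) (use X in \<open>auto simp: hom_def\<close>)
  next
    fix X assume X: "X \<in> Arr (RaPar C)"
    from X show "Comp (RaPar C) X (Rst (RaPar C) X) = X"
    proof (rule RaPar_ArrE)
      fix s f assume "s \<in> SS C" "f \<in> Arr C" "Dom C f = Dom C s" "X = cls s f"
      then show ?thesis using comp_cls_mono[of s "Ident C (Dom C s)" s f] by simp
    qed
    from X show "Rst (RaPar C) (Rng (RaPar C) X) = Rng (RaPar C) X"
      by (rule RaPar_RngE) auto
    from X show "Comp (RaPar C) (Rng (RaPar C) X) X = X"
    proof (rule RaPar_RngE)
      fix s p m assume "s \<in> SS C" "p \<in> PP C" "m \<in> SS C" "Dom C p = Dom C s" "Cod C p = Dom C m"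
        "X = cls s (m \<cdot> p)" "Rng (RaPar C) X = cls m m"
      then show ?thesis using comp_cls_mono[of s p m m] by simp
    qed
  next
    fix F G assume FG: "F \<in> Arr (RaPar C)" "G \<in> Arr (RaPar C)" "Dom (RaPar C) F = Dom (RaPar C) G"
    obtain s f where s: "s \<in> SS C" "f \<in> Arr C" "Dom C f = Dom C s" "F = cls s f" "Dom (RaPar C) F = Cod C s"
      by (rule RaPar_ArrE[OF FG(1)])
    obtain t g where t: "t \<in> SS C" "g \<in> Arr C" "Dom C g = Dom C t" "G = cls t g" "Dom (RaPar C) G = Cod C t"
      by (rule RaPar_ArrE[OF FG(2)])
    have st: "Cod C s = Cod C t" using s t FG by simp
    obtain t' s' where p: "pullback C s t t' s'" "t' \<in> SS C"
      by (rule SS_pullbackE[of s t]) (use s t st in auto)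
    note d = pullbackD[OF p(1)]
    have s': "s' \<in> SS C" using SS_stable[OF s(1) pullback_sym[OF p(1)]] .
    \<comment> \<open>R2 and R3 both rest on the intersection of \<open>s\<close> and
      \<open>t\<close>, whose inclusion can be read as \<open>s \<cdot> t'\<close> or as
      \<open>t \<cdot> s'\<close>.\<close>
    have 1: "Comp (RaPar C) (cls t t) (cls s s) = cls (s \<cdot> t') (s \<cdot> t')"
      using Rst_comp[OF t(1) _ s(1) _ p(1)] s by simp
    have "Comp (RaPar C) (cls s s) (cls t t) = cls (t \<cdot> s') (t \<cdot> s')"
      using Rst_comp[OF s(1) _ t(1) _ pullback_sym[OF p(1)]] t by simp
    then show "Comp (RaPar C) (Rst (RaPar C) F) (Rst (RaPar C) G) =
        Comp (RaPar C) (Rst (RaPar C) G) (Rst (RaPar C) F)"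
      using 1 s t d by simp
    have "Comp (RaPar C) (cls t g) (cls s s) = cls (s \<cdot> t') (g \<cdot> s')"
      using comp_cls[OF s(1) _ _ t(1-3) p(1)] s(1) by simp
    then show "Rst (RaPar C) (Comp (RaPar C) G (Rst (RaPar C) F)) =
        Comp (RaPar C) (Rst (RaPar C) G) (Rst (RaPar C) F)"
      using 1 s t d(1-8) p(2) by simp
  next
    fix F G assume FG: "F \<in> Arr (RaPar C)" "G \<in> Arr (RaPar C)" "Cod (RaPar C) F = Dom (RaPar C) G"
    obtain s p m where s: "s \<in> SS C" "p \<in> PP C" "m \<in> SS C" "Dom C p = Dom C s" "Cod C p = Dom C m"
      "F = cls s (m \<cdot> p)" "Cod (RaPar C) F = Cod C m" "Rng (RaPar C) F = cls m m"
      by (rule RaPar_RngE[OF FG(1)])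
    obtain t g where t: "t \<in> SS C" "g \<in> Arr C" "Dom C g = Dom C t" "G = cls t g" "Dom (RaPar C) G = Cod C t"
      by (rule RaPar_ArrE[OF FG(2)])
    have mt: "Cod C m = Cod C t" using FG s t by simp
    obtain t' m' where q: "pullback C m t t' m'" "t' \<in> SS C"
      by (rule SS_pullbackE[of m t]) (use s t mt in auto)
    note d = pullbackD[OF q(1)]
    have m': "m' \<in> SS C" using SS_stable[OF s(3) pullback_sym[OF q(1)]] .
    \<comment> \<open>The pullback of \<open>t\<close> along \<open>m \<cdot> p\<close> is taken in
      two stages, over \<open>m\<close> and then over \<open>p\<close>. Stability puts
      \<open>p'\<close> into \<open>PP\<close>, so \<open>(t \<cdot> m') \<cdot> p'\<close> is
      already a factorization; RR3 reads off its range.\<close>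
    obtain t'' p' where r: "pullback C p t' t'' p'" "t'' \<in> SS C"
      by (rule SS_pullbackE[of p t']) (use s t d q in auto)
    note e = pullbackD[OF r(1)]
    have p': "p' \<in> PP C" using PP_stable[OF s(2) q(2) r(1)] .
    have mp: "pullback C (m \<cdot> p) t t'' (m' \<cdot> p')" using pullback_paste[OF q(1) r(1)] .
    have a: "Comp (RaPar C) (cls t t) F = cls (s \<cdot> t'') ((t \<cdot> m') \<cdot> p')"
      using Rst_comp[OF t(1) _ s(1) _ mp] s(1-6) t pullbackD(9)[OF mp] d(1-8) e(1-8) by simp
    have b: "Comp (RaPar C) G F = cls (s \<cdot> t'') (g \<cdot> (m' \<cdot> p'))"
      using comp_cls[OF s(1) _ _ t(1-3) mp] s(1-6) t(4) by simp
    have c: "Comp (RaPar C) (cls t t) (cls m m) = cls (t \<cdot> m') (t \<cdot> m')"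
      using Rst_comp[OF t(1) _ s(3) _ q(1)] s(3) d by simp
    \<comment> \<open>For R4, restricting \<open>F\<close> on the source side gives the same span as
      the pullback along \<open>t\<close>, by commutativity of the pasted square.\<close>
    have "Comp (RaPar C) F (cls (s \<cdot> t'') (s \<cdot> t'')) = cls (s \<cdot> t'') ((m \<cdot> p) \<cdot> t'')"
      using comp_cls_mono[of "s \<cdot> t''" t'' s "m \<cdot> p"] s(1-6) r(2) e(1-8) by simp
    moreover have "(t \<cdot> m') \<cdot> p' = (m \<cdot> p) \<cdot> t''"
      using pullbackD(9)[OF mp] s(1-5) t(1-3) d(1-8) e(1-8) by simp
    ultimately show "Comp (RaPar C) (Rst (RaPar C) G) F = Comp (RaPar C) F (Rst (RaPar C) (Comp (RaPar C) G F))"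
      using a b s(1-5) t(1-4) r(2) d(1-8) e(1-8) by simp
    have "Rng (RaPar C) (cls (s \<cdot> t'') ((t \<cdot> m') \<cdot> p')) = cls (t \<cdot> m') (t \<cdot> m')"
      by (rule Rng_cls) (use s t m' p' d(1-8) e(1-8) r(2) in auto)
    then show "Rng (RaPar C) (Comp (RaPar C) (Rst (RaPar C) G) F) =
        Comp (RaPar C) (Rst (RaPar C) G) (Rng (RaPar C) F)"
      using a c s(8) t(1-4) by simp
    \<comment> \<open>For RR4, a factorization \<open>n \<cdot> q\<close> of
      \<open>g \<cdot> m'\<close> also serves the full composite, since \<open>q \<cdot> p'\<close>
      remains in \<open>PP\<close>. Both ranges are therefore given by \<open>n\<close>.\<close>
    have "g \<cdot> m' \<in> Arr C" using t m' d by simp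
    then obtain q n where qn: "q \<in> PP C" "n \<in> SS C" "Cod C q = Dom C n" "Dom C q = Dom C (g \<cdot> m')"
      "Cod C n = Cod C (g \<cdot> m')" "g \<cdot> m' = n \<cdot> q"
      by (rule factorE)
    have D: "Dom C q = Dom C t'" using qn(4) t m' d by simp
    have "Comp (RaPar C) G (cls m m) = cls (m \<cdot> t') (n \<cdot> q)"
      using comp_cls[OF s(3) _ _ t(1-3) q(1)] s(3) t(4) qn(6) by simp
    then have "Rng (RaPar C) (Comp (RaPar C) G (cls m m)) = cls n n"
      using Rng_cls[of "m \<cdot> t'" q n] s(3) q(2) d(1-8) qn(1-3) D by simp
    moreover have "Rng (RaPar C) (cls (s \<cdot> t'') (n \<cdot> (q \<cdot> p'))) = cls n n"
      by (rule Rng_cls) (use s(1-5) qn(1-3) D p' d(1-8) e(1-8) r(2) in auto)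
    moreover have "g \<cdot> (m' \<cdot> p') = n \<cdot> (q \<cdot> p')"
      using t(1-3) qn(1-3) D m' p' d(1-8) e(1-8) by (simp add: reassoc[OF qn(6)])
    ultimately show "Rng (RaPar C) (Comp (RaPar C) G (Rng (RaPar C) F)) = Rng (RaPar C) (Comp (RaPar C) G F)"
      using b s(8) by simp
  qed (rule RaPar_split)
qed

end


section \<open>Total morphisms of a split range category\<close>

lemma Total_simps [simp]:
  "Obj (Total X) = Obj X" "Arr (Total X) = {f. total X f}" "Dom (Total X) = Dom X"
  "Cod (Total X) = Cod X" "Ident (Total X) = Ident X" "Comp (Total X) = Comp X"
  "PP (Total X) = RaSur X" "SS (Total X) = ReIso X"
  by (simp_all add: Total_def)

context split_range_cat
begin

lemma Rst_Arr [simp]: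
  assumes "f \<in> Arr X"
  shows "Rst X f \<in> Arr X" "Dom X (Rst X f) = Dom X f" "Cod X (Rst X f) = Dom X f"
  using Rst_hom[OF Arr_hom[OF assms]] by (auto simp: hom_def)

lemma Rng_Arr [simp]:
  assumes "f \<in> Arr X"
  shows "Rng X f \<in> Arr X" "Dom X (Rng X f) = Cod X f" "Cod X (Rng X f) = Cod X f"
  using Rng_hom[OF Arr_hom[OF assms]] by (auto simp: hom_def)

lemma Rst_Ident [simp]: "A \<in> Obj X \<Longrightarrow> Rst X (Ident X A) = Ident X A"
  using R1[of "Ident X A"] by simp

lemma Rng_Ident [simp]: "A \<in> Obj X \<Longrightarrow> Rng X (Ident X A) = Ident X A"
  using RR2[of "Ident X A"] by simp

lemma Rst_Rst [simp]: "f \<in> Arr X \<Longrightarrow> Rst X (Rst X f) = Rst X f"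
  using R3[of f "Ident X (Dom X f)"] by simp

lemma Rst_absorb:
  assumes "f \<in> Arr X" "g \<in> Arr X" "Cod X f = Dom X g"
  shows "Rst X (g \<cdot> f) \<cdot> Rst X f = Rst X (g \<cdot> f)"
  using R3[of f "g \<cdot> f"] assms by (simp add: R1)

lemma Rst_comp_Rst:
  assumes "f \<in> Arr X" "g \<in> Arr X" "Cod X f = Dom X g"
  shows "Rst X (Rst X g \<cdot> f) = Rst X (g \<cdot> f)"
proof -
  have "Rst X (Rst X g \<cdot> f) = Rst X (f \<cdot> Rst X (g \<cdot> f))" by (simp only: R4[OF assms])
  also have "\<dots> = Rst X (g \<cdot> f) \<cdot> Rst X f"
    using R3[of "g \<cdot> f" f] R2[of f "g \<cdot> f"] assms by simp
  also have "\<dots> = Rst X (g \<cdot> f)" by (rule Rst_absorb[OF assms])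
  finally show ?thesis .
qed

lemma totalI: "f \<in> Arr X \<Longrightarrow> Rst X f = Ident X (Dom X f) \<Longrightarrow> total X f"
  by (simp add: total_def)

lemma totalD [simp]: "total X f \<Longrightarrow> f \<in> Arr X" "total X f \<Longrightarrow> Rst X f = Ident X (Dom X f)"
  by (simp_all add: total_def)

lemma total_Ident [simp]: "A \<in> Obj X \<Longrightarrow> total X (Ident X A)"
  by (rule totalI) simp_all

lemma Rst_total_comp:
  "f \<in> Arr X \<Longrightarrow> total X g \<Longrightarrow> Cod X f = Dom X g \<Longrightarrow> Rst X (g \<cdot> f) = Rst X f"
  using Rst_comp_Rst[of f g] by simp

lemma total_comp [simp]: "total X f \<Longrightarrow> total X g \<Longrightarrow> Cod X f = Dom X g \<Longrightarrow> total X (g \<cdot> f)"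
  using Rst_total_comp[of f g] by (intro totalI) auto

lemma total_cancel:
  assumes "total X (g \<cdot> f)" "f \<in> Arr X" "g \<in> Arr X" "Cod X f = Dom X g"
  shows "total X f"
proof (rule totalI)
  show "Rst X f = Ident X (Dom X f)"
    using Rst_absorb[of f g] assms totalD(2)[OF assms(1)] by simp
qed fact

lemma Rng_comp_surj:
  "f \<in> Arr X \<Longrightarrow> g \<in> Arr X \<Longrightarrow> Cod X f = Dom X g \<Longrightarrow> Rng X f = Ident X (Cod X f)
    \<Longrightarrow> Rng X (g \<cdot> f) = Rng X g"
  using RR4[of f g] by simp

lemma Rng_retraction:
  assumes "m \<in> Arr X" "r \<in> Arr X" "Cod X m = Dom X r" "r \<cdot> m = Ident X (Cod X r)"
  shows "Rng X r = Ident X (Cod X r)"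
proof -
  have "Rng X r = Rng X r \<cdot> (r \<cdot> m)" using assms by simp
  also have "\<dots> = Ident X (Cod X r)"
    using reassoc[OF RR2, of r m] assms by simp
  finally show ?thesis .
qed

text \<open>A total restricted isomorphism together with its restricted inverse, in purely
  equational form. Totality of \<open>m\<close> is not listed because it follows from
  \<open>r \<cdot> m = 1\<close> by \<open>total_cancel\<close>.\<close>

definition splits where
  "splits m r \<longleftrightarrow> m \<in> Arr X \<and> r \<in> Arr X \<and> Dom X r = Cod X m \<and> Cod X r = Dom X m \<and>
     r \<cdot> m = Ident X (Dom X m) \<and> m \<cdot> r = Rst X r"

lemma splitsD:
  assumes "splits m r"
  shows "m \<in> Arr X" "r \<in> Arr X" "Dom X r = Cod X m" "Cod X r = Dom X m"
    "r \<cdot> m = Ident X (Dom X m)" "m \<cdot> r = Rst X r"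
  using assms by (auto simp: splits_def)

lemma splits_total: "splits m r \<Longrightarrow> total X m"
  by (rule total_cancel[of r]) (auto simp: splits_def)

lemma splits_Rng: "splits m r \<Longrightarrow> Rng X r = Ident X (Dom X m)"
  using Rng_retraction[of m r] by (simp add: splits_def)

lemma splits_cancel:
  assumes m: "splits m r" and u: "u \<in> Arr X" "v \<in> Arr X" "Cod X u = Dom X m" "Cod X v = Dom X m"
    "m \<cdot> u = m \<cdot> v"
  shows "u = v"
proof -
  note d = splitsD[OF m]
  have "u = r \<cdot> (m \<cdot> u)" using d(1-4) u(1-4) by (simp add: reassoc[OF d(5)])
  also have "\<dots> = r \<cdot> (m \<cdot> v)" by (simp only: u(5))
  also have "\<dots> = v" using d(1-4) u(1-4) by (simp add: reassoc[OF d(5)])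
  finally show ?thesis .
qed

text \<open>The axiom \<open>split\<close> provides \<open>m \<cdot> r = Rst X g\<close>; since
  \<open>m\<close> is total, \<open>r\<close> has the same restriction as
  \<open>m \<cdot> r\<close>, which turns this into the equation required by
  \<open>splits\<close>.\<close>

lemma Rst_splitE:
  assumes "g \<in> Arr X"
  obtains m r where "splits m r" "Cod X m = Dom X g" "m \<cdot> r = Rst X g" "Rst X r = Rst X g"
proof -
  have "Rst X g \<in> Arr X" using assms by simp
  from split[OF this] assms obtain m r where mr: "m \<in> Arr X" "r \<in> Arr X" "Dom X r = Dom X g"
    "Cod X r = Dom X m" "Cod X m = Dom X g" "r \<cdot> m = Ident X (Dom X m)" and e: "Rst X g = m \<cdot> r"
    by (auto simp: hom_def)
  have "total X m" by (rule total_cancel[of r]) (use mr in auto)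
  then have "Rst X r = Rst X (m \<cdot> r)" using mr by (simp add: Rst_total_comp)
  also have "\<dots> = Rst X g" using assms by (simp flip: e)
  finally have r: "Rst X r = Rst X g" .
  show thesis by (rule that[of m r]) (use mr e r in \<open>auto simp: splits_def\<close>)
qed

text \<open>Inserting \<open>Rst X i = k \<cdot> i\<close> into \<open>i \<cdot> j\<close>, and
  symmetrically, bounds the restrictions of \<open>j\<close> and \<open>k\<close> by one another, so
  by R2 they agree. Then
  \<open>j = j \<cdot> i \<cdot> j = k \<cdot> i \<cdot> j = k\<close>.\<close>

lemma restricted_inverse_unique:
  assumes j: "restricted_inverse X i j" and k: "restricted_inverse X i k"
  shows "j = k"
proof -
  have J: "i \<in> Arr X" "j \<in> Arr X" "Dom X j = Cod X i" "Cod X j = Dom X i" "j \<cdot> i = Rst X i" "i \<cdot> j = Rst X j"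
    using j by (auto simp: restricted_inverse_def hom_def)
  have K: "k \<in> Arr X" "Dom X k = Cod X i" "Cod X k = Dom X i" "k \<cdot> i = Rst X i" "i \<cdot> k = Rst X k"
    using k by (auto simp: restricted_inverse_def hom_def)
  have "Rst X j = i \<cdot> (Rst X i \<cdot> j)"
    using J by (simp add: reassoc[OF R1[of i]])
  also have "\<dots> = Rst X k \<cdot> Rst X j"
    using J(1-4) K(1-3) by (simp flip: J(6) K(4,5))
  finally have a: "Rst X j = Rst X k \<cdot> Rst X j" .
  have "Rst X k = i \<cdot> (Rst X i \<cdot> k)"
    using J(1-4) K by (simp add: reassoc[OF R1[of i]])
  also have "\<dots> = Rst X j \<cdot> Rst X k"
    using J(1-4) K(1-3) by (simp flip: J(5,6) K(5))
  also have "\<dots> = Rst X j" using a R2[of j k] J K by simp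
  finally have b: "Rst X k = Rst X j" .
  have "j = j \<cdot> (i \<cdot> j)" using R1[of j] J by simp
  also have "\<dots> = k \<cdot> (i \<cdot> j)" using J(1-4) K(1-3) reassoc[OF J(5), of j] reassoc[OF K(4), of j] by simp
  also have "\<dots> = k" using R1[of k] J K b by simp
  finally show ?thesis .
qed

lemma splits_restricted_inverse: "splits m r \<Longrightarrow> restricted_inverse X m r"
  using splits_total[of m r] by (auto simp: splits_def restricted_inverse_def hom_def)

lemma rinv_splits [simp]: "splits m r \<Longrightarrow> rinv X m = r"
  unfolding rinv_def
  using splits_restricted_inverse restricted_inverse_unique by blast

lemma ReIso_iff: "m \<in> ReIso X \<longleftrightarrow> (\<exists>r. splits m r)"
proof
  assume "m \<in> ReIso X"
  then obtain r where "total X m" "restricted_inverse X m r" by (auto simp: ReIso_def)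
  then have "splits m r" by (auto simp: splits_def restricted_inverse_def hom_def)
  then show "\<exists>r. splits m r" ..
next
  assume "\<exists>r. splits m r"
  then show "m \<in> ReIso X" using splits_total splits_restricted_inverse unfolding ReIso_def by blast
qed

lemma RaSur_iff: "f \<in> RaSur X \<longleftrightarrow> total X f \<and> Rng X f = Ident X (Cod X f)"
  unfolding RaSur_def total_def by blast

text \<open>The left inverse is immediate; for the idempotent, R4 moves \<open>Rst X r\<close> to
  the right of \<open>q\<close>, where it becomes \<open>Rst X (r \<cdot> q)\<close> and absorbs
  \<open>Rst X q\<close>.\<close>

lemma splits_comp:
  assumes m: "splits m r" and n: "splits n q" and c: "Cod X m = Dom X n"
  shows "splits (n \<cdot> m) (r \<cdot> q)"
proof -
  note d = splitsD[OF m] and e = splitsD[OF n]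
  have 1: "(r \<cdot> q) \<cdot> (n \<cdot> m) = Ident X (Dom X m)"
    using d(1-5) e(1-4) c by (simp add: reassoc[OF e(5)])
  have "(n \<cdot> m) \<cdot> (r \<cdot> q) = n \<cdot> (Rst X r \<cdot> q)"
    using d(1-4) e(1-4) c by (simp add: reassoc[OF d(6)])
  also have "\<dots> = (n \<cdot> q) \<cdot> Rst X (r \<cdot> q)"
    using R4[of q r] d(1-4) e(1-4) c by simp
  also have "\<dots> = Rst X (r \<cdot> q) \<cdot> Rst X q"
    using R2[of q "r \<cdot> q"] d(1-4) e(1-4) c by (simp only: e(6)) simp
  also have "\<dots> = Rst X (r \<cdot> q)"
    using Rst_absorb[of q r] d(1-4) e(1-4) c by simp
  finally show ?thesis using 1 d(1-4) e(1-4) c by (simp add: splits_def)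
qed

end

text \<open>\<open>Total\<close> is only defined on records without further fields.\<close>

locale plain_split_range_cat = split_range_cat X for X :: "('o, 'm) range_cat" (structure)
begin

lemma splits_mono: "splits m r \<Longrightarrow> is_mono (Total X) m"
  using splits_cancel[of m r] splits_total by (auto simp: is_mono_def hom_def)

lemma Total_category: "category (Total X)"
  by unfold_locales (auto simp: hom_def)

sublocale T: category "Total X"
  by (rule Total_category)

lemma Total_isoE:
  assumes "is_iso (Total X) h"
  obtains k where "splits h k" "total X k" "h \<cdot> k = Ident X (Cod X h)"
proof -
  obtain k where k: "total X h" "total X k" "Dom X k = Cod X h" "Cod X k = Dom X h"
    "k \<cdot> h = Ident X (Dom X h)" "h \<cdot> k = Ident X (Cod X h)"
    using T.isoE[OF assms] by auto
  then have "splits h k" by (simp add: splits_def)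
  then show thesis using k that by blast
qed

text \<open>Pullbacks along restricted isomorphisms are characterized equationally: \<open>m\<close> splits the
  domain of definition of \<open>j \<cdot> f\<close>, where \<open>j\<close> is the restricted inverse of \<open>s\<close>.\<close>

lemma Total_pullbackI:
  assumes f: "total X f" and s: "splits s j" and c: "Cod X f = Cod X s"
    and m: "splits m r" "Cod X m = Dom X f" "m \<cdot> r = Rst X (j \<cdot> f)"
    and f': "f' \<in> Arr X" "Dom X f' = Dom X m" "Cod X f' = Dom X s" "f \<cdot> m = s \<cdot> f'"
  shows "pullback (Total X) f s m f'"
proof -
  note sd = splitsD[OF s] and md = splitsD[OF m(1)]
  have tm: "total X m" and ts: "total X s" using splits_total m s by auto
  have "total X (f \<cdot> m)" using tm f m by simp
  then have tf': "total X f'" using total_cancel[of s f'] f' sd by simp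
  show ?thesis
  proof (rule T.pullbackI, unfold Total_simps mem_Collect_eq)
    fix u v assume u: "total X u" "total X v" "Dom X u = Dom X v" "Cod X u = Dom X f"
      "Cod X v = Dom X s" "f \<cdot> u = s \<cdot> v"
    have "j \<cdot> f \<cdot> u = v"
      using sd(1-4) u(1-5) by (simp add: u(6) reassoc[OF sd(5)])
    \<comment> \<open>Since \<open>j \<cdot> f \<cdot> u = v\<close> is total, R4 shows that
      \<open>u\<close> is fixed by the idempotent that \<open>m\<close> splits, hence factors
      through \<open>m\<close>.\<close>
    then have "Rst X (j \<cdot> f) \<cdot> u = u"
      using R4[of u "j \<cdot> f"] sd(1-4) u(1-5) f c by simp
    then have mr: "m \<cdot> (r \<cdot> u) = u"
      using md(1-4) u(1-5) m(2) by (simp add: reassoc[OF m(3)])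
    have "total X (r \<cdot> u)"
      by (rule total_cancel[of m]) (use mr md u m(2) in auto)
    moreover have "s \<cdot> (f' \<cdot> (r \<cdot> u)) = s \<cdot> v"
      using f'(1-3) sd(1-4) md(1-4) u(1-5) m(2) f mr by (simp add: reassoc[OF f'(4)[symmetric]] u(6))
    then have "f' \<cdot> (r \<cdot> u) = v"
      by (rule splits_cancel[OF s, rotated -1]) (use f' md u m(2) in auto)
    ultimately show "\<exists>h. total X h \<and> Dom X h = Dom X u \<and> Cod X h = Dom X m \<and> m \<cdot> h = u \<and> f' \<cdot> h = v"
      using mr md u m(2) by (intro exI[of _ "r \<cdot> u"]) simp
  next
    fix h k assume "total X h" "total X k" "Dom X h = Dom X k" "Cod X h = Dom X m"
      "Cod X k = Dom X m" "m \<cdot> h = m \<cdot> k"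
    then show "h = k" using splits_cancel[OF m(1), of h k] by simp
  qed (use f tm ts tf' f' m c in auto)
qed

lemma Total_pullback_existsE:
  assumes f: "total X f" and s: "splits s j" and c: "Cod X f = Cod X s"
  obtains m r where "splits m r" "Cod X m = Dom X f" "m \<cdot> r = Rst X (j \<cdot> f)"
    "pullback (Total X) f s m (j \<cdot> f \<cdot> m)"
proof -
  note sd = splitsD[OF s]
  obtain m r where m: "splits m r" "Cod X m = Dom X (j \<cdot> f)" "m \<cdot> r = Rst X (j \<cdot> f)"
    by (rule Rst_splitE[of "j \<cdot> f"]) (use f sd c in auto)
  have m2: "Cod X m = Dom X f" using m(2) f sd c by simp
  note md = splitsD[OF m(1)]
  \<comment> \<open>The square commutes because R4 carries \<open>s \<cdot> j = Rst X j\<close> past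
    \<open>f\<close> to \<open>Rst X (j \<cdot> f)\<close>, which \<open>m\<close> absorbs.\<close>
  have "s \<cdot> (j \<cdot> f \<cdot> m) = Rst X j \<cdot> f \<cdot> m"
    using sd(1-4) f c md(1-4) m2 by (simp add: reassoc[OF sd(6)])
  also have "\<dots> = f \<cdot> (Rst X (j \<cdot> f) \<cdot> m)"
    using reassoc[OF R4[of f j], of m] f sd(1-4) c md(1-4) m2 by simp
  also have "Rst X (j \<cdot> f) \<cdot> m = m"
    using md(1-5) m2 by (simp flip: m(3))
  finally have "pullback (Total X) f s m (j \<cdot> f \<cdot> m)"
    by (intro Total_pullbackI[OF f s c m(1) m2 m(3)]) (use f sd(1-4) c md(1-4) m2 in auto)
  then show thesis using that m(1,3) m2 by blast
qed

text \<open>An arbitrary pullback differs from the constructed one by an isomorphism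
  \<open>h\<close>, and precomposing \<open>m\<close> with \<open>h\<close> does not change the
  idempotent that is split. Pullback squares thereby yield equations that can be used in
  calculations.\<close>

lemma Total_pullbackE:
  assumes p: "pullback (Total X) f s s' f'" and s: "splits s j"
  obtains r where "splits s' r" "s' \<cdot> r = Rst X (j \<cdot> f)"
proof -
  note d = T.pullbackD[OF p, simplified] and sd = splitsD[OF s]
  obtain m r where m: "splits m r" "Cod X m = Dom X f" "m \<cdot> r = Rst X (j \<cdot> f)"
    "pullback (Total X) f s m (j \<cdot> f \<cdot> m)"
    by (rule Total_pullback_existsE[OF d(1) s d(5)])
  obtain h where h: "is_iso (Total X) h" "Dom X h = Dom X s'" "Cod X h = Dom X m" "m \<cdot> h = s'"
    using T.pullback_compare[OF m(4) p] by (auto simp only: Total_simps)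
  obtain k where k: "splits h k" "total X k" "h \<cdot> k = Ident X (Cod X h)"
    by (rule Total_isoE[OF h(1)])
  note md = splitsD[OF m(1)] and hd = splitsD[OF k(1)]
  have "splits s' (k \<cdot> r)"
    using splits_comp[OF k(1) m(1) h(3)] h(4) by simp
  moreover have "s' \<cdot> (k \<cdot> r) = m \<cdot> ((h \<cdot> k) \<cdot> r)"
    unfolding h(4)[symmetric] using md(1-4) hd(1-4) h(3) by simp
  then have "s' \<cdot> (k \<cdot> r) = Rst X (j \<cdot> f)"
    using k(3) md(1-4) h(3) m(3) by simp
  ultimately show thesis using that by blast
qed

lemma Total_stable_fact: "stable_fact (Total X)"
proof (unfold_locales, unfold Total_simps)
  show "RaSur X \<subseteq> {f. total X f}" by (auto simp: RaSur_iff)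
  show "ReIso X \<subseteq> {f. total X f}" by (auto simp: ReIso_def)
next
  fix p h assume p: "p \<in> RaSur X" and h: "is_iso (Total X) h" "Dom X h = Cod X p"
  obtain k where k: "splits h k" "total X k" "h \<cdot> k = Ident X (Cod X h)"
    by (rule Total_isoE[OF h(1)])
  have "Rng X h = Ident X (Cod X h)"
    using Rng_retraction[of k h] k splitsD[OF k(1)] by simp
  then show "h \<cdot> p \<in> RaSur X"
    using p h(2) Rng_comp_surj[of p h] splits_total[OF k(1)] by (simp add: RaSur_iff)
next
  fix s h assume s: "s \<in> ReIso X" and h: "is_iso (Total X) h" "Cod X h = Dom X s"
  obtain k where k: "splits h k" by (rule Total_isoE[OF h(1)])
  then show "s \<cdot> h \<in> ReIso X" using s h(2) splits_comp unfolding ReIso_iff by blast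
next
  fix f assume "f \<in> {f. total X f}"
  then have f: "total X f" by simp
  \<comment> \<open>The image of \<open>f\<close> is obtained by splitting its range idempotent.
    That \<open>r \<cdot> f\<close> has full range follows from RR4, which replaces \<open>f\<close>
    by \<open>Rng X f = m \<cdot> r\<close>.\<close>
  obtain m r where m: "splits m r" "Cod X m = Dom X (Rng X f)" "m \<cdot> r = Rst X (Rng X f)"
    by (rule Rst_splitE[of "Rng X f"]) (use f in auto)
  have mf: "Cod X m = Cod X f" using m(2) f by simp
  have mr: "m \<cdot> r = Rng X f" using m(3) f by (simp add: RR1)
  note md = splitsD[OF m(1)]
  have fe: "f = m \<cdot> (r \<cdot> f)"
    using md(1-4) mf f by (simp add: reassoc[OF mr] RR2)
  have "total X (r \<cdot> f)" by (rule total_cancel[of m]) (use md mf f fe[symmetric] in auto)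
  moreover have "Rng X (r \<cdot> f) = Ident X (Cod X (r \<cdot> f))"
  proof -
    have "Rng X (r \<cdot> f) = Rng X (r \<cdot> (m \<cdot> r))" using RR4[of f r] md mf f mr by simp
    also have "\<dots> = Ident X (Dom X m)" using splits_Rng[OF m(1)] md(1-4) by (simp add: reassoc[OF md(5)])
    finally show ?thesis using md mf f by simp
  qed
  ultimately have "r \<cdot> f \<in> RaSur X" by (simp add: RaSur_iff)
  then show "\<exists>p\<in>RaSur X. \<exists>s\<in>ReIso X. Cod X p = Dom X s \<and> f = s \<cdot> p"
    using m(1) md f mf fe by (intro bexI[of _ "r \<cdot> f"] bexI[of _ m]) (simp_all add: ReIso_iff, blast)
next
  fix p s u v assume p: "p \<in> RaSur X" and s: "s \<in> ReIso X"
    and u: "u \<in> hom (Total X) (Dom X p) (Dom X s)" and v: "v \<in> hom (Total X) (Cod X p) (Cod X s)"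
    and vp: "v \<cdot> p = s \<cdot> u"
  have U: "total X u" "Dom X u = Dom X p" "Cod X u = Dom X s" "total X v" "Dom X v = Cod X p" "Cod X v = Cod X s"
    using u v by (auto simp: hom_def)
  have P: "total X p" "Rng X p = Ident X (Cod X p)" using p by (auto simp: RaSur_iff)
  obtain j where j: "splits s j" using s by (auto simp: ReIso_iff)
  note sd = splitsD[OF j]
  have jvp: "j \<cdot> v \<cdot> p = u" using U(1-3) sd(1-4) by (simp add: vp reassoc[OF sd(5)])
  \<comment> \<open>The only possible filler is \<open>j \<cdot> v\<close>, and the point is its
    totality: by RR3 an idempotent \<open>Rst X (j \<cdot> v)\<close> fixing \<open>p\<close> also
    fixes \<open>Rng X p\<close>, which is an identity.\<close>
  have "Rst X (j \<cdot> v) \<cdot> p = p"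
    using R4[of p "j \<cdot> v"] P U sd(1-4) jvp by simp
  then have tot: "Rst X (j \<cdot> v) = Ident X (Cod X p)"
    using RR3[of p "j \<cdot> v"] P U sd(1-4) by simp
  then have jv: "total X (j \<cdot> v)" using U sd(1-4) by (intro totalI) simp_all
  have "s \<cdot> j \<cdot> v = v"
    using R4[of v j] tot U sd(1-4) by (simp add: reassoc[OF sd(6)])
  then show "\<exists>!d. d \<in> hom (Total X) (Cod X p) (Dom X s) \<and> d \<cdot> p = u \<and> s \<cdot> d = v"
  proof (intro ex1I[of _ "j \<cdot> v"], goal_cases)
    case 1
    then show ?case using jv jvp U P sd(1-4) by (simp add: hom_def)
  next
    case (2 d)
    then show ?case using splits_cancel[OF j, of d "j \<cdot> v"] U sd(1-4) by (auto simp: hom_def)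
  qed
next
  fix f s assume "f \<in> {f. total X f}" "s \<in> ReIso X" "Cod X f = Cod X s"
  then show "\<exists>s' f'. pullback (Total X) f s s' f'"
    using Total_pullback_existsE[of f s] unfolding ReIso_iff by blast
next
  fix p s s' p' assume p: "p \<in> RaSur X" and s: "s \<in> ReIso X" and pb: "pullback (Total X) p s s' p'"
  have P: "total X p" "Rng X p = Ident X (Cod X p)" using p by (auto simp: RaSur_iff)
  obtain j where j: "splits s j" using s by (auto simp: ReIso_iff)
  obtain r where r: "splits s' r" "s' \<cdot> r = Rst X (j \<cdot> p)" by (rule Total_pullbackE[OF pb j])
  note d = T.pullbackD[OF pb, simplified] and sd = splitsD[OF j] and rd = splitsD[OF r(1)]
  \<comment> \<open>The aim is \<open>p' \<cdot> r = j \<cdot> p\<close>. As \<open>r\<close> and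
    \<open>p\<close> have full range, this equates the range of \<open>p'\<close> with that of
    \<open>j\<close>, which is an identity.\<close>
  have "p' = j \<cdot> (s \<cdot> p')" using sd(1-4) d by (simp add: reassoc[OF sd(5)])
  then have "p' = j \<cdot> (p \<cdot> s')" by (simp only: d(9))
  then have "p' \<cdot> r = (j \<cdot> (p \<cdot> s')) \<cdot> r" by simp
  also have "\<dots> = (j \<cdot> p) \<cdot> Rst X (j \<cdot> p)"
    using sd(1-4) d(1-8) rd(1-4) by (simp flip: r(2))
  also have "\<dots> = j \<cdot> p" using R1[of "j \<cdot> p"] sd(1-4) d(1-8) by simp
  finally have p'r: "p' \<cdot> r = j \<cdot> p" .
  have "Rng X p' = Rng X (p' \<cdot> r)"
    using Rng_comp_surj[of r p'] splits_Rng[OF r(1)] rd(1-4) d(1-8) by simp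
  also have "\<dots> = Rng X j"
    unfolding p'r using Rng_comp_surj[of p j] P sd(1-4) d(1-8) by simp
  also have "\<dots> = Ident X (Cod X p')"
    using splits_Rng[OF j] d by simp
  finally show "p' \<in> RaSur X" using d by (simp add: RaSur_iff)
qed

lemma Total_mono_fact: "mono_fact (Total X)"
proof -
  interpret stable_fact "Total X" by (rule Total_stable_fact)
  show ?thesis by unfold_locales (auto simp: ReIso_iff intro: splits_mono)
qed

end


section \<open>Functors\<close>

lemma fctr_simps [simp]:
  "FObj id_fctr A = A" "FArr id_fctr f = f"
  "FObj (comp_fctr G F) A = FObj G (FObj F A)" "FArr (comp_fctr G F) f = FArr G (FArr F f)"
  by (simp_all add: id_fctr_def comp_fctr_def)

lemma functorD:
  assumes "is_functor C D F"
  shows "A \<in> Obj C \<Longrightarrow> FObj F A \<in> Obj D"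
    and "A \<in> Obj C \<Longrightarrow> FArr F (Ident C A) = Ident D (FObj F A)"
    and "f \<in> Arr C \<Longrightarrow> FArr F f \<in> Arr D"
    and "f \<in> Arr C \<Longrightarrow> Dom D (FArr F f) = FObj F (Dom C f)"
    and "f \<in> Arr C \<Longrightarrow> Cod D (FArr F f) = FObj F (Cod C f)"
    and "f \<in> Arr C \<Longrightarrow> g \<in> Arr C \<Longrightarrow> Cod C f = Dom C g
      \<Longrightarrow> FArr F (g \<cdot>\<^bsub>C\<^esub> f) = FArr F g \<cdot>\<^bsub>D\<^esub> FArr F f"
  using assms by (auto simp: is_functor_def hom_def)

lemma functorI:
  assumes "\<And>A. A \<in> Obj C \<Longrightarrow> FObj F A \<in> Obj D"
    and "\<And>A. A \<in> Obj C \<Longrightarrow> FArr F (Ident C A) = Ident D (FObj F A)"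
    and "\<And>f. f \<in> Arr C \<Longrightarrow> FArr F f \<in> Arr D"
    and "\<And>f. f \<in> Arr C \<Longrightarrow> Dom D (FArr F f) = FObj F (Dom C f)"
    and "\<And>f. f \<in> Arr C \<Longrightarrow> Cod D (FArr F f) = FObj F (Cod C f)"
    and "\<And>f g. f \<in> Arr C \<Longrightarrow> g \<in> Arr C \<Longrightarrow> Cod C f = Dom C g
      \<Longrightarrow> FArr F (g \<cdot>\<^bsub>C\<^esub> f) = FArr F g \<cdot>\<^bsub>D\<^esub> FArr F f"
  shows "is_functor C D F"
  using assms by (simp add: is_functor_def hom_def)

lemma bij_functor_inverse:
  assumes C: "category C" and D: "category D" and F: "is_functor C D F"
    and bo: "bij_betw (FObj F) (Obj C) (Obj D)" and ba: "bij_betw (FArr F) (Arr C) (Arr D)"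
  obtains G where "is_functor D C G" "fctr_eq C (comp_fctr G F) id_fctr" "fctr_eq D (comp_fctr F G) id_fctr"
proof -
  interpret C: category C by (rule C)
  interpret D: category D by (rule D)
  note f = functorD[OF F]
  define G where "G = \<lparr>FObj = inv_into (Obj C) (FObj F), FArr = inv_into (Arr C) (FArr F)\<rparr>"
  have GF: "FObj G (FObj F A) = A" if "A \<in> Obj C" for A
    using bij_betw_inv_into_left[OF bo] that by (simp add: G_def)
  have GF': "FArr G (FArr F k) = k" if "k \<in> Arr C" for k
    using bij_betw_inv_into_left[OF ba] that by (simp add: G_def)
  have ob: "\<exists>A\<in>Obj C. B = FObj F A" if "B \<in> Obj D" for B
    using that bo by (auto simp: bij_betw_def)
  have ar: "\<exists>k\<in>Arr C. h = FArr F k" if "h \<in> Arr D" for h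
    using that ba by (auto simp: bij_betw_def)
  have "is_functor D C G"
  proof (rule functorI)
    fix A assume "A \<in> Obj D"
    then obtain B where B: "B \<in> Obj C" "A = FObj F B" using ob by blast
    then show "FObj G A \<in> Obj C" using GF by simp
    have "FArr G (FArr F (Ident C B)) = Ident C B" using GF' B by simp
    then show "FArr G (Ident D A) = Ident C (FObj G A)" using GF B f(2) by simp
  next
    fix h assume "h \<in> Arr D"
    then obtain k where k: "k \<in> Arr C" "h = FArr F k" using ar by blast
    then show "FArr G h \<in> Arr C" "Dom C (FArr G h) = FObj G (Dom D h)"
        "Cod C (FArr G h) = FObj G (Cod D h)"
      using GF' GF f(4,5) by simp_all
  next
    fix h h' assume h: "h \<in> Arr D" "h' \<in> Arr D" "Cod D h = Dom D h'"
    then obtain k k' where k: "k \<in> Arr C" "h = FArr F k" "k' \<in> Arr C" "h' = FArr F k'"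
      using ar by metis
    then have "FObj F (Cod C k) = FObj F (Dom C k')" using h f(4,5) by simp
    then have c: "Cod C k = Dom C k'" using k GF by (metis C.Cod_Obj C.Dom_Obj)
    have "FArr G (FArr F (k' \<cdot>\<^bsub>C\<^esub> k)) = k' \<cdot>\<^bsub>C\<^esub> k" using GF' k c by simp
    then show "FArr G (h' \<cdot>\<^bsub>D\<^esub> h) = FArr G h' \<cdot>\<^bsub>C\<^esub> FArr G h"
      using k c f(6) GF' by simp
  qed
  moreover have "fctr_eq C (comp_fctr G F) id_fctr"
    by (simp add: fctr_eq_def GF GF')
  moreover have "fctr_eq D (comp_fctr F G) id_fctr"
    using bij_betw_inv_into_right[OF bo] bij_betw_inv_into_right[OF ba]
    by (simp add: fctr_eq_def G_def)
  ultimately show thesis using that by blast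
qed

lemma inverse_functor_pullback:
  assumes C: "category C" and D: "category D" and F: "is_functor C D F" and G: "is_functor D C G"
    and GF: "fctr_eq C (comp_fctr G F) id_fctr" and FG: "fctr_eq D (comp_fctr F G) id_fctr"
    and p: "pullback C f t t' f'"
  shows "pullback D (FArr F f) (FArr F t) (FArr F t') (FArr F f')"
proof -
  interpret C: category C by (rule C)
  interpret D: category D by (rule D)
  note FF = functorD[OF F] and GG = functorD[OF G] and d = C.pullbackD[OF p]
  have e: "\<And>A. A \<in> Obj C \<Longrightarrow> FObj G (FObj F A) = A" "\<And>f. f \<in> Arr C \<Longrightarrow> FArr G (FArr F f) = f"
    "\<And>A. A \<in> Obj D \<Longrightarrow> FObj F (FObj G A) = A" "\<And>f. f \<in> Arr D \<Longrightarrow> FArr F (FArr G f) = f"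
    using GF FG by (auto simp: fctr_eq_def)
  show ?thesis
  proof (rule D.pullbackI)
    show "FArr F f \<cdot>\<^bsub>D\<^esub> FArr F t' = FArr F t \<cdot>\<^bsub>D\<^esub> FArr F f'"
      using d by (metis FF(6))
  next
    fix u v assume a: "u \<in> Arr D" "v \<in> Arr D" "Dom D u = Dom D v" "Cod D u = Dom D (FArr F f)"
      "Cod D v = Dom D (FArr F t)" "FArr F f \<cdot>\<^bsub>D\<^esub> u = FArr F t \<cdot>\<^bsub>D\<^esub> v"
    have c: "Dom C (FArr G u) = Dom C (FArr G v)" "Cod C (FArr G u) = Dom C f" "Cod C (FArr G v) = Dom C t"
      using a d FF GG e by auto
    have "FArr G (FArr F f \<cdot>\<^bsub>D\<^esub> u) = f \<cdot>\<^bsub>C\<^esub> FArr G u" "FArr G (FArr F t \<cdot>\<^bsub>D\<^esub> v) = t \<cdot>\<^bsub>C\<^esub> FArr G v"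
      using a(1-5) d FF(3-5) GG(6) e by simp_all
    then obtain h where h: "h \<in> Arr C" "Dom C h = Dom C (FArr G u)" "Cod C h = Dom C t'"
        "t' \<cdot>\<^bsub>C\<^esub> h = FArr G u" "f' \<cdot>\<^bsub>C\<^esub> h = FArr G v"
      using C.pullback_ex[OF p, of "FArr G u" "FArr G v"] a(1,2,6) c GG(3) by metis
    have "FArr F t' \<cdot>\<^bsub>D\<^esub> FArr F h = u" "FArr F f' \<cdot>\<^bsub>D\<^esub> FArr F h = v"
      using h d a(1,2) e(4) FF(6)[of h t'] FF(6)[of h f'] by auto
    then show "\<exists>h. h \<in> Arr D \<and> Dom D h = Dom D u \<and> Cod D h = Dom D (FArr F t') \<and>
        FArr F t' \<cdot>\<^bsub>D\<^esub> h = u \<and> FArr F f' \<cdot>\<^bsub>D\<^esub> h = v"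
      using h(1-3) d a(1,2) FF(3-5) GG(4) e(3) by (intro exI[of _ "FArr F h"]) simp
  next
    fix h k assume a: "h \<in> Arr D" "k \<in> Arr D" "Dom D h = Dom D k" "Cod D h = Dom D (FArr F t')"
      "Cod D k = Dom D (FArr F t')" "FArr F t' \<cdot>\<^bsub>D\<^esub> h = FArr F t' \<cdot>\<^bsub>D\<^esub> k"
      "FArr F f' \<cdot>\<^bsub>D\<^esub> h = FArr F f' \<cdot>\<^bsub>D\<^esub> k"
    have c: "FArr G (FArr F x \<cdot>\<^bsub>D\<^esub> y) = x \<cdot>\<^bsub>C\<^esub> FArr G y"
      if "x \<in> Arr C" "y \<in> Arr D" "Cod D y = Dom D (FArr F x)" for x y
      using that FF(3) GG(6) e(2) by simp
    have "FArr G h = FArr G k"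
    proof (rule C.pullback_uniq[OF p])
      show "t' \<cdot>\<^bsub>C\<^esub> FArr G h = t' \<cdot>\<^bsub>C\<^esub> FArr G k"
        using c[of t' h] c[of t' k] a d by simp
      show "f' \<cdot>\<^bsub>C\<^esub> FArr G h = f' \<cdot>\<^bsub>C\<^esub> FArr G k"
        using c[of f' h] c[of f' k] a d FF(4) by simp
    qed (use a d FF(4) GG e(1) in auto)
    then show "h = k" using a(1,2) e(4) by metis
  qed (use d FF in auto)
qed

text \<open>An invertible functor and its inverse preserve all pullbacks, so only the two classes
  remain to be matched; equality of their images, rather than inclusion, makes the inverse a
  1-cell.\<close>

lemma fact_iso_1cellI:
  assumes C: "stable_fact C" and D: "stable_fact D" and F: "is_functor C D F"
    and bo: "bij_betw (FObj F) (Obj C) (Obj D)" and ba: "bij_betw (FArr F) (Arr C) (Arr D)"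
    and P: "FArr F ` PP C = PP D" and S: "FArr F ` SS C = SS D"
  shows "fact_iso_1cell C D F"
proof -
  interpret C: stable_fact C by (rule C)
  interpret D: stable_fact D by (rule D)
  obtain G where G: "is_functor D C G" "fctr_eq C (comp_fctr G F) id_fctr" "fctr_eq D (comp_fctr F G) id_fctr"
    by (rule bij_functor_inverse[OF C.category_axioms D.category_axioms F bo ba])
  have "FArr G ` PP D \<subseteq> PP C" "FArr G ` SS D \<subseteq> SS C"
    using G(2) by (auto simp: fctr_eq_def simp flip: P S)
  then have "fact_1cell D C G"
    unfolding fact_1cell_def
    using C D G(1) inverse_functor_pullback[OF D.category_axioms C.category_axioms G(1) F G(3,2)]
    by (intro conjI) simp_all
  moreover have "fact_1cell C D F"
    unfolding fact_1cell_def
    using C D F P S inverse_functor_pullback[OF C.category_axioms D.category_axioms F G]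
    by (intro conjI) simp_all
  ultimately show ?thesis
    using G(2,3) unfolding fact_iso_1cell_def by blast
qed

lemma range_iso_1cellI:
  assumes F: "range_1cell X Y F"
    and bo: "bij_betw (FObj F) (Obj X) (Obj Y)" and ba: "bij_betw (FArr F) (Arr X) (Arr Y)"
  shows "range_iso_1cell X Y F"
proof -
  have XY: "split_range_cat X" "split_range_cat Y" and F': "is_functor X Y F"
    and R: "\<And>f. f \<in> Arr X \<Longrightarrow> FArr F (Rst X f) = Rst Y (FArr F f) \<and> FArr F (Rng X f) = Rng Y (FArr F f)"
    using F by (auto simp: range_1cell_def)
  interpret X: split_range_cat X by (rule XY)
  interpret Y: split_range_cat Y by (rule XY)
  obtain G where G: "is_functor Y X G" "fctr_eq X (comp_fctr G F) id_fctr" "fctr_eq Y (comp_fctr F G) id_fctr"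
    by (rule bij_functor_inverse[OF X.category_axioms Y.category_axioms F' bo ba])
  have "FArr G (Rst Y f) = Rst X (FArr G f) \<and> FArr G (Rng Y f) = Rng X (FArr G f)" if f: "f \<in> Arr Y" for f
  proof -
    obtain g where g: "g \<in> Arr X" "f = FArr F g" using f ba by (auto simp: bij_betw_def)
    have "FArr G (FArr F h) = h" if "h \<in> Arr X" for h using G(2) that by (simp add: fctr_eq_def)
    then show ?thesis using g by (simp flip: R)
  qed
  then have "range_1cell Y X G" using XY G(1) by (simp add: range_1cell_def)
  then show ?thesis using F G unfolding range_iso_1cell_def by blast
qed


section \<open>RaPar on 1-cells and 2-cells\<close>

lemma stable_fact_mono_iff: "stable_fact_mono C \<longleftrightarrow> mono_fact C"
  by (auto simp: stable_fact_mono_def mono_fact_def mono_fact_axioms_def)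

lemma (in mono_fact) RaPar_nt: "RaPar_nt C F \<alpha> A = cls (Ident C (FObj F A)) (\<alpha> A)"
  by (simp add: RaPar_nt_def span_nt_def z_equiv_span_iso)

lemma fact_1cellD:
  assumes "fact_1cell C D F"
  shows "stable_fact C" "stable_fact D" "is_functor C D F"
    "p \<in> PP C \<Longrightarrow> FArr F p \<in> PP D" "s \<in> SS C \<Longrightarrow> FArr F s \<in> SS D"
    "s \<in> SS C \<Longrightarrow> pullback C f s s' f'
      \<Longrightarrow> pullback D (FArr F f) (FArr F s) (FArr F s') (FArr F f')"
  using assms by (auto simp: fact_1cell_def)

locale mono_fact_1cell = C: mono_fact C + D: mono_fact D
  for C :: "('oc, 'mc) fact_cat" and D :: "('od, 'md) fact_cat" +
  fixes F :: "('oc, 'mc, 'od, 'md) fctr"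
  assumes cell: "fact_1cell C D F"
begin

lemmas F = functorD[OF fact_1cellD(3)[OF cell]]

declare F(1-5) [simp]

lemmas F_PP [simp] = fact_1cellD(4)[OF cell]

lemmas F_SS [simp] = fact_1cellD(5)[OF cell]

lemmas F_pullback = fact_1cellD(6)[OF cell]

lemma F_span_mor:
  assumes m: "span_mor C x (s, f) (t, g)"
  shows "span_mor D (FArr F x) (FArr F s, FArr F f) (FArr F t, FArr F g)"
proof -
  note a = m[unfolded C.span_mor_iff C.in_spans]
  have "FArr F t \<cdot>\<^bsub>D\<^esub> FArr F x = FArr F s" "FArr F g \<cdot>\<^bsub>D\<^esub> FArr F x = FArr F f"
    using F(6)[of x t, symmetric] F(6)[of x g, symmetric] a by simp_all
  then show ?thesis
    using a by (simp add: D.span_mor_iff)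
qed

lemma FObj_RaPar_fctr [simp]: "FObj (RaPar_fctr D F) A = FObj F A"
  by (simp add: RaPar_fctr_def span_fctr_def)

lemma FArr_RaPar_fctr [simp]:
  assumes "s \<in> SS C" "f \<in> Arr C" "Dom C f = Dom C s"
  shows "FArr (RaPar_fctr D F) (C.cls s f) = D.cls (FArr F s) (FArr F f)"
proof -
  let ?A = "{D.cls (FArr F t) (FArr F g) | t g. (t, g) \<in> C.cls s f}"
  have "FArr (RaPar_fctr D F) (C.cls s f) = \<Union>?A"
    by (simp add: RaPar_fctr_def span_fctr_def D.z_equiv_span_iso)
  also have "\<dots> = D.cls (FArr F s) (FArr F f)"
  proof (rule C.Union_eqI)
    show "\<exists>x. x \<in> ?A" using C.cls_representative[OF assms] by blast
    fix K assume "K \<in> ?A"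
    then obtain t g where K: "K = D.cls (FArr F t) (FArr F g)" "(t, g) \<in> C.cls s f" by blast
    from K(2) obtain x y where "span_mor C x (t, g) (s, f)" "span_mor C y (s, f) (t, g)"
      by (rule C.cls_memE)
    then show "K = D.cls (FArr F s) (FArr F f)"
      unfolding K(1) by (rule D.cls_eqI[OF F_span_mor F_span_mor])
  qed
  finally show ?thesis .
qed

lemma RaPar_1cell: "range_1cell (RaPar C) (RaPar D) (RaPar_fctr D F)"
proof -
  have "is_functor (RaPar C) (RaPar D) (RaPar_fctr D F)"
  proof (rule functorI)
    fix A assume "A \<in> Obj (RaPar C)"
    then show "FObj (RaPar_fctr D F) A \<in> Obj (RaPar D)"
      "FArr (RaPar_fctr D F) (Ident (RaPar C) A) = Ident (RaPar D) (FObj (RaPar_fctr D F) A)"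
      by (simp_all add: C.Ident_RaPar D.Ident_RaPar)
  next
    fix K assume "K \<in> Arr (RaPar C)"
    then show "FArr (RaPar_fctr D F) K \<in> Arr (RaPar D)"
      "Dom (RaPar D) (FArr (RaPar_fctr D F) K) = FObj (RaPar_fctr D F) (Dom (RaPar C) K)"
      "Cod (RaPar D) (FArr (RaPar_fctr D F) K) = FObj (RaPar_fctr D F) (Cod (RaPar C) K)"
      by (auto elim!: C.RaPar_ArrE)
  next
    fix K L assume KL: "K \<in> Arr (RaPar C)" "L \<in> Arr (RaPar C)" "Cod (RaPar C) K = Dom (RaPar C) L"
    obtain s f where s: "s \<in> SS C" "f \<in> Arr C" "Dom C f = Dom C s" "K = C.cls s f" "Cod (RaPar C) K = Cod C f"
      by (rule C.RaPar_ArrE[OF KL(1)])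
    obtain t g where t: "t \<in> SS C" "g \<in> Arr C" "Dom C g = Dom C t" "L = C.cls t g" "Dom (RaPar C) L = Cod C t"
      by (rule C.RaPar_ArrE[OF KL(2)])
    obtain t' f' where p: "pullback C f t t' f'" "t' \<in> SS C"
      by (rule C.SS_pullbackE[of f t]) (use s t KL in auto)
    note d = C.pullbackD[OF p(1)]
    have "FArr (RaPar_fctr D F) (Comp (RaPar C) L K) = D.cls (FArr F (s \<cdot>\<^bsub>C\<^esub> t')) (FArr F (g \<cdot>\<^bsub>C\<^esub> f'))"
      using C.comp_cls[OF s(1-3) t(1-3) p(1)] s t p(2) d(1-8) by simp
    also have "\<dots> = D.cls (FArr F s \<cdot>\<^bsub>D\<^esub> FArr F t') (FArr F g \<cdot>\<^bsub>D\<^esub> FArr F f')"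
      using s t p(2) d(1-8) by (simp add: F(6))
    also have "\<dots> = Comp (RaPar D) (FArr (RaPar_fctr D F) L) (FArr (RaPar_fctr D F) K)"
      using D.comp_cls[OF _ _ _ _ _ _ F_pullback[OF t(1) p(1)], of "FArr F s" "FArr F g"] s t by simp
    finally show "FArr (RaPar_fctr D F) (Comp (RaPar C) L K) =
      Comp (RaPar D) (FArr (RaPar_fctr D F) L) (FArr (RaPar_fctr D F) K)" .
  qed
  moreover have "FArr (RaPar_fctr D F) (Rst (RaPar C) K) = Rst (RaPar D) (FArr (RaPar_fctr D F) K) \<and>
      FArr (RaPar_fctr D F) (Rng (RaPar C) K) = Rng (RaPar D) (FArr (RaPar_fctr D F) K)"
    if K: "K \<in> Arr (RaPar C)" for K
  proof (rule C.RaPar_RngE[OF K], intro conjI)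
    fix s p m assume a: "s \<in> SS C" "p \<in> PP C" "m \<in> SS C" "Dom C p = Dom C s" "Cod C p = Dom C m"
      "K = C.cls s (m \<cdot>\<^bsub>C\<^esub> p)" "Rng (RaPar C) K = C.cls m m"
    show "FArr (RaPar_fctr D F) (Rst (RaPar C) K) = Rst (RaPar D) (FArr (RaPar_fctr D F) K)"
      using a(1-6) by simp
    \<comment> \<open>\<open>F\<close> maps \<open>PP\<close> and \<open>SS\<close> into the
      corresponding classes, so the image of a factorization is again one and computes the
      range.\<close>
    have "Rng (RaPar D) (FArr (RaPar_fctr D F) K) = Rng (RaPar D) (D.cls (FArr F s) (FArr F m \<cdot>\<^bsub>D\<^esub> FArr F p))"
      using a(1-6) by (simp add: F(6))
    also have "\<dots> = D.cls (FArr F m) (FArr F m)" by (rule D.Rng_cls) (use a(1-5) in auto)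
    finally show "FArr (RaPar_fctr D F) (Rng (RaPar C) K) = Rng (RaPar D) (FArr (RaPar_fctr D F) K)"
      using a(3,7) by simp
  qed
  ultimately show ?thesis
    using C.RaPar_split_range_cat D.RaPar_split_range_cat by (simp add: range_1cell_def)
qed

end

lemma fact_2cellD:
  assumes "fact_2cell C D F G \<alpha>"
  shows "fact_1cell C D F" "fact_1cell C D G"
    "A \<in> Obj C \<Longrightarrow> \<alpha> A \<in> Arr D" "A \<in> Obj C \<Longrightarrow> Dom D (\<alpha> A) = FObj F A" "A \<in> Obj C \<Longrightarrow> Cod D (\<alpha> A) = FObj G A"
    "f \<in> Arr C \<Longrightarrow> \<alpha> (Cod C f) \<cdot>\<^bsub>D\<^esub> FArr F f = FArr G f \<cdot>\<^bsub>D\<^esub> \<alpha> (Dom C f)"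
    "s \<in> SS C \<Longrightarrow> pullback D (\<alpha> (Cod C s)) (FArr G s) (FArr F s) (\<alpha> (Dom C s))"
  using assms by (auto simp: fact_2cell_def nat_trans_def hom_def)

lemma (in mono_fact) total_cls: "f \<in> Arr C \<Longrightarrow> A = Dom C f \<Longrightarrow> total (RaPar C) (cls (Ident C A) f)"
  by (simp add: total_def Ident_RaPar)

text \<open>For naturality at \<open>[s, f]\<close>, one composite needs only a pullback of an
  identity, while the other pulls \<open>FArr G s\<close> back along a component of
  \<open>\<alpha>\<close>. The pullback condition on 2-cells says that the naturality square at
  \<open>s\<close> does exactly this.\<close>

lemma RaPar_2cell:
  assumes "mono_fact C" "mono_fact D" and \<alpha>: "fact_2cell C D F G \<alpha>"
  shows "range_2cell (RaPar C) (RaPar D) (RaPar_fctr D F) (RaPar_fctr D G) (RaPar_nt D F \<alpha>)"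
proof -
  note a = fact_2cellD[OF \<alpha>]
  interpret F: mono_fact_1cell C D F
    using assms a(1) by (simp add: mono_fact_1cell_def mono_fact_1cell_axioms_def)
  interpret G: mono_fact_1cell C D G
    using assms a(2) by (simp add: mono_fact_1cell_def mono_fact_1cell_axioms_def)
  have "nat_trans (RaPar C) (RaPar D) (RaPar_fctr D F) (RaPar_fctr D G) (RaPar_nt D F \<alpha>)"
    unfolding nat_trans_def
  proof (intro conjI ballI)
    fix A assume "A \<in> Obj (RaPar C)"
    then show "RaPar_nt D F \<alpha> A \<in> hom (RaPar D) (FObj (RaPar_fctr D F) A) (FObj (RaPar_fctr D G) A)"
      using a(3-5)[of A] by (simp add: F.D.RaPar_nt hom_def)
  next
    fix K assume K: "K \<in> Arr (RaPar C)"
    obtain s f where s: "s \<in> SS C" "f \<in> Arr C" "Dom C f = Dom C s" "K = F.C.cls s f"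
      "Dom (RaPar C) K = Cod C s" "Cod (RaPar C) K = Cod C f"
      by (rule F.C.RaPar_ArrE[OF K])
    have "Comp (RaPar D) (RaPar_nt D F \<alpha> (Cod C f)) (FArr (RaPar_fctr D F) K) =
        F.D.cls (FArr F s) (\<alpha> (Cod C f) \<cdot>\<^bsub>D\<^esub> FArr F f)"
      using F.D.total_comp_cls[of "FArr F s" "FArr F f" "\<alpha> (Cod C f)"] s a(3-5)[of "Cod C f"]
      by (simp add: F.D.RaPar_nt)
    also have "\<dots> = F.D.cls (Ident D (FObj F (Cod C s)) \<cdot>\<^bsub>D\<^esub> FArr F s) (FArr G f \<cdot>\<^bsub>D\<^esub> \<alpha> (Dom C s))"
      using a(6)[of f] s by simp
    also have "\<dots> = Comp (RaPar D) (FArr (RaPar_fctr D G) K) (RaPar_nt D F \<alpha> (Cod C s))"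
      using F.D.comp_cls[OF _ _ _ _ _ _ a(7)[OF s(1)], of "Ident D (FObj F (Cod C s))" "FArr G f"]
        s a(3-5)[of "Cod C s"]
      by (simp add: F.D.RaPar_nt)
    finally show "Comp (RaPar D) (RaPar_nt D F \<alpha> (Cod (RaPar C) K)) (FArr (RaPar_fctr D F) K) =
        Comp (RaPar D) (FArr (RaPar_fctr D G) K) (RaPar_nt D F \<alpha> (Dom (RaPar C) K))"
      using s by simp
  qed
  moreover have "total (RaPar D) (RaPar_nt D F \<alpha> A)" if "A \<in> Obj C" for A
    using F.D.total_cls[of "\<alpha> A"] a(3,4)[OF that] by (simp add: F.D.RaPar_nt)
  ultimately show ?thesis
    using F.RaPar_1cell G.RaPar_1cell by (simp add: range_2cell_def)
qed


section \<open>The unit\<close>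

context mono_fact
begin

lemma FObj_unit [simp]: "FObj (unit_fctr C) A = A"
  by (simp add: unit_fctr_def)

lemma FArr_unit: "FArr (unit_fctr C) f = cls (Ident C (Dom C f)) f"
  by (simp add: unit_fctr_def z_equiv_span_iso)

text \<open>Totality of \<open>[s, f]\<close> means \<open>[s, s] = [1, 1]\<close>, which makes
  \<open>s\<close> invertible; transporting \<open>f\<close> along the inverse \<open>x\<close>
  gives the representative with an identity as left leg.\<close>

lemma total_RaParE:
  assumes "total (RaPar C) K"
  obtains f where "f \<in> Arr C" "K = cls (Ident C (Dom C f)) f" "Dom (RaPar C) K = Dom C f"
    "Cod (RaPar C) K = Cod C f"
proof -
  have "K \<in> Arr (RaPar C)" using assms by (simp add: total_def)
  then obtain s f where s: "s \<in> SS C" "f \<in> Arr C" "Dom C f = Dom C s" "K = cls s f" "Dom (RaPar C) K = Cod C s"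
      "Cod (RaPar C) K = Cod C f"
    by (rule RaPar_ArrE)
  have "cls (Ident C (Cod C s)) (Ident C (Cod C s)) = cls s s"
    using assms s by (simp add: total_def Ident_RaPar)
  then obtain x where x: "is_iso C x" "Dom C x = Cod C s" "Cod C x = Dom C s" "s \<cdot> x = Ident C (Cod C s)"
    by (rule cls_eqD) (use s in auto)
  have xA: "x \<in> Arr C" using x(1) by (rule iso_Arr)
  have xs: "x \<cdot> s = Ident C (Dom C s)"
    by (rule SS_cancel[OF s(1)]) (use s xA x in \<open>auto simp: reassoc[OF x(4)]\<close>)
  have "span_mor C s (s, f) (Ident C (Cod C s), f \<cdot> x)" "span_mor C x (Ident C (Cod C s), f \<cdot> x) (s, f)"
    using s xA x xs by (auto simp: span_mor_iff)
  then have "K = cls (Ident C (Cod C s)) (f \<cdot> x)" using s cls_eqI by blast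
  then show thesis using that[of "f \<cdot> x"] s xA x by simp
qed

lemma cls_Ident_eqD:
  assumes "cls (Ident C A) f = cls (Ident C A) g" "f \<in> Arr C" "g \<in> Arr C" "Dom C f = A" "Dom C g = A"
  shows "f = g"
proof -
  obtain x where "is_iso C x" "Dom C x = A" "Cod C x = A" "Ident C A \<cdot> x = Ident C A" "g \<cdot> x = f"
    by (rule cls_eqD[OF assms(1)]) (use assms in auto)
  then show ?thesis using assms iso_Arr[of x] by simp
qed

lemma unit_functor: "is_functor C (Total (RaPar C)) (unit_fctr C)"
proof (rule functorI)
  fix f g assume "f \<in> Arr C" "g \<in> Arr C" "Cod C f = Dom C g"
  then show "FArr (unit_fctr C) (g \<cdot> f) = FArr (unit_fctr C) g \<cdot>\<^bsub>Total (RaPar C)\<^esub> FArr (unit_fctr C) f"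
    using total_comp_cls[of "Ident C (Dom C f)" f g] by (simp add: FArr_unit)
qed (auto simp: FArr_unit Ident_RaPar total_cls)

lemma unit_bij: "bij_betw (FArr (unit_fctr C)) (Arr C) (Arr (Total (RaPar C)))"
  unfolding bij_betw_def
proof
  show "inj_on (FArr (unit_fctr C)) (Arr C)"
  proof (rule inj_onI)
    fix f g assume a: "f \<in> Arr C" "g \<in> Arr C" "FArr (unit_fctr C) f = FArr (unit_fctr C) g"
    then have "Dom (RaPar C) (FArr (unit_fctr C) f) = Dom (RaPar C) (FArr (unit_fctr C) g)" by simp
    then have "Dom C f = Dom C g" using a(1,2) by (simp add: FArr_unit)
    then show "f = g" using a cls_Ident_eqD by (auto simp: FArr_unit)
  qed
  show "FArr (unit_fctr C) ` Arr C = Arr (Total (RaPar C))"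
    by (auto simp: FArr_unit total_cls elim!: total_RaParE)
qed

text \<open>The range of \<open>[1, f]\<close> is represented by the \<open>SS\<close>-part
  \<open>m\<close> of \<open>f\<close>. It is an identity exactly when \<open>m\<close> is
  invertible, and this is equivalent to \<open>f\<close> lying in \<open>PP\<close>: if
  \<open>f\<close> lies there, filling \<open>f\<close> against \<open>m\<close> gives a section of
  \<open>m\<close>.\<close>

lemma unit_RaSur:
  assumes f: "f \<in> Arr C"
  shows "FArr (unit_fctr C) f \<in> RaSur (RaPar C) \<longleftrightarrow> f \<in> PP C"
proof -
  obtain p m where pm: "p \<in> PP C" "m \<in> SS C" "Cod C p = Dom C m" "Dom C p = Dom C f"
    "Cod C m = Cod C f" "f = m \<cdot> p" by (rule factorE[OF f])
  have R: "Rng (RaPar C) (FArr (unit_fctr C) f) = cls m m"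
    using Rng_cls[of "Ident C (Dom C f)" p m] pm(1-5) f by (simp add: FArr_unit flip: pm(6))
  have "cls m m = cls (Ident C (Cod C m)) (Ident C (Cod C m)) \<longleftrightarrow> f \<in> PP C"
  proof
    assume "cls m m = cls (Ident C (Cod C m)) (Ident C (Cod C m))"
    then obtain x where "is_iso C x" "Dom C x = Dom C m" "Cod C x = Cod C m" "Ident C (Cod C m) \<cdot> x = m"
      by (rule cls_eqD) (use pm(2) in auto)
    then have "is_iso C m" using iso_Arr[of x] by simp
    then show "f \<in> PP C" using PP_iso[OF pm(1), of m] pm(3,6) by simp
  next
    assume fP: "f \<in> PP C"
    have mp: "m \<cdot> p = f" using pm(6) by simp
    obtain d where "d \<in> Arr C" "Dom C d = Cod C f" "Cod C d = Dom C m" "m \<cdot> d = Ident C (Cod C m)"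
      by (rule fillE[OF fP pm(2), of p "Ident C (Cod C m)"]) (use pm(1-5) f mp in auto)
    then have "span_mor C d (Ident C (Cod C m), Ident C (Cod C m)) (m, m)"
      "span_mor C m (m, m) (Ident C (Cod C m), Ident C (Cod C m))"
      using pm(2,5) f by (auto simp: span_mor_iff)
    then show "cls m m = cls (Ident C (Cod C m)) (Ident C (Cod C m))" by (metis cls_eqI)
  qed
  then show ?thesis
    using R f pm(5) total_cls[OF f] by (simp add: RaSur_def FArr_unit Ident_RaPar)
qed

lemma RaPar_plain: "plain_split_range_cat (RaPar C)"
  by (simp add: plain_split_range_cat_def RaPar_split_range_cat)

interpretation X: plain_split_range_cat "RaPar C"
  by (rule RaPar_plain)

lemma splits_cls:
  assumes s: "s \<in> SS C"
  shows "X.splits (cls (Ident C (Dom C s)) s) (cls s (Ident C (Dom C s)))"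
  using total_comp_cls[of s "Ident C (Dom C s)" s]
    comp_cls_mono[of "Ident C (Dom C s)" "Ident C (Dom C s)" s "Ident C (Dom C s)"] s
  by (simp add: X.splits_def Ident_RaPar)

text \<open>For the converse direction, a restricted inverse \<open>[t, g]\<close> of
  \<open>[1, f]\<close> forces \<open>f\<close> to be \<open>t\<close> precomposed with an
  isomorphism inverse to \<open>g\<close>.\<close>

lemma unit_ReIso:
  assumes f: "f \<in> Arr C"
  shows "FArr (unit_fctr C) f \<in> ReIso (RaPar C) \<longleftrightarrow> f \<in> SS C"
proof
  assume "f \<in> SS C"
  then show "FArr (unit_fctr C) f \<in> ReIso (RaPar C)"
    using splits_cls by (auto simp: X.ReIso_iff FArr_unit)
next
  assume "FArr (unit_fctr C) f \<in> ReIso (RaPar C)"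
  then obtain K where K: "X.splits (cls (Ident C (Dom C f)) f) K"
    by (auto simp: X.ReIso_iff FArr_unit)
  note kd = X.splitsD[OF K]
  obtain t g where t: "t \<in> SS C" "g \<in> Arr C" "Dom C g = Dom C t" "K = cls t g"
    "Dom (RaPar C) K = Cod C t" "Cod (RaPar C) K = Cod C g"
    using kd(2) by (rule RaPar_ArrE)
  have c: "Cod C t = Cod C f" "Cod C g = Dom C f" using kd t f by auto
  have fg: "f \<cdot> g \<in> Arr C" "Dom C (f \<cdot> g) = Dom C t" using t f c by simp_all
  \<comment> \<open>The composite \<open>[1, f] \<cdot> [t, g]\<close> is the restriction of
    \<open>[t, g]\<close>; comparing representatives gives \<open>f \<cdot> g = t\<close>.\<close>
  have "cls t (f \<cdot> g) = cls t t"
    using kd(6) total_comp_cls[of t g f] t f c by simp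
  then obtain x where "t \<cdot> x = t" "t \<cdot> x = f \<cdot> g"
    using t(1) fg by (rule cls_eqD) (rule that)
  then have fgt: "f \<cdot> g = t" by simp
  obtain t' f' where p: "pullback C f t t' f'" "t' \<in> SS C"
    by (rule SS_pullbackE[OF f t(1) c(1)[symmetric]])
  note d = pullbackD[OF p(1)]
  \<comment> \<open>The opposite composite is an identity, so the pullback \<open>t'\<close> of
    \<open>t\<close> along \<open>f\<close> is invertible and equals
    \<open>g \<cdot> f'\<close>.\<close>
  have "cls t' (g \<cdot> f') = cls (Ident C (Dom C f)) (Ident C (Dom C f))"
    using kd(5) comp_cls[OF _ f _ t(1-3) p(1), of "Ident C (Dom C f)"] t f d(1-8) by (simp add: Ident_RaPar)
  then obtain y where y: "is_iso C y" "Dom C y = Dom C t'" "Cod C y = Dom C f"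
      "Ident C (Dom C f) \<cdot> y = t'" "Ident C (Dom C f) \<cdot> y = g \<cdot> f'"
    by (rule cls_eqD) (use t d p(2) in auto)
  then have t': "is_iso C t'" "g \<cdot> f' = t'" using iso_Arr[of y] by auto
  obtain k where k: "k \<in> Arr C" "Dom C k = Cod C t'" "Cod C k = Dom C t'" "t' \<cdot> k = Ident C (Cod C t')"
    by (rule isoE[OF t'(1)])
  \<comment> \<open>With \<open>k\<close> inverse to \<open>t'\<close>, this is the second pullback
    leg transported to the domain of \<open>f\<close>. It is inverse to \<open>g\<close> and
    satisfies \<open>t \<cdot> ?h = f\<close>.\<close>
  let ?h = "f' \<cdot> k"
  have gh: "g \<cdot> ?h = Ident C (Dom C f)"
    using t(1-3) d(1-8) k c by (simp add: reassoc[OF t'(2)])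
  have "t \<cdot> ?h = (f \<cdot> t') \<cdot> k" using t(1-3) d k c by simp
  then have th: "t \<cdot> ?h = f" using d(1-8) k f by simp
  have "?h \<cdot> g = Ident C (Dom C t)"
  proof (rule SS_cancel[OF t(1)])
    show "t \<cdot> ?h \<cdot> g = t \<cdot> Ident C (Dom C t)"
      using reassoc[OF th, of g] t(1-3) d(1-8) k c f fgt by simp
  qed (use t(1-3) d(1-8) k c in auto)
  then have "is_iso C ?h" using gh t(1-3) d(1-8) k c by (intro isoI[of ?h g]) auto
  then show "f \<in> SS C"
    using SS_iso[OF t(1), of ?h] th d(1-8) k by simp
qed

lemma image_eqI_iff:
  "h ` A = T \<Longrightarrow> U \<subseteq> T \<Longrightarrow> V \<subseteq> A \<Longrightarrow> (\<And>x. x \<in> A \<Longrightarrow> h x \<in> U \<longleftrightarrow> x \<in> V) \<Longrightarrow> h ` V = U"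
  by blast

lemma unit_fact_iso: "fact_iso_1cell C (Total (RaPar C)) (unit_fctr C)"
proof (rule fact_iso_1cellI)
  have a: "FArr (unit_fctr C) ` Arr C = {K. total (RaPar C) K}"
    using unit_bij by (simp add: bij_betw_def)
  have "RaSur (RaPar C) \<subseteq> {K. total (RaPar C) K}" "ReIso (RaPar C) \<subseteq> {K. total (RaPar C) K}"
    by (auto simp: X.RaSur_iff ReIso_def)
  then show "FArr (unit_fctr C) ` PP C = PP (Total (RaPar C))"
    "FArr (unit_fctr C) ` SS C = SS (Total (RaPar C))"
    using image_eqI_iff[OF a _ PP_Arr unit_RaSur] image_eqI_iff[OF a _ SS_Arr unit_ReIso] by simp_all
  show "bij_betw (FObj (unit_fctr C)) (Obj C) (Obj (Total (RaPar C)))"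
    by (simp add: bij_betw_def inj_on_def image_def)
qed (rule stable_fact_axioms X.Total_stable_fact unit_functor unit_bij)+

end

lemma fact_iso_1cell_inj:
  assumes "fact_iso_1cell C D F"
  shows "inj_on (FArr F) (Arr C)"
proof -
  obtain G where "fctr_eq C (comp_fctr G F) id_fctr"
    using assms by (auto simp: fact_iso_1cell_def)
  then show ?thesis
    by (intro inj_on_inverseI[of _ "FArr G"]) (simp add: fctr_eq_def)
qed


section \<open>Total on 1-cells and 2-cells\<close>

lemma plainI: "split_range_cat X \<Longrightarrow> plain_split_range_cat X"
  by (simp add: plain_split_range_cat_def)

locale split_range_1cell = X: plain_split_range_cat X + Y: plain_split_range_cat Y
  for X :: "('ox, 'mx) range_cat" and Y :: "('oy, 'my) range_cat" +
  fixes F :: "('ox, 'mx, 'oy, 'my) fctr"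
  assumes cell: "range_1cell X Y F"
begin

lemma F_functor: "is_functor X Y F"
  using cell by (simp add: range_1cell_def)

lemmas F = functorD[OF F_functor]

declare F(1-5) [simp]

lemma F_Rst: "f \<in> Arr X \<Longrightarrow> FArr F (Rst X f) = Rst Y (FArr F f)"
  using cell by (simp add: range_1cell_def)

lemma F_Rng: "f \<in> Arr X \<Longrightarrow> FArr F (Rng X f) = Rng Y (FArr F f)"
  using cell by (simp add: range_1cell_def)

lemma F_total [simp]: "total X f \<Longrightarrow> total Y (FArr F f)"
  by (rule Y.totalI) (simp_all flip: F_Rst)

lemma F_splits:
  assumes "X.splits m r" shows "Y.splits (FArr F m) (FArr F r)"
proof -
  note d = X.splitsD[OF assms]
  show ?thesis
    using d F(6)[of m r, symmetric] F(6)[of r m, symmetric]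
    by (simp add: Y.splits_def F_Rst)
qed

lemma FArr_Total_fctr [simp]: "total X f \<Longrightarrow> FArr (Total_fctr X F) f = FArr F f"
  by (simp add: Total_fctr_def)

lemma FObj_Total_fctr [simp]: "FObj (Total_fctr X F) A = FObj F A"
  by (simp add: Total_fctr_def)

text \<open>\<open>Total_pullbackE\<close> turns a pullback along a restricted isomorphism into an
  equation between restrictions, \<open>F\<close> preserves that equation, and
  \<open>Total_pullbackI\<close> turns it back into a pullback.\<close>

lemma Total_1cell: "fact_1cell (Total X) (Total Y) (Total_fctr X F)"
  unfolding fact_1cell_def
proof (intro conjI allI impI)
  show "is_functor (Total X) (Total Y) (Total_fctr X F)"
    by (rule functorI) (simp_all add: F(6))
  show "FArr (Total_fctr X F) ` PP (Total X) \<subseteq> PP (Total Y)"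
    by (auto simp: X.RaSur_iff Y.RaSur_iff simp flip: F_Rng)
  show "FArr (Total_fctr X F) ` SS (Total X) \<subseteq> SS (Total Y)"
    using F_splits X.splits_total by (fastforce simp: X.ReIso_iff Y.ReIso_iff)
  fix f s s' f' assume "s \<in> SS (Total X)" and p: "pullback (Total X) f s s' f'"
  then obtain j where j: "X.splits s j" by (auto simp: X.ReIso_iff)
  obtain r where r: "X.splits s' r" "s' \<cdot>\<^bsub>X\<^esub> r = Rst X (j \<cdot>\<^bsub>X\<^esub> f)"
    by (rule X.Total_pullbackE[OF p j])
  note d = X.T.pullbackD[OF p, unfolded Total_simps mem_Collect_eq]
  note jd = X.splitsD[OF j] and rd = X.splitsD[OF r(1)]
  have "FArr F (s' \<cdot>\<^bsub>X\<^esub> r) = Rst Y (FArr F (j \<cdot>\<^bsub>X\<^esub> f))"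
    unfolding r(2) using jd d by (simp add: F_Rst)
  then have "FArr F s' \<cdot>\<^bsub>Y\<^esub> FArr F r = Rst Y (FArr F j \<cdot>\<^bsub>Y\<^esub> FArr F f)"
    using jd(1-4) rd(1-4) d by (simp add: F(6))
  moreover have "FArr F f \<cdot>\<^bsub>Y\<^esub> FArr F s' = FArr F s \<cdot>\<^bsub>Y\<^esub> FArr F f'"
    using F(6)[of s' f] F(6)[of f' s] d by simp
  ultimately show "pullback (Total Y) (FArr (Total_fctr X F) f) (FArr (Total_fctr X F) s)
      (FArr (Total_fctr X F) s') (FArr (Total_fctr X F) f')"
    using Y.Total_pullbackI[OF _ F_splits[OF j] _ F_splits[OF r(1)], of "FArr F f" "FArr F f'"] d
    by simp
qed (rule X.Total_stable_fact Y.Total_stable_fact)+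

end

lemma range_2cellD:
  assumes "range_2cell X Y F G \<alpha>"
  shows "range_1cell X Y F" "range_1cell X Y G" "split_range_cat X" "split_range_cat Y"
    "A \<in> Obj X \<Longrightarrow> \<alpha> A \<in> Arr Y" "A \<in> Obj X \<Longrightarrow> Dom Y (\<alpha> A) = FObj F A" "A \<in> Obj X \<Longrightarrow> Cod Y (\<alpha> A) = FObj G A"
    "f \<in> Arr X \<Longrightarrow> \<alpha> (Cod X f) \<cdot>\<^bsub>Y\<^esub> FArr F f = FArr G f \<cdot>\<^bsub>Y\<^esub> \<alpha> (Dom X f)"
    "A \<in> Obj X \<Longrightarrow> total Y (\<alpha> A)"
  using assms by (auto simp: range_2cell_def nat_trans_def hom_def range_1cell_def)

lemma split_range_1cellI: "range_1cell X Y F \<Longrightarrow> split_range_1cell X Y F"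
  by (simp add: split_range_1cell_def split_range_1cell_axioms_def plainI range_1cell_def)

lemma Total_2cell:
  assumes \<alpha>: "range_2cell X Y F G \<alpha>"
  shows "fact_2cell (Total X) (Total Y) (Total_fctr X F) (Total_fctr X G) (Total_nt \<alpha>)"
proof -
  note a = range_2cellD[OF \<alpha>]
  interpret F: split_range_1cell X Y F by (rule split_range_1cellI[OF a(1)])
  interpret G: split_range_1cell X Y G by (rule split_range_1cellI[OF a(2)])
  have "nat_trans (Total X) (Total Y) (Total_fctr X F) (Total_fctr X G) \<alpha>"
    using a(6-9) by (simp add: nat_trans_def hom_def)
  moreover have "pullback (Total Y) (\<alpha> (Cod X s)) (FArr G s) (FArr F s) (\<alpha> (Dom X s))"
    if s: "s \<in> ReIso X" for s
  proof -
    obtain j where j: "F.X.splits s j" using s by (auto simp: F.X.ReIso_iff)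
    note jd = F.X.splitsD[OF j]
    have ob: "Cod X s \<in> Obj X" "Dom X s \<in> Obj X" using jd by auto
    \<comment> \<open>The pullback criterion asks for the restriction of \<open>FArr G j\<close>
      after a component of \<open>\<alpha>\<close>. Naturality at the possibly partial
      \<open>j\<close> exchanges it for a composite whose total left factor does not affect the
      restriction.\<close>
    have "FArr F s \<cdot>\<^bsub>Y\<^esub> FArr F j = Rst Y (FArr F j)"
      using F.F(6)[of j s] jd F.F_Rst[of j] by simp
    also have "\<dots> = Rst Y (\<alpha> (Dom X s) \<cdot>\<^bsub>Y\<^esub> FArr F j)"
      using F.Y.Rst_total_comp[of "FArr F j" "\<alpha> (Dom X s)"] a(6,9) ob jd by simp
    also have "\<dots> = Rst Y (FArr G j \<cdot>\<^bsub>Y\<^esub> \<alpha> (Cod X s))"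
      using a(8)[of j] jd by simp
    finally show ?thesis
      using F.Y.Total_pullbackI[OF a(9) G.F_splits[OF j] _ F.F_splits[OF j], of "Cod X s" "\<alpha> (Dom X s)"]
        a(5-7) a(8)[of s] ob jd(1) by simp
  qed
  moreover have "total X s" if "s \<in> ReIso X" for s
    using that by (simp add: ReIso_def)
  ultimately show ?thesis
    using F.Total_1cell G.Total_1cell by (simp add: fact_2cell_def Total_nt_def)
qed


section \<open>The counit\<close>

context plain_split_range_cat
begin

sublocale M: mono_fact "Total X"
  by (rule Total_mono_fact)

lemma FObj_counit [simp]: "FObj (counit_fctr X) A = A"
  by (simp add: counit_fctr_def)

text \<open>If \<open>s = t \<cdot> x\<close> with \<open>x\<close> invertible, uniqueness of
  restricted inverses gives \<open>j = z \<cdot> k\<close> with \<open>z\<close> inverse to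
  \<open>x\<close>, and \<open>x\<close> cancels against \<open>z\<close>. All representatives thus
  give the same value.\<close>

lemma counit_cls:
  assumes s: "splits s j" and f: "total X f" "Dom X f = Dom X s"
  shows "FArr (counit_fctr X) (M.cls s f) = f \<cdot> j"
proof -
  have "(case y of (s, f) \<Rightarrow> f \<cdot> rinv X s) = f \<cdot> j" if y: "y \<in> M.cls s f" for y
  proof (cases y)
    case (Pair t g)
    with y obtain x where x: "is_iso (Total X) x" "span_mor (Total X) x (s, f) (t, g)"
      by (auto simp: M.in_cls span_iso_def)
    then have t: "t \<in> ReIso X" "total X g" "Dom X g = Dom X t" "total X x" "Dom X x = Dom X s"
      "Cod X x = Dom X t" "t \<cdot> x = s" "g \<cdot> x = f"
      by (simp_all add: M.span_mor_iff)
    obtain k where k: "splits t k" using t by (auto simp: ReIso_iff)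
    obtain z where z: "splits x z" "x \<cdot> z = Ident X (Cod X x)" by (rule Total_isoE[OF x(1)])
    note kd = splitsD[OF k] and zd = splitsD[OF z(1)]
    have "j = z \<cdot> k"
      using rinv_splits[OF splits_comp[OF z(1) k t(6)]] rinv_splits[OF s] t(7) by simp
    moreover have "(g \<cdot> x) \<cdot> (z \<cdot> k) = g \<cdot> k"
      using t(2,3,6) kd(1-4) zd(1-4) by (simp add: reassoc[OF z(2)])
    ultimately have "f \<cdot> j = g \<cdot> k" by (simp only: t(8))
    then show ?thesis using Pair k by simp
  qed
  moreover have "(s, f) \<in> M.cls s f"
    using M.cls_representative[of s f] s f by (auto simp: ReIso_iff)
  ultimately have "the_elem ((\<lambda>(s, f). f \<cdot> rinv X s) ` M.cls s f) = f \<cdot> j"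
    by (intro M.the_elem_image_const)
  then show ?thesis by (simp add: counit_fctr_def)
qed

lemma RaPar_TotalE:
  assumes "K \<in> Arr (RaPar (Total X))"
  obtains s j f where "splits s j" "total X f" "Dom X f = Dom X s" "K = M.cls s f"
    "Dom (RaPar (Total X)) K = Cod X s" "Cod (RaPar (Total X)) K = Cod X f"
    "FArr (counit_fctr X) K = f \<cdot> j"
proof -
  obtain s f where s: "s \<in> ReIso X" "total X f" "Dom X f = Dom X s" "K = M.cls s f"
    "Dom (RaPar (Total X)) K = Cod X s" "Cod (RaPar (Total X)) K = Cod X f"
    using M.RaPar_ArrE[OF assms] by auto
  then show thesis using that counit_cls unfolding ReIso_iff by blast
qed

lemma counit_functor: "is_functor (RaPar (Total X)) X (counit_fctr X)"
proof (rule functorI)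
  fix A assume "A \<in> Obj (RaPar (Total X))"
  then have A: "A \<in> Obj X" by simp
  then have "splits (Ident X A) (Ident X A)" by (simp add: splits_def)
  then show "FArr (counit_fctr X) (Ident (RaPar (Total X)) A) = Ident X (FObj (counit_fctr X) A)"
    using counit_cls[of "Ident X A" "Ident X A" "Ident X A"] A by (simp add: M.Ident_RaPar)
next
  fix K assume "K \<in> Arr (RaPar (Total X))"
  then obtain s j f where "splits s j" "total X f" "Dom X f = Dom X s"
    "Dom (RaPar (Total X)) K = Cod X s" "Cod (RaPar (Total X)) K = Cod X f"
    "FArr (counit_fctr X) K = f \<cdot> j" by (rule RaPar_TotalE)
  then show "FArr (counit_fctr X) K \<in> Arr X"
    "Dom X (FArr (counit_fctr X) K) = FObj (counit_fctr X) (Dom (RaPar (Total X)) K)"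
    "Cod X (FArr (counit_fctr X) K) = FObj (counit_fctr X) (Cod (RaPar (Total X)) K)"
    using splitsD[of s j] by simp_all
next
  fix K L assume KL: "K \<in> Arr (RaPar (Total X))" "L \<in> Arr (RaPar (Total X))"
    "Cod (RaPar (Total X)) K = Dom (RaPar (Total X)) L"
  obtain s j f where s: "splits s j" "total X f" "Dom X f = Dom X s" "K = M.cls s f"
    "Cod (RaPar (Total X)) K = Cod X f" "FArr (counit_fctr X) K = f \<cdot> j"
    by (rule RaPar_TotalE[OF KL(1)])
  obtain t k g where t: "splits t k" "total X g" "Dom X g = Dom X t" "L = M.cls t g"
    "Dom (RaPar (Total X)) L = Cod X t" "FArr (counit_fctr X) L = g \<cdot> k"
    by (rule RaPar_TotalE[OF KL(2)])
  have ft: "Cod X f = Cod X t" using KL s t by simp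
  have SS: "s \<in> ReIso X" "t \<in> ReIso X" using s t by (auto simp: ReIso_iff)
  obtain t' f' where p: "pullback (Total X) f t t' f'"
    using M.SS_pullback_exists[of f t] s t SS ft by auto
  obtain r where r: "splits t' r" "t' \<cdot> r = Rst X (k \<cdot> f)" by (rule Total_pullbackE[OF p t(1)])
  note d = T.pullbackD[OF p, unfolded Total_simps mem_Collect_eq]
  note sd = splitsD[OF s(1)] and td = splitsD[OF t(1)] and rd = splitsD[OF r(1)]
  \<comment> \<open>The exchange law \<open>f' \<cdot> r = k \<cdot> f\<close> converts the
    composite taken through the pullback into the composite of the two values of the counit.\<close>
  have "f' = k \<cdot> (t \<cdot> f')" using td(1-4) d by (simp add: reassoc[OF td(5)])
  then have "f' \<cdot> r = (k \<cdot> (f \<cdot> t')) \<cdot> r" by (simp only: d(9))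
  also have "\<dots> = (k \<cdot> f) \<cdot> (t' \<cdot> r)" using td(1-4) d(1-8) rd(1-4) by simp
  also have "\<dots> = k \<cdot> f" unfolding r(2) using R1[of "k \<cdot> f"] td(1-4) d(1-8) by simp
  finally have f'r: "f' \<cdot> r = k \<cdot> f" .
  have "Comp (RaPar (Total X)) L K = M.cls (s \<cdot> t') (g \<cdot> f')"
    using M.comp_cls[OF _ _ _ _ _ _ p, of s g] s t SS by simp
  then have "FArr (counit_fctr X) (Comp (RaPar (Total X)) L K) = (g \<cdot> f') \<cdot> (r \<cdot> j)"
    using counit_cls[OF splits_comp[OF r(1) s(1)], of "g \<cdot> f'"] s(2,3) t(2,3) d(1-8) sd(1) by simp
  also have "\<dots> = (g \<cdot> k) \<cdot> (f \<cdot> j)"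
    using s(2,3) t(2,3) d(1-8) sd(1-4) rd(1-4) td(1-4) by (simp add: reassoc[OF f'r])
  finally show "FArr (counit_fctr X) (Comp (RaPar (Total X)) L K) =
      FArr (counit_fctr X) L \<cdot> FArr (counit_fctr X) K"
    by (simp only: s(6) t(6))
qed simp

lemma counit_1cell: "range_1cell (RaPar (Total X)) X (counit_fctr X)"
proof -
  have "FArr (counit_fctr X) (Rst (RaPar (Total X)) K) = Rst X (FArr (counit_fctr X) K) \<and>
      FArr (counit_fctr X) (Rng (RaPar (Total X)) K) = Rng X (FArr (counit_fctr X) K)"
    if K: "K \<in> Arr (RaPar (Total X))" for K
  proof
    obtain s j f where s: "splits s j" "total X f" "Dom X f = Dom X s" "K = M.cls s f"
        "FArr (counit_fctr X) K = f \<cdot> j"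
      by (rule RaPar_TotalE[OF K])
    note sd = splitsD[OF s(1)]
    have "FArr (counit_fctr X) (M.cls s s) = Rst X (f \<cdot> j)"
      using counit_cls[OF s(1) splits_total[OF s(1)]] sd s(2,3) Rst_total_comp[of j f] by simp
    moreover have "s \<in> ReIso X" using s(1) ReIso_iff by blast
    ultimately show "FArr (counit_fctr X) (Rst (RaPar (Total X)) K) = Rst X (FArr (counit_fctr X) K)"
      using s M.Rst_cls[of s f] by simp
  next
    obtain s p m where s: "s \<in> ReIso X" "p \<in> RaSur X" "m \<in> ReIso X" "Dom X p = Dom X s" "Cod X p = Dom X m"
      "K = M.cls s (m \<cdot> p)" and RK: "Rng (RaPar (Total X)) K = M.cls m m"
      by (rule M.RaPar_RngE[OF K, unfolded Total_simps]) (rule that)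
    obtain j where j: "splits s j" using s by (auto simp: ReIso_iff)
    obtain n where n: "splits m n" using s by (auto simp: ReIso_iff)
    note jd = splitsD[OF j] and nd = splitsD[OF n]
    have p: "total X p" "Rng X p = Ident X (Cod X p)" using s by (auto simp: RaSur_iff)
    have tm: "total X m" using splits_total[OF n] .
    \<comment> \<open>Precomposition with the full-range morphisms \<open>p\<close> and
      \<open>j\<close> does not affect the range, so that of \<open>m\<close> remains. It equals the
      range of the restriction idempotent \<open>m \<cdot> n\<close>, and RR3 applied to an identity
      shows that such an idempotent is its own range.\<close>
    have "Rng X (FArr (counit_fctr X) K) = Rng X (m \<cdot> (p \<cdot> j))"
      using counit_cls[OF j, of "m \<cdot> p"] s p tm jd by simp
    also have "Rng X (m \<cdot> (p \<cdot> j)) = Rng X m"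
      using Rng_comp_surj[of "p \<cdot> j" m] Rng_comp_surj[of j p] splits_Rng[OF j] jd p tm s(4,5) by simp
    also have "\<dots> = Rng X (m \<cdot> n)"
      using Rng_comp_surj[of n m] splits_Rng[OF n] nd by simp
    also have "\<dots> = m \<cdot> n"
      using RR3[of "Ident X (Dom X n)" n] nd by simp
    also have "\<dots> = FArr (counit_fctr X) (Rng (RaPar (Total X)) K)"
      unfolding RK using counit_cls[OF n tm] by simp
    finally show "FArr (counit_fctr X) (Rng (RaPar (Total X)) K) = Rng X (FArr (counit_fctr X) K)" ..
  qed
  then show ?thesis
    using counit_functor M.RaPar_split_range_cat split_range_cat_axioms
    by (simp add: range_1cell_def)
qed

text \<open>As \<open>f\<close> and \<open>g\<close> are total,
  \<open>f \<cdot> j = g \<cdot> k\<close> forces \<open>j\<close> and \<open>k\<close> to have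
  equal restrictions. Then \<open>k \<cdot> s\<close> is a morphism of spans, and exchanging the
  roles gives one in the other direction.\<close>

lemma counit_inj: "inj_on (FArr (counit_fctr X)) (Arr (RaPar (Total X)))"
proof (rule inj_onI)
  fix K L assume KL: "K \<in> Arr (RaPar (Total X))" "L \<in> Arr (RaPar (Total X))"
    "FArr (counit_fctr X) K = FArr (counit_fctr X) L"
  have mor: "span_mor (Total X) (k \<cdot> s) (s, f) (t, g)"
    if s: "splits s j" "total X f" "Dom X f = Dom X s"
      and t: "splits t k" "total X g" "Dom X g = Dom X t" and e: "f \<cdot> j = g \<cdot> k" for s j f t k g
  proof -
    note sd = splitsD[OF s(1)] and td = splitsD[OF t(1)]
    have "Rst X j = Rst X (f \<cdot> j)" "Rst X k = Rst X (g \<cdot> k)"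
      using sd(1-4) td(1-4) s(2,3) t(2,3) by (simp_all add: Rst_total_comp)
    then have R: "Rst X j = Rst X k" using e by simp
    have "Dom X (f \<cdot> j) = Dom X (g \<cdot> k)" using e by simp
    then have c: "Cod X s = Cod X t" using sd(1-4) td(1-4) s(2,3) t(2,3) by simp
    have "t \<cdot> (k \<cdot> s) = Rst X k \<cdot> s" using sd(1-4) td(1-4) c by (simp add: reassoc[OF td(6)])
    also have "\<dots> = (s \<cdot> j) \<cdot> s" by (simp only: R[symmetric] sd(6))
    also have "\<dots> = s" using sd(1-5) by simp
    finally have 1: "t \<cdot> (k \<cdot> s) = s" .
    have "g \<cdot> (k \<cdot> s) = (f \<cdot> j) \<cdot> s" using sd(1-4) td(1-4) c t(2,3) e by simp
    also have "\<dots> = f" using sd(1-5) s(2,3) by simp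
    finally have 2: "g \<cdot> (k \<cdot> s) = f" .
    have "total X (t \<cdot> (k \<cdot> s))" unfolding 1 by (rule splits_total[OF s(1)])
    then have "total X (k \<cdot> s)"
      by (rule total_cancel) (use sd(1-4) td(1-4) c in auto)
    then show ?thesis
      using 1 2 sd(1-4) td(1-4) c s t by (auto simp: M.span_mor_iff ReIso_iff)
  qed
  obtain s j f where s: "splits s j" "total X f" "Dom X f = Dom X s" "K = M.cls s f"
    "FArr (counit_fctr X) K = f \<cdot> j"
    by (rule RaPar_TotalE[OF KL(1)])
  obtain t k g where t: "splits t k" "total X g" "Dom X g = Dom X t" "L = M.cls t g"
    "FArr (counit_fctr X) L = g \<cdot> k"
    by (rule RaPar_TotalE[OF KL(2)])
  have e: "f \<cdot> j = g \<cdot> k" using s t KL(3) by simp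
  show "K = L"
    unfolding s(4) t(4) by (rule M.cls_eqI[OF mor[OF s(1-3) t(1-3) e] mor[OF t(1-3) s(1-3) e[symmetric]]])
qed

lemma counit_surj: "h \<in> Arr X \<Longrightarrow> \<exists>K \<in> Arr (RaPar (Total X)). FArr (counit_fctr X) K = h"
proof -
  assume h: "h \<in> Arr X"
  obtain s r where s: "splits s r" "Cod X s = Dom X h" "s \<cdot> r = Rst X h"
    by (rule Rst_splitE[OF h])
  note sd = splitsD[OF s(1)]
  \<comment> \<open>Totality of \<open>h \<cdot> s\<close> is what has to be secured: R4 gives
    \<open>s \<cdot> Rst X (h \<cdot> s) = s\<close>, from which the split monomorphism
    \<open>s\<close> is cancelled.\<close>
  have "s \<cdot> Rst X (h \<cdot> s) = Rst X h \<cdot> s" using R4[of s h] sd s(2) h by simp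
  also have "\<dots> = s" using sd(1-5) unfolding s(3)[symmetric] by simp
  finally have "s \<cdot> Rst X (h \<cdot> s) = s \<cdot> Ident X (Dom X s)" using sd by simp
  then have "Rst X (h \<cdot> s) = Ident X (Dom X s)"
    by (rule splits_cancel[OF s(1), rotated -1]) (use sd s(2) h in auto)
  then have hs: "total X (h \<cdot> s)" by (intro totalI) (use sd s(2) h in auto)
  have sR: "s \<in> ReIso X" using s by (auto simp: ReIso_iff)
  have "M.cls s (h \<cdot> s) \<in> Arr (RaPar (Total X))"
    using M.cls_Arr[of s "h \<cdot> s"] sR hs sd s(2) h by simp
  moreover have "FArr (counit_fctr X) (M.cls s (h \<cdot> s)) = h"
    using counit_cls[OF s(1) hs] sd(1-4) s(2,3) h R1[OF h] by simp
  ultimately show ?thesis by blast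
qed

lemma counit_iso: "range_iso_1cell (RaPar (Total X)) X (counit_fctr X)"
proof (rule range_iso_1cellI[OF counit_1cell])
  show "bij_betw (FObj (counit_fctr X)) (Obj (RaPar (Total X))) (Obj X)"
    by (simp add: bij_betw_def inj_on_def image_def)
  show "bij_betw (FArr (counit_fctr X)) (Arr (RaPar (Total X))) (Arr X)"
    unfolding bij_betw_def
  proof
    show "FArr (counit_fctr X) ` Arr (RaPar (Total X)) = Arr X"
      using functorD(3)[OF counit_functor] counit_surj by blast
  qed (rule counit_inj)
qed

lemma unit_counit:
  "fctr_eq (Total X)
    (comp_fctr (Total_fctr (RaPar (Total X)) (counit_fctr X)) (unit_fctr (Total X))) id_fctr"
  unfolding fctr_eq_def
proof (intro conjI ballI)
  fix f assume "f \<in> Arr (Total X)"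
  then have f: "total X f" by simp
  have i: "splits (Ident X (Dom X f)) (Ident X (Dom X f))" using f by (simp add: splits_def)
  have "total (RaPar (Total X)) (M.cls (Ident X (Dom X f)) f)"
    using M.total_cls[of f] f by simp
  then show "FArr (comp_fctr (Total_fctr (RaPar (Total X)) (counit_fctr X)) (unit_fctr (Total X))) f = FArr id_fctr f"
    using counit_cls[OF i f] f by (simp add: M.FArr_unit Total_fctr_def)
qed (simp add: Total_fctr_def)

end

context mono_fact
begin

interpretation X: plain_split_range_cat "RaPar C"
  by (rule RaPar_plain)

text \<open>The restricted inverse of \<open>[1, s]\<close> is \<open>[s, 1]\<close>, so the counit
  sends the span formed by \<open>[1, s]\<close> and \<open>[1, f]\<close> to
  \<open>[1, f] \<cdot> [s, 1] = [s, f]\<close>.\<close>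

lemma counit_unit:
  "fctr_eq (RaPar C) (comp_fctr (counit_fctr (RaPar C)) (RaPar_fctr (Total (RaPar C)) (unit_fctr C))) id_fctr"
proof -
  have "fact_1cell C (Total (RaPar C)) (unit_fctr C)"
    using unit_fact_iso by (simp add: fact_iso_1cell_def)
  then interpret U: mono_fact_1cell C "Total (RaPar C)" "unit_fctr C"
    by (simp add: mono_fact_1cell_def mono_fact_1cell_axioms_def X.Total_mono_fact mono_fact_axioms)
  show ?thesis
    unfolding fctr_eq_def
  proof (intro conjI ballI)
    fix K assume "K \<in> Arr (RaPar C)"
    then obtain s f where s: "s \<in> SS C" "f \<in> Arr C" "Dom C f = Dom C s" "K = cls s f"
      by (rule RaPar_ArrE)
    have "FArr (counit_fctr (RaPar C)) (X.M.cls (FArr (unit_fctr C) s) (FArr (unit_fctr C) f)) =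
        Comp (RaPar C) (FArr (unit_fctr C) f) (cls s (Ident C (Dom C s)))"
      by (rule X.counit_cls) (use s splits_cls[of s] total_cls[of f] in \<open>auto simp: FArr_unit\<close>)
    also have "\<dots> = cls s f"
      using total_comp_cls[of s "Ident C (Dom C s)" f] s by (simp add: FArr_unit)
    finally show "FArr (comp_fctr (counit_fctr (RaPar C)) (RaPar_fctr (Total (RaPar C)) (unit_fctr C))) K =
        FArr id_fctr K"
      using s by simp
  qed simp
qed

end


section \<open>2-functoriality and 2-naturality\<close>

lemma mono_fact_1cellI: "mono_fact C \<Longrightarrow> mono_fact D \<Longrightarrow> fact_1cell C D F \<Longrightarrow> mono_fact_1cell C D F"
  by (simp add: mono_fact_1cell_def mono_fact_1cell_axioms_def)

lemma RaPar_1cell: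
  "mono_fact C \<Longrightarrow> mono_fact D \<Longrightarrow> fact_1cell C D F \<Longrightarrow> range_1cell (RaPar C) (RaPar D) (RaPar_fctr D F)"
  using mono_fact_1cell.RaPar_1cell mono_fact_1cellI by blast

lemma Total_1cell: "range_1cell X Y F \<Longrightarrow> fact_1cell (Total X) (Total Y) (Total_fctr X F)"
  using split_range_1cell.Total_1cell split_range_1cellI by blast

lemma Total_mono_factI: "split_range_cat X \<Longrightarrow> mono_fact (Total X)"
  using plain_split_range_cat.Total_mono_fact plainI by blast

lemma fact_1cell_id: "stable_fact C \<Longrightarrow> fact_1cell C C id_fctr"
proof -
  assume "stable_fact C"
  then interpret stable_fact C .
  have "is_functor C C id_fctr" by (rule functorI) simp_all
  then show ?thesis by (auto simp: fact_1cell_def stable_fact_axioms)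
qed

lemma fact_1cell_comp:
  assumes F: "fact_1cell C D F" and G: "fact_1cell D E G"
  shows "fact_1cell C E (comp_fctr G F)"
proof -
  note f = fact_1cellD[OF F] and g = fact_1cellD[OF G]
  interpret C: stable_fact C by (rule f(1))
  have "is_functor C E (comp_fctr G F)"
    using functorD[OF f(3)] functorD[OF g(3)] by (intro functorI) simp_all
  then show ?thesis
    using f(1) g(2) g(4)[OF f(4)] g(5)[OF f(5)] g(6)[OF f(5,6)]
    by (simp add: fact_1cell_def image_subset_iff)
qed

text \<open>Cells are total HOL functions compared only on the domain category, so respect for
  \<open>fctr_eq\<close> and \<open>nt_eq\<close> has to be established too. The vertical and
  horizontal composition laws reduce to \<open>total_comp_cls\<close>.\<close>

lemma RaPar_2functor:
  fixes C :: "('oc, 'mc) fact_cat" and D :: "('od, 'md) fact_cat" and E :: "('oe, 'me) fact_cat"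
  assumes C: "mono_fact C" and D: "mono_fact D" and E: "mono_fact E"
  shows "fact_1cell C D F \<Longrightarrow> fact_1cell C D G \<Longrightarrow> fctr_eq C F G \<Longrightarrow>
      fctr_eq (RaPar C) (RaPar_fctr D F) (RaPar_fctr D G)"
    and "fctr_eq C F F' \<Longrightarrow> nt_eq C \<alpha> \<alpha>' \<Longrightarrow> nt_eq (RaPar C) (RaPar_nt D F \<alpha>) (RaPar_nt D F' \<alpha>')"
    and "fctr_eq (RaPar C) (RaPar_fctr C id_fctr) id_fctr"
    and "fact_1cell C D F \<Longrightarrow> fact_1cell D E H \<Longrightarrow>
      fctr_eq (RaPar C) (RaPar_fctr E (comp_fctr H F)) (comp_fctr (RaPar_fctr E H) (RaPar_fctr D F))"
    and "fact_1cell C D F \<Longrightarrow> nt_eq (RaPar C) (RaPar_nt D F (id_nt D F)) (id_nt (RaPar D) (RaPar_fctr D F))"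
    and "fact_2cell C D F G \<alpha> \<Longrightarrow> fact_2cell C D G F' \<beta> \<Longrightarrow>
      nt_eq (RaPar C) (RaPar_nt D F (vcomp D \<beta> \<alpha>)) (vcomp (RaPar D) (RaPar_nt D G \<beta>) (RaPar_nt D F \<alpha>))"
    and "fact_2cell C D F F' \<alpha> \<Longrightarrow> fact_2cell D E H H' \<gamma> \<Longrightarrow>
      nt_eq (RaPar C) (RaPar_nt E (comp_fctr H F) (hcomp E H F' \<gamma> \<alpha>))
        (hcomp (RaPar E) (RaPar_fctr E H) (RaPar_fctr D F') (RaPar_nt E H \<gamma>) (RaPar_nt D F \<alpha>))"
proof -
  interpret C: mono_fact C by (rule C)
  interpret D: mono_fact D by (rule D)
  interpret E: mono_fact E by (rule E)
  show "fctr_eq (RaPar C) (RaPar_fctr D F) (RaPar_fctr D G)"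
    if "fact_1cell C D F" "fact_1cell C D G" "fctr_eq C F G"
  proof -
    interpret F: mono_fact_1cell C D F using C D that(1) by (rule mono_fact_1cellI)
    interpret G: mono_fact_1cell C D G using C D that(2) by (rule mono_fact_1cellI)
    show ?thesis using that(3) unfolding fctr_eq_def by (auto elim!: C.RaPar_ArrE)
  qed
  show "nt_eq (RaPar C) (RaPar_nt D F \<alpha>) (RaPar_nt D F' \<alpha>')" if "fctr_eq C F F'" "nt_eq C \<alpha> \<alpha>'"
    using that by (simp add: nt_eq_def fctr_eq_def D.RaPar_nt)
  show "fctr_eq (RaPar C) (RaPar_fctr C id_fctr) id_fctr"
  proof -
    interpret I: mono_fact_1cell C C id_fctr
      by (rule mono_fact_1cellI[OF C C fact_1cell_id[OF C.stable_fact_axioms]])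
    show ?thesis unfolding fctr_eq_def by (auto elim!: C.RaPar_ArrE)
  qed
  show "fctr_eq (RaPar C) (RaPar_fctr E (comp_fctr H F)) (comp_fctr (RaPar_fctr E H) (RaPar_fctr D F))"
    if "fact_1cell C D F" "fact_1cell D E H"
  proof -
    interpret F: mono_fact_1cell C D F using C D that(1) by (rule mono_fact_1cellI)
    interpret H: mono_fact_1cell D E H using D E that(2) by (rule mono_fact_1cellI)
    interpret HF: mono_fact_1cell C E "comp_fctr H F"
      using C E fact_1cell_comp[OF that] by (rule mono_fact_1cellI)
    show ?thesis unfolding fctr_eq_def by (auto elim!: C.RaPar_ArrE)
  qed
  show "nt_eq (RaPar C) (RaPar_nt D F (id_nt D F)) (id_nt (RaPar D) (RaPar_fctr D F))"
    if "fact_1cell C D F"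
  proof -
    interpret F: mono_fact_1cell C D F using C D that by (rule mono_fact_1cellI)
    show ?thesis by (simp add: nt_eq_def id_nt_def D.RaPar_nt D.Ident_RaPar)
  qed
  show "nt_eq (RaPar C) (RaPar_nt D F (vcomp D \<beta> \<alpha>)) (vcomp (RaPar D) (RaPar_nt D G \<beta>) (RaPar_nt D F \<alpha>))"
    if "fact_2cell C D F G \<alpha>" "fact_2cell C D G F' \<beta>"
    unfolding nt_eq_def
  proof
    fix A assume "A \<in> Obj (RaPar C)"
    then have A: "A \<in> Obj C" by simp
    note a = fact_2cellD(3-5)[OF that(1) A] and b = fact_2cellD(3-5)[OF that(2) A]
    have "FObj F A \<in> Obj D" "FObj G A \<in> Obj D" using a D.Dom_Obj D.Cod_Obj by metis+
    then show "RaPar_nt D F (vcomp D \<beta> \<alpha>) A = vcomp (RaPar D) (RaPar_nt D G \<beta>) (RaPar_nt D F \<alpha>) A"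
      using D.total_comp_cls[of "Ident D (FObj F A)" "\<alpha> A" "\<beta> A"] a b
      by (simp add: vcomp_def D.RaPar_nt)
  qed
  show "nt_eq (RaPar C) (RaPar_nt E (comp_fctr H F) (hcomp E H F' \<gamma> \<alpha>))
        (hcomp (RaPar E) (RaPar_fctr E H) (RaPar_fctr D F') (RaPar_nt E H \<gamma>) (RaPar_nt D F \<alpha>))"
    if "fact_2cell C D F F' \<alpha>" "fact_2cell D E H H' \<gamma>"
    unfolding nt_eq_def
  proof
    fix A assume "A \<in> Obj (RaPar C)"
    then have A: "A \<in> Obj C" by simp
    interpret F': mono_fact_1cell C D F' using C D fact_2cellD(2)[OF that(1)] by (rule mono_fact_1cellI)
    interpret H: mono_fact_1cell D E H using D E fact_2cellD(1)[OF that(2)] by (rule mono_fact_1cellI)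
    note a = fact_2cellD(3-5)[OF that(1) A]
    have ob: "FObj F A \<in> Obj D" "FObj F' A \<in> Obj D" using a D.Dom_Obj D.Cod_Obj by metis+
    note c = fact_2cellD(3-5)[OF that(2) ob(2)]
    show "RaPar_nt E (comp_fctr H F) (hcomp E H F' \<gamma> \<alpha>) A =
        hcomp (RaPar E) (RaPar_fctr E H) (RaPar_fctr D F') (RaPar_nt E H \<gamma>) (RaPar_nt D F \<alpha>) A"
      using E.total_comp_cls[of "Ident E (FObj H (FObj F A))" "FArr H (\<alpha> A)" "\<gamma> (FObj F' A)"] a c ob
      by (simp add: hcomp_def D.RaPar_nt E.RaPar_nt)
  qed
qed

text \<open>\<open>Total_fctr\<close> is \<open>undefined\<close> off total morphisms. Its
  composition laws therefore use that 1-cells preserve totality and that components of 2-cells are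
  total.\<close>

lemma Total_2functor:
  fixes X :: "('ox, 'mx) range_cat" and Y :: "('oy, 'my) range_cat" and Z :: "('oz, 'mz) range_cat"
  shows "fctr_eq X F G \<Longrightarrow> fctr_eq (Total X) (Total_fctr X F) (Total_fctr X G)"
    and "nt_eq X \<alpha> \<alpha>' \<Longrightarrow> nt_eq (Total X) (Total_nt \<alpha>) (Total_nt \<alpha>')"
    and "fctr_eq (Total X) (Total_fctr X id_fctr) id_fctr"
    and "range_1cell X Y F \<Longrightarrow>
      fctr_eq (Total X) (Total_fctr X (comp_fctr H F)) (comp_fctr (Total_fctr Y H) (Total_fctr X F))"
    and "nt_eq (Total X) (Total_nt (id_nt Y F)) (id_nt (Total Y) (Total_fctr X F))"
    and "nt_eq (Total X) (Total_nt (vcomp Y \<beta> \<alpha>)) (vcomp (Total Y) (Total_nt \<beta>) (Total_nt \<alpha>))"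
    and "range_2cell X Y F F' \<alpha> \<Longrightarrow>
      nt_eq (Total X) (Total_nt (hcomp Z H F' \<gamma> \<alpha>))
        (hcomp (Total Z) (Total_fctr Y H) (Total_fctr X F') (Total_nt \<gamma>) (Total_nt \<alpha>))"
proof -
  show "fctr_eq (Total X) (Total_fctr X F) (Total_fctr X G)" if "fctr_eq X F G"
    using that by (simp add: fctr_eq_def Total_fctr_def total_def)
  show "fctr_eq (Total X) (Total_fctr X (comp_fctr H F)) (comp_fctr (Total_fctr Y H) (Total_fctr X F))"
    if F: "range_1cell X Y F"
  proof -
    interpret F: split_range_1cell X Y F by (rule split_range_1cellI[OF F])
    show ?thesis by (auto simp: fctr_eq_def Total_fctr_def)
  qed
  show "nt_eq (Total X) (Total_nt (hcomp Z H F' \<gamma> \<alpha>))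
      (hcomp (Total Z) (Total_fctr Y H) (Total_fctr X F') (Total_nt \<gamma>) (Total_nt \<alpha>))"
    if "range_2cell X Y F F' \<alpha>"
    using range_2cellD(9)[OF that] by (simp add: nt_eq_def Total_nt_def hcomp_def Total_fctr_def)
qed (simp_all add: fctr_eq_def nt_eq_def Total_nt_def Total_fctr_def id_nt_def vcomp_def)

lemma unit_2natural:
  assumes C: "mono_fact C" and D: "mono_fact D"
  shows "fact_1cell C D F \<Longrightarrow>
      fctr_eq C (comp_fctr (Total_fctr (RaPar C) (RaPar_fctr D F)) (unit_fctr C)) (comp_fctr (unit_fctr D) F)"
    and "fact_2cell C D F G \<alpha> \<Longrightarrow>
      nt_eq C (whisker_right (Total_nt (RaPar_nt D F \<alpha>)) (unit_fctr C)) (whisker_left (unit_fctr D) \<alpha>)"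
proof -
  interpret C: mono_fact C by (rule C)
  interpret D: mono_fact D by (rule D)
  show "fctr_eq C (comp_fctr (Total_fctr (RaPar C) (RaPar_fctr D F)) (unit_fctr C)) (comp_fctr (unit_fctr D) F)"
    if F: "fact_1cell C D F"
  proof -
    interpret F: mono_fact_1cell C D F using C D F by (rule mono_fact_1cellI)
    show ?thesis
      by (simp add: fctr_eq_def Total_fctr_def C.FArr_unit D.FArr_unit C.total_cls)
  qed
  show "nt_eq C (whisker_right (Total_nt (RaPar_nt D F \<alpha>)) (unit_fctr C)) (whisker_left (unit_fctr D) \<alpha>)"
    if "fact_2cell C D F G \<alpha>"
    using fact_2cellD(4)[OF that]
    by (simp add: nt_eq_def whisker_right_def whisker_left_def Total_nt_def D.FArr_unit D.RaPar_nt)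
qed

text \<open>A functor preserving restrictions carries the restricted inverse of \<open>s\<close> to
  that of its image, so both composites send \<open>[s, f]\<close> to \<open>FArr F f\<close> after
  \<open>FArr F j\<close>.\<close>

lemma counit_2natural:
  assumes X: "split_range_cat X" and Y: "split_range_cat Y"
  shows "range_1cell X Y F \<Longrightarrow>
      fctr_eq (RaPar (Total X)) (comp_fctr (counit_fctr Y) (RaPar_fctr (Total Y) (Total_fctr X F)))
        (comp_fctr F (counit_fctr X))"
    and "range_2cell X Y F G \<alpha> \<Longrightarrow>
      nt_eq (RaPar (Total X))
        (whisker_left (counit_fctr Y) (RaPar_nt (Total Y) (Total_fctr X F) (Total_nt \<alpha>)))
        (whisker_right \<alpha> (counit_fctr X))"
proof -
  interpret X: plain_split_range_cat X using X by (rule plainI)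
  interpret Y: plain_split_range_cat Y using Y by (rule plainI)
  show "fctr_eq (RaPar (Total X)) (comp_fctr (counit_fctr Y) (RaPar_fctr (Total Y) (Total_fctr X F)))
        (comp_fctr F (counit_fctr X))" if F: "range_1cell X Y F"
  proof -
    interpret F: split_range_1cell X Y F by (rule split_range_1cellI[OF F])
    interpret T: mono_fact_1cell "Total X" "Total Y" "Total_fctr X F"
      by (rule mono_fact_1cellI[OF X.Total_mono_fact Y.Total_mono_fact F.Total_1cell])
    show ?thesis
      unfolding fctr_eq_def
    proof (intro conjI ballI)
      fix K assume "K \<in> Arr (RaPar (Total X))"
      then obtain s j f where s: "X.splits s j" "total X f" "Dom X f = Dom X s" "K = X.M.cls s f"
        "FArr (counit_fctr X) K = f \<cdot>\<^bsub>X\<^esub> j" by (rule X.RaPar_TotalE)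
      note sd = X.splitsD[OF s(1)]
      have sR: "s \<in> ReIso X" using s(1) X.ReIso_iff by blast
      have "FArr (RaPar_fctr (Total Y) (Total_fctr X F)) K = Y.M.cls (FArr F s) (FArr F f)"
        using T.FArr_RaPar_fctr[of s f] s(2-4) sR X.splits_total[OF s(1)] by simp
      moreover have "FArr (counit_fctr Y) (Y.M.cls (FArr F s) (FArr F f)) = FArr F f \<cdot>\<^bsub>Y\<^esub> FArr F j"
        using Y.counit_cls[OF F.F_splits[OF s(1)] F.F_total[OF s(2)]] s(2,3) sd(1) by simp
      moreover have "FArr F (FArr (counit_fctr X) K) = FArr F f \<cdot>\<^bsub>Y\<^esub> FArr F j"
        using F.F(6)[of j f] s(2,3,5) sd(1-4) by simp
      ultimately show "FArr (comp_fctr (counit_fctr Y) (RaPar_fctr (Total Y) (Total_fctr X F))) K =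
          FArr (comp_fctr F (counit_fctr X)) K" by simp
    qed simp
  qed
  show "nt_eq (RaPar (Total X))
        (whisker_left (counit_fctr Y) (RaPar_nt (Total Y) (Total_fctr X F) (Total_nt \<alpha>)))
        (whisker_right \<alpha> (counit_fctr X))" if a: "range_2cell X Y F G \<alpha>"
    unfolding nt_eq_def
  proof
    fix A assume "A \<in> Obj (RaPar (Total X))"
    then have A: "A \<in> Obj X" by simp
    note a = range_2cellD(5,6,9)[OF a A]
    have "FObj F A \<in> Obj Y" using a(1,2) Y.Dom_Obj by metis
    then have "Y.splits (Ident Y (FObj F A)) (Ident Y (FObj F A))" by (simp add: Y.splits_def)
    then show "whisker_left (counit_fctr Y) (RaPar_nt (Total Y) (Total_fctr X F) (Total_nt \<alpha>)) A =
        whisker_right \<alpha> (counit_fctr X) A"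
      using Y.counit_cls[of "Ident Y (FObj F A)" "Ident Y (FObj F A)" "\<alpha> A"] a \<open>FObj F A \<in> Obj Y\<close>
      by (simp add: whisker_left_def whisker_right_def Y.M.RaPar_nt Total_nt_def Total_fctr_def)
  qed
qed

lemma unit_iso_iff_mono:
  assumes "stable_fact C"
  shows "fact_iso_1cell C (Total (RaPar C)) (unit_fctr C) \<longleftrightarrow> (\<forall>s \<in> SS C. is_mono C s)"
proof
  show "\<forall>s \<in> SS C. is_mono C s" if "fact_iso_1cell C (Total (RaPar C)) (unit_fctr C)"
    using unit_inj_imp_mono[OF assms fact_iso_1cell_inj[OF that]] by blast
  show "fact_iso_1cell C (Total (RaPar C)) (unit_fctr C)" if "\<forall>s \<in> SS C. is_mono C s"
    using that assms by (intro mono_fact.unit_fact_iso) (simp flip: stable_fact_mono_iff add: stable_fact_mono_def)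
qed

lemma RaPar_eq_Span:
  assumes "mono_fact C" "mono_fact D"
  shows "RaPar C = Span C"
    and "fctr_eq (RaPar C) (RaPar_fctr D F) (Span_fctr D F)"
    and "nt_eq (RaPar C) (RaPar_nt D F \<alpha>) (Span_nt D F \<alpha>)"
  using assms
  by (simp_all add: mono_fact.RaPar_Span RaPar_fctr_def Span_fctr_def RaPar_nt_def Span_nt_def
      mono_fact.z_equiv_span_iso fctr_eq_def nt_eq_def)

text \<open>The 2-categories are not formed as HOL objects. The equivalence is expressed by laws for
  arbitrary objects over independent carrier types: 2-functors both ways, 2-natural unit and counit,
  and the triangle identities. Invertibility of the counit and unit is supplied by the first two
  clauses.\<close>

theorem corollary8:
  fixes C :: "('oc, 'mc) fact_cat" and D :: "('od, 'md) fact_cat" and E :: "('oe, 'me) fact_cat"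
    and X :: "('ox, 'mx) range_cat" and Y :: "('oy, 'my) range_cat" and Z :: "('oz, 'mz) range_cat"
  shows
    \<comment> \<open>every object of SplitRangeCat is fixed\<close>
    "(split_range_cat X \<longrightarrow> range_iso_1cell (RaPar (Total X)) X (counit_fctr X)) \<and>
    \<comment> \<open>the fixed objects of StableFact\<close>
    (stable_fact C \<longrightarrow>
      (fact_iso_1cell C (Total (RaPar C)) (unit_fctr C) \<longleftrightarrow> (\<forall>s \<in> SS C. is_mono C s))) \<and>
    \<comment> \<open>RaPar restricts to a 2-functor from StableFact_mono to SplitRangeCat\<close>
    (stable_fact_mono C \<and> stable_fact_mono D \<and> stable_fact_mono E \<longrightarrow>
      split_range_cat (RaPar C) \<and>
      (\<forall>F. fact_1cell C D F \<longrightarrow> range_1cell (RaPar C) (RaPar D) (RaPar_fctr D F)) \<and>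
      (\<forall>F G \<alpha>. fact_2cell C D F G \<alpha> \<longrightarrow>
        range_2cell (RaPar C) (RaPar D) (RaPar_fctr D F) (RaPar_fctr D G) (RaPar_nt D F \<alpha>)) \<and>
      (\<forall>F G. fact_1cell C D F \<and> fact_1cell C D G \<and> fctr_eq C F G \<longrightarrow>
        fctr_eq (RaPar C) (RaPar_fctr D F) (RaPar_fctr D G)) \<and>
      (\<forall>F F' G G' \<alpha> \<alpha>'. fact_2cell C D F G \<alpha> \<and> fact_2cell C D F' G' \<alpha>' \<and>
          fctr_eq C F F' \<and> fctr_eq C G G' \<and> nt_eq C \<alpha> \<alpha>' \<longrightarrow>
        nt_eq (RaPar C) (RaPar_nt D F \<alpha>) (RaPar_nt D F' \<alpha>')) \<and>
      fctr_eq (RaPar C) (RaPar_fctr C id_fctr) id_fctr \<and>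
      (\<forall>F G. fact_1cell C D F \<and> fact_1cell D E G \<longrightarrow>
        fctr_eq (RaPar C) (RaPar_fctr E (comp_fctr G F))
          (comp_fctr (RaPar_fctr E G) (RaPar_fctr D F))) \<and>
      (\<forall>F. fact_1cell C D F \<longrightarrow>
        nt_eq (RaPar C) (RaPar_nt D F (id_nt D F)) (id_nt (RaPar D) (RaPar_fctr D F))) \<and>
      (\<forall>F G H \<alpha> \<beta>. fact_2cell C D F G \<alpha> \<and> fact_2cell C D G H \<beta> \<longrightarrow>
        nt_eq (RaPar C) (RaPar_nt D F (vcomp D \<beta> \<alpha>))
          (vcomp (RaPar D) (RaPar_nt D G \<beta>) (RaPar_nt D F \<alpha>))) \<and>
      (\<forall>F F' G G' \<alpha> \<beta>. fact_2cell C D F F' \<alpha> \<and> fact_2cell D E G G' \<beta> \<longrightarrow>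
        nt_eq (RaPar C) (RaPar_nt E (comp_fctr G F) (hcomp E G F' \<beta> \<alpha>))
          (hcomp (RaPar E) (RaPar_fctr E G) (RaPar_fctr D F') (RaPar_nt E G \<beta>) (RaPar_nt D F \<alpha>)))) \<and>
    \<comment> \<open>Total is a 2-functor from SplitRangeCat to StableFact_mono\<close>
    (split_range_cat X \<and> split_range_cat Y \<and> split_range_cat Z \<longrightarrow>
      stable_fact_mono (Total X) \<and>
      (\<forall>F. range_1cell X Y F \<longrightarrow> fact_1cell (Total X) (Total Y) (Total_fctr X F)) \<and>
      (\<forall>F G \<alpha>. range_2cell X Y F G \<alpha> \<longrightarrow>
        fact_2cell (Total X) (Total Y) (Total_fctr X F) (Total_fctr X G) (Total_nt \<alpha>)) \<and>
      (\<forall>F G. range_1cell X Y F \<and> range_1cell X Y G \<and> fctr_eq X F G \<longrightarrow>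
        fctr_eq (Total X) (Total_fctr X F) (Total_fctr X G)) \<and>
      (\<forall>F F' G G' \<alpha> \<alpha>'. range_2cell X Y F G \<alpha> \<and> range_2cell X Y F' G' \<alpha>' \<and>
          fctr_eq X F F' \<and> fctr_eq X G G' \<and> nt_eq X \<alpha> \<alpha>' \<longrightarrow>
        nt_eq (Total X) (Total_nt \<alpha>) (Total_nt \<alpha>')) \<and>
      fctr_eq (Total X) (Total_fctr X id_fctr) id_fctr \<and>
      (\<forall>F G. range_1cell X Y F \<and> range_1cell Y Z G \<longrightarrow>
        fctr_eq (Total X) (Total_fctr X (comp_fctr G F))
          (comp_fctr (Total_fctr Y G) (Total_fctr X F))) \<and>
      (\<forall>F. range_1cell X Y F \<longrightarrow>
        nt_eq (Total X) (Total_nt (id_nt Y F)) (id_nt (Total Y) (Total_fctr X F))) \<and>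
      (\<forall>F G H \<alpha> \<beta>. range_2cell X Y F G \<alpha> \<and> range_2cell X Y G H \<beta> \<longrightarrow>
        nt_eq (Total X) (Total_nt (vcomp Y \<beta> \<alpha>)) (vcomp (Total Y) (Total_nt \<beta>) (Total_nt \<alpha>))) \<and>
      (\<forall>F F' G G' \<alpha> \<beta>. range_2cell X Y F F' \<alpha> \<and> range_2cell Y Z G G' \<beta> \<longrightarrow>
        nt_eq (Total X) (Total_nt (hcomp Z G F' \<beta> \<alpha>))
          (hcomp (Total Z) (Total_fctr Y G) (Total_fctr X F') (Total_nt \<beta>) (Total_nt \<alpha>)))) \<and>
    \<comment> \<open>the unit is 2-natural on StableFact_mono\<close>
    (stable_fact_mono C \<and> stable_fact_mono D \<longrightarrow>
      (\<forall>F. fact_1cell C D F \<longrightarrow>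
        fctr_eq C (comp_fctr (Total_fctr (RaPar C) (RaPar_fctr D F)) (unit_fctr C))
          (comp_fctr (unit_fctr D) F)) \<and>
      (\<forall>F G \<alpha>. fact_2cell C D F G \<alpha> \<longrightarrow>
        nt_eq C (whisker_right (Total_nt (RaPar_nt D F \<alpha>)) (unit_fctr C))
          (whisker_left (unit_fctr D) \<alpha>))) \<and>
    \<comment> \<open>the counit is 2-natural\<close>
    (split_range_cat X \<and> split_range_cat Y \<longrightarrow>
      (\<forall>F. range_1cell X Y F \<longrightarrow>
        fctr_eq (RaPar (Total X))
          (comp_fctr (counit_fctr Y) (RaPar_fctr (Total Y) (Total_fctr X F)))
          (comp_fctr F (counit_fctr X))) \<and>
      (\<forall>F G \<alpha>. range_2cell X Y F G \<alpha> \<longrightarrow>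
        nt_eq (RaPar (Total X))
          (whisker_left (counit_fctr Y) (RaPar_nt (Total Y) (Total_fctr X F) (Total_nt \<alpha>)))
          (whisker_right \<alpha> (counit_fctr X)))) \<and>
    \<comment> \<open>triangle identities\<close>
    (stable_fact_mono C \<longrightarrow>
      fctr_eq (RaPar C)
        (comp_fctr (counit_fctr (RaPar C)) (RaPar_fctr (Total (RaPar C)) (unit_fctr C))) id_fctr) \<and>
    (split_range_cat X \<longrightarrow>
      fctr_eq (Total X)
        (comp_fctr (Total_fctr (RaPar (Total X)) (counit_fctr X)) (unit_fctr (Total X))) id_fctr) \<and>
    \<comment> \<open>on StableFact_mono, RaPar is the Span construction\<close>
    (stable_fact_mono C \<and> stable_fact_mono D \<longrightarrow>
      RaPar C = Span C \<and>
      (\<forall>F. fact_1cell C D F \<longrightarrow> fctr_eq (RaPar C) (RaPar_fctr D F) (Span_fctr D F)) \<and>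
      (\<forall>F G \<alpha>. fact_2cell C D F G \<alpha> \<longrightarrow> nt_eq (RaPar C) (RaPar_nt D F \<alpha>) (Span_nt D F \<alpha>)))"
  unfolding stable_fact_mono_iff
proof (intro conjI)
  show "split_range_cat X \<longrightarrow> range_iso_1cell (RaPar (Total X)) X (counit_fctr X)"
    using plain_split_range_cat.counit_iso plainI by blast
  show "stable_fact C \<longrightarrow>
      (fact_iso_1cell C (Total (RaPar C)) (unit_fctr C) \<longleftrightarrow> (\<forall>s \<in> SS C. is_mono C s))"
    using unit_iso_iff_mono by blast
  show "mono_fact C \<longrightarrow> fctr_eq (RaPar C)
        (comp_fctr (counit_fctr (RaPar C)) (RaPar_fctr (Total (RaPar C)) (unit_fctr C))) id_fctr"
    using mono_fact.counit_unit by blast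
  show "split_range_cat X \<longrightarrow> fctr_eq (Total X)
        (comp_fctr (Total_fctr (RaPar (Total X)) (counit_fctr X)) (unit_fctr (Total X))) id_fctr"
    using plain_split_range_cat.unit_counit plainI by blast
qed (intro conjI impI allI; (elim conjE)?;
    rule mono_fact.RaPar_split_range_cat RaPar_1cell RaPar_2cell RaPar_2functor
      Total_mono_factI Total_1cell Total_2cell Total_2functor
      unit_2natural counit_2natural RaPar_eq_Span; assumption)+

end
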